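(* Assume: (i) there is a constant $\lambda_H>0$ such that $H(U,x,t)\succeq \lambda_H I_{hm}$ for all $U\in\mathbb{R}^{hm}$, $x\in\mathbb{R}^n$, $t\in\mathbb{R}$; (ii) there is a constant $c_u^f>0$ such that $\left\|\frac{\partial f}{\partial u}(x,u,t)\right\|\le c_u^f$ for all $x\in\mathbb{R}^n$, $u\in\mathbb{R}^m$, $t\in\mathbb{R}$. Suppose there exist uniformly positive definite matrices $P:\mathbb{R}^n\times\mathbb{R}\to\mathbb{R}^{n\times n}$, $Q:\mathbb{R}^{hm}\times\mathbb{R}\to\mathbb{R}^{hm\times hm}$ and constants $\beta_x,\beta_z,\beta_{\mathrm p}$ with $\beta_x>\beta_{\mathrm p}>0$, $\beta_z>0$ such that $$\mathrm{L}[Q,\eta,z,\beta_z](z,t)\preceq0\qquad\text{for all } z\in\mathbb{R}^{hm},\ t\in\mathbb{R},$$ $$\left\langle P_{xU}(x,u_{\mathrm r},t)\,K(U,x,t)\right\rangle-\beta_{\mathrm p}P(x,t)\preceq0\qquad\text{for all } U\in\mathbb{R}^{hm},\ x\in\mathbb{R}^n,\ t\in\mathbb{R},\ \text{ where } u_{\mathrm r}=\Pi_0U-\Pi_0U^\ast(x,t),$$ $$\mathrm{L}[P,f_{\mathrm r},x,\beta_x+\beta_{\mathrm p}](x,u_{\mathrm r},t)\preceq0\qquad\text{for all } x\in\mathbb{R}^n,\ u_{\mathrm r}\in\mathbb{R}^m,\ t\in\mathbb{R}.$$ Then there exists $\gamma>0$ such that $\mathrm{L}[M,\phi,s,\gamma](s,t)\preceq0$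 (for all $s\in\mathbb{R}^{n+hm}$, $t\in\mathbb{R}$) holds for the metric $M$ built from $P$, $Q$ and the constant $\kappa$ as defined in the context. Moreover, the closed-loop system $\dot s(t)=\phi(s(t),t)$ is contracting under the assumption that there exists a constant $c_x^\zeta>0$ such that $\left\|\frac{\partial\zeta}{\partial x}(U,x,t)\right\|\le c_x^\zeta$ for all $U\in\mathbb{R}^{hm}$, $x\in\mathbb{R}^n$, $t\in\mathbb{R}$. Furthermore, if $\eta(0,t)=0$ for any $t\in\mathbb{R}$, then $x(t)$ determined by the closed-loop system $\dot s(t)=\phi(s(t),t)$, $s=[x;U]$, converges to the optimally controlled state determined by $\dot x^\ast(t)=f(x^\ast(t),\Pi_0U^\ast(x^\ast(t),t),t)$.
   Context: **Conventions.** All functions are assumed differentiable an arbitrary number of times. $\langle S\rangle:=S+S^\top$ for a square matrix $S$. $[v^1;\dots;v^k]$ denotes vertical concatenation of vectors. For $f(x)\in\mathbb{R}^m$ with $x\in\mathbb{R}^n$, $\frac{\partial f}{\partial x}\in\mathbb{R}^{m\times n}$ is the Jacobian. A symmetric-matrix-valued function is *uniformly positive definite* if there is $\epsilon>0$ such that its value is $\succeq\epsilon I$ at every point of its domain. **Plant and optimal control problem.** The plant is $\dot x(t)=f(x(t),u(t),t)$ with $f:\mathbb{R}^n\times\mathbb{R}^m\times\mathbb{R}\to\mathbb{R}^n$. Let $h$ be the horizon and $U=[u^0;\dots;u^{h-1}]\in\mathbb{R}^{hm}$. Given $(U,x,t)$, the predicted states $x^k=x^k(U,x,t)$ are $x^0=x$,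 $x^{k+1}=f_{\mathrm d}(x^k,u^k,t^k)$, $k=0,\dots,h-1$, where $f_{\mathrm d}$ is a discretization of $f$ and $t^k$ are prediction times (typically $t^k=t+k\Delta t$, $f_{\mathrm d}(x^k,u^k,t^k)=x^k+f(x^k,u^k,t^k)\Delta t$). With smooth stage cost $\ell(x,u,t)$ and smooth terminal cost $\Phi(x,t)$, set $$V(U,x,t)=\Phi(x^h(U,x,t),t^h)+\sum_{k=0}^{h-1}\ell(x^k(U,x,t),u^k,t^k),$$ $U^\ast(x,t)=\arg\min_U V(U,x,t)$, $\zeta(U,x,t)=\nabla_UV(U,x,t)\in\mathbb{R}^{hm}$, $H(U,x,t)=\frac{\partial\zeta}{\partial U}(U,x,t)$. With $s=[x;U]$, write $\zeta(s,t)=\zeta(U,x,t)$ and $\frac{\partial\zeta}{\partial s}=\left[\frac{\partial\zeta}{\partial x}\ \ H\right]$. **Continuation method.** A function $\eta:\mathbb{R}^{hm}\times\mathbb{R}\to\mathbb{R}^{hm}$ is given (virtual dynamics $\dot z=\eta(z,t)$, $z=\zeta(U,x,t)$). Let $\Pi_0=[I_m\ 0\ \cdots\ 0]\in\mathbb{R}^{m\times hm}$ and $u=\Pi_0U$. Define $$b(U,x,t)=\eta(\zeta(U,x,t),t)-\frac{\partial\zeta}{\partial x}(U,x,t)f(x,\Pi_0U,t)-\frac{\partial\zeta}{\partial t}(U,x,t),$$ $$\phi(s,t)=\left[f(x,\Pi_0U,t);\ H(U,x,t)^{-1}b(U,x,t)\right].$$ The closed-loop system is $\dot s(t)=\phi(s(t),t)$.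 **Metric.** For uniformly positive definite $P$, $Q$ as in the claim, and with $\kappa>0$ a constant, $$M(s,t)=\begin{bmatrix}P(x,t)&0\\0&0\end{bmatrix}+\kappa\left(\frac{\partial\zeta}{\partial s}(s,t)\right)^{\top}Q(\zeta(s,t),t)\,\frac{\partial\zeta}{\partial s}(s,t),\qquad s=[x;U].$$ **Residual dynamics.** $f_{\mathrm r}(x,u_{\mathrm r},t)=f(x,\Pi_0U^\ast(x,t)+u_{\mathrm r},t)$, and $$P_{xU}(x,u_{\mathrm r},t)=P(x,t)\frac{\partial f_{\mathrm r}}{\partial u_{\mathrm r}}(x,u_{\mathrm r},t)\Pi_0,\qquad K(U,x,t)=-H^{-1}(U,x,t)\frac{\partial\zeta}{\partial x}(U,x,t)-\frac{\partial U^\ast}{\partial x}(x,t).$$ **Operator $\mathrm L$.** For a vector field $g$ in the variable $y\in\mathbb{R}^N$ (possibly depending on an additional variable $v$ and on $t$), a matrix function $W(y,t)\in\mathbb{R}^{N\times N}$ and a constant $\gamma$, $$\mathrm{L}[W,g,y,\gamma]=\sum_{i=1}^{N}g_i\frac{\partial W}{\partial y_i}+\frac{\partial W}{\partial t}+\left\langle W\frac{\partial g}{\partial y}\right\rangle+\gamma W,$$ evaluated at $(y,t)$, or at $(y,v,t)$ if $g$ depends on $v$; $\frac{\partial g}{\partial y}$ is taken with $v$ and $t$ fixed. **Contracting.** A system $\dot s=\phi(s,t)$ with $s\in\mathbb{R}^N$ is *contracting* if there exist a uniformly positive definite $M:\mathbb{R}^N\times\mathbb{R}\to\mathbb{R}^{N\times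 N}$ and a constant $\gamma>0$ such that $\mathrm{L}[M,\phi,s,\gamma](s,t)\preceq0$ for all $s\in\mathbb{R}^N$, $t\in\mathbb{R}$.
   Formalization: The formal theorem additionally assumes that P is uniformly bounded above, P(x,t) ⪯ c I for a constant c (without it the claim fails, e.g. for P = 1 + e^t), and it asserts the matrix inequality for some suitably chosen constant κ > 0, not for every κ. *)

theory Defs
  imports "HOL-Analysis.Analysis"
begin

text \<open>On finite-dimensional spaces, continuity of all iterated directional derivatives
  \<open>\<lambda>x. D f(x) v\<close> is the usual notion of being \<open>k\<close> times continuously differentiable.\<close>

primrec times_cont_diff :: "nat \<Rightarrow> ('a::real_normed_vector \<Rightarrow> 'b::real_normed_vector) \<Rightarrow> bool" where
  "times_cont_diff 0 f \<longleftrightarrow> continuous_on UNIV f"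
| "times_cont_diff (Suc k) f \<longleftrightarrow>
     (\<forall>x. f differentiable (at x)) \<and>
     (\<forall>v. times_cont_diff k (\<lambda>x. frechet_derivative f (at x) v))"

definition smooth :: "('a::real_normed_vector \<Rightarrow> 'b::real_normed_vector) \<Rightarrow> bool" where
  "smooth f \<longleftrightarrow> (\<forall>k. times_cont_diff k f)"

definition sym_sum :: "real^'n^'n \<Rightarrow> real^'n^'n" where
  "sym_sum S = S + transpose S"

definition pos_semidef :: "real^'n^'n \<Rightarrow> bool" where
  "pos_semidef A \<longleftrightarrow> transpose A = A \<and> (\<forall>v. 0 \<le> v \<bullet> (A *v v))"

definition loewner_le :: "real^'n^'n \<Rightarrow> real^'n^'n \<Rightarrow> bool" (infix "\<preceq>\<^sub>L" 50) where
  "A \<preceq>\<^sub>L B \<longleftrightarrow> pos_semidef (B - A)"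

text \<open>Symmetry of all values is included, since \<open>mat \<epsilon> \<preceq>\<^sub>L W y t\<close> makes \<open>W y t\<close> symmetric.
  No upper bound is imposed.\<close>

definition uniformly_pos_def :: "('d \<Rightarrow> real \<Rightarrow> real^'n^'n) \<Rightarrow> bool" where
  "uniformly_pos_def W \<longleftrightarrow> (\<exists>\<epsilon>>0. \<forall>y t. mat \<epsilon> \<preceq>\<^sub>L W y t)"

definition mat_norm :: "real^'n^'m \<Rightarrow> real" where
  "mat_norm A = onorm ((*v) A)"

text \<open>A vector field with a further argument \<open>v\<close> is passed as \<open>\<lambda>y t. g y v t\<close>, so that \<open>v\<close> is held
  fixed in the Jacobian.\<close>

definition L_op :: "(real^'N \<Rightarrow> real \<Rightarrow> real^'N^'N) \<Rightarrow> (real^'N \<Rightarrow> real \<Rightarrow> real^'N) \<Rightarrow> real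
    \<Rightarrow> real^'N \<Rightarrow> real \<Rightarrow> real^'N^'N" where
  "L_op W g \<gamma> y t =
     (\<Sum>i\<in>UNIV. (g y t $ i) *\<^sub>R frechet_derivative (\<lambda>y. W y t) (at y) (axis i 1))
     + vector_derivative (\<lambda>t. W y t) (at t)
     + sym_sum (W y t ** jacobian (\<lambda>y. g y t) (at y))
     + \<gamma> *\<^sub>R W y t"

definition contracting :: "(real^'N \<Rightarrow> real \<Rightarrow> real^'N) \<Rightarrow> bool" where
  "contracting \<phi> \<longleftrightarrow>
     (\<exists>M \<gamma>. smooth (\<lambda>(s, t). M s t) \<and> uniformly_pos_def M \<and> \<gamma> > 0 \<and>
            (\<forall>s t. L_op M \<phi> \<gamma> s t \<preceq>\<^sub>L 0))"

definition solution_from :: "('a::real_normed_vector \<Rightarrow> real \<Rightarrow> 'a) \<Rightarrow> real \<Rightarrow> (real \<Rightarrow> 'a) \<Rightarrow> bool" where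
  "solution_from g t0 y \<longleftrightarrow>
     (\<forall>t\<ge>t0. (y has_vector_derivative g (y t) t) (at t within {t0..}))"

text \<open>The horizon is \<open>h = CARD('h)\<close>, and \<open>U = [u\<^sup>0; \<dots>; u\<^bsup>h-1\<^esup>]\<close> is a vector with index type
  \<open>'h \<times> 'm\<close>; the linear order on \<open>'h\<close> only serves to number the stages \<open>0, \<dots>, h - 1\<close>.\<close>

definition stage :: "nat \<Rightarrow> 'h::{finite,linorder}" where
  "stage k = sorted_list_of_set UNIV ! k"

definition input_at :: "real^('h::{finite,linorder} \<times> 'm::finite) \<Rightarrow> nat \<Rightarrow> real^'m" where
  "input_at U k = (\<chi> j. U $ (stage k, j))"

definition Pi0 :: "real^('h::{finite,linorder} \<times> 'm::finite)^'m" where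
  "Pi0 = (\<chi> i kj. if kj = (stage 0, i) then 1 else 0)"

definition vcat :: "real^'a \<Rightarrow> real^'b \<Rightarrow> real^('a::finite + 'b::finite)" where
  "vcat x U = (\<chi> i. case i of Inl a \<Rightarrow> x $ a | Inr b \<Rightarrow> U $ b)"

definition upper_part :: "real^('a::finite + 'b::finite) \<Rightarrow> real^'a" where
  "upper_part s = (\<chi> a. s $ Inl a)"

definition lower_part :: "real^('a::finite + 'b::finite) \<Rightarrow> real^'b" where
  "lower_part s = (\<chi> b. s $ Inr b)"

definition upper_left_block :: "real^'a^'a \<Rightarrow> real^('a::finite + 'b::finite)^('a + 'b)" where
  "upper_left_block A =
     (\<chi> i j. case (i, j) of (Inl a, Inl a') \<Rightarrow> A $ a $ a' | _ \<Rightarrow> 0)"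

primrec predicted_state ::
  "(real^'n \<Rightarrow> real^'m \<Rightarrow> real \<Rightarrow> real^'n) \<Rightarrow> (nat \<Rightarrow> real \<Rightarrow> real)
    \<Rightarrow> real^('h::{finite,linorder} \<times> 'm::finite) \<Rightarrow> real^'n \<Rightarrow> real \<Rightarrow> nat \<Rightarrow> real^'n" where
  "predicted_state fd tk U x t 0 = x"
| "predicted_state fd tk U x t (Suc k) =
     fd (predicted_state fd tk U x t k) (input_at U k) (tk k t)"

definition ocp_cost ::
  "(real^'n \<Rightarrow> real^'m \<Rightarrow> real \<Rightarrow> real^'n) \<Rightarrow> (nat \<Rightarrow> real \<Rightarrow> real)
    \<Rightarrow> (real^'n \<Rightarrow> real^'m \<Rightarrow> real \<Rightarrow> real) \<Rightarrow> (real^'n \<Rightarrow> real \<Rightarrow> real)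
    \<Rightarrow> real^('h::{finite,linorder} \<times> 'm::finite) \<Rightarrow> real^'n \<Rightarrow> real \<Rightarrow> real" where
  "ocp_cost fd tk ell \<Phi> U x t =
     \<Phi> (predicted_state fd tk U x t CARD('h)) (tk CARD('h) t)
     + (\<Sum>k<CARD('h). ell (predicted_state fd tk U x t k) (input_at U k) (tk k t))"

text \<open>The remaining notions depend on the optimal control problem only through the cost
  \<open>V U x t\<close>.\<close>

definition U_opt :: "(real^'r \<Rightarrow> real^'n \<Rightarrow> real \<Rightarrow> real) \<Rightarrow> real^'n \<Rightarrow> real \<Rightarrow> real^'r" where
  "U_opt V x t = (ARG_MIN (\<lambda>U. V U x t) U. True)"

definition gradient :: "(real^'r \<Rightarrow> real) \<Rightarrow> real^'r \<Rightarrow> real^'r" where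
  "gradient g U = (\<chi> i. frechet_derivative g (at U) (axis i 1))"

definition zeta :: "(real^'r \<Rightarrow> real^'n \<Rightarrow> real \<Rightarrow> real) \<Rightarrow> real^'r \<Rightarrow> real^'n \<Rightarrow> real \<Rightarrow> real^'r" where
  "zeta V U x t = gradient (\<lambda>U. V U x t) U"

definition zeta_U :: "(real^'r \<Rightarrow> real^'n \<Rightarrow> real \<Rightarrow> real) \<Rightarrow> real^'r \<Rightarrow> real^'n \<Rightarrow> real \<Rightarrow> real^'r^'r" where
  "zeta_U V U x t = jacobian (\<lambda>U. zeta V U x t) (at U)"

definition zeta_x :: "(real^'r \<Rightarrow> real^'n \<Rightarrow> real \<Rightarrow> real) \<Rightarrow> real^'r \<Rightarrow> real^'n \<Rightarrow> real \<Rightarrow> real^'n^'r" where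
  "zeta_x V U x t = jacobian (\<lambda>x. zeta V U x t) (at x)"

definition zeta_t :: "(real^'r \<Rightarrow> real^'n \<Rightarrow> real \<Rightarrow> real) \<Rightarrow> real^'r \<Rightarrow> real^'n \<Rightarrow> real \<Rightarrow> real^'r" where
  "zeta_t V U x t = vector_derivative (\<lambda>t. zeta V U x t) (at t)"

definition zeta_s :: "(real^'r \<Rightarrow> real^'n \<Rightarrow> real \<Rightarrow> real)
    \<Rightarrow> real^('n::finite + 'r::finite) \<Rightarrow> real \<Rightarrow> real^('n + 'r)^'r" where
  "zeta_s V s t = jacobian (\<lambda>s. zeta V (lower_part s) (upper_part s) t) (at s)"

definition continuation_rhs :: "(real^'n \<Rightarrow> real^'m \<Rightarrow> real \<Rightarrow> real^'n)
    \<Rightarrow> (real^('h::{finite,linorder} \<times> 'm::finite) \<Rightarrow> real^'n \<Rightarrow> real \<Rightarrow> real)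
    \<Rightarrow> (real^('h \<times> 'm) \<Rightarrow> real \<Rightarrow> real^('h \<times> 'm))
    \<Rightarrow> real^('h \<times> 'm) \<Rightarrow> real^'n \<Rightarrow> real \<Rightarrow> real^('h \<times> 'm)" where
  "continuation_rhs f V \<eta> U x t =
     \<eta> (zeta V U x t) t - zeta_x V U x t *v f x (Pi0 *v U) t - zeta_t V U x t"

definition closed_loop :: "(real^'n \<Rightarrow> real^'m \<Rightarrow> real \<Rightarrow> real^'n)
    \<Rightarrow> (real^('h::{finite,linorder} \<times> 'm::finite) \<Rightarrow> real^'n \<Rightarrow> real \<Rightarrow> real)
    \<Rightarrow> (real^('h \<times> 'm) \<Rightarrow> real \<Rightarrow> real^('h \<times> 'm))
    \<Rightarrow> real^('n::finite + 'h \<times> 'm) \<Rightarrow> real \<Rightarrow> real^('n + 'h \<times> 'm)" where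
  "closed_loop f V \<eta> s t =
     (let x = upper_part s; U = lower_part s in
      vcat (f x (Pi0 *v U) t)
           (matrix_inv (zeta_U V U x t) *v continuation_rhs f V \<eta> U x t))"

definition contr_metric :: "(real^'r \<Rightarrow> real^'n \<Rightarrow> real \<Rightarrow> real)
    \<Rightarrow> (real^'n \<Rightarrow> real \<Rightarrow> real^'n^'n) \<Rightarrow> (real^'r \<Rightarrow> real \<Rightarrow> real^'r^'r) \<Rightarrow> real
    \<Rightarrow> real^('n::finite + 'r::finite) \<Rightarrow> real \<Rightarrow> real^('n + 'r)^('n + 'r)" where
  "contr_metric V P Q \<kappa> s t =
     (let x = upper_part s; U = lower_part s in
      upper_left_block (P x t)
      + \<kappa> *\<^sub>R (transpose (zeta_s V s t) ** Q (zeta V U x t) t ** zeta_s V s t))"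

definition f_res :: "(real^'n \<Rightarrow> real^'m \<Rightarrow> real \<Rightarrow> real^'n)
    \<Rightarrow> (real^('h::{finite,linorder} \<times> 'm::finite) \<Rightarrow> real^'n \<Rightarrow> real \<Rightarrow> real)
    \<Rightarrow> real^'n \<Rightarrow> real^'m \<Rightarrow> real \<Rightarrow> real^'n" where
  "f_res f V x ur t = f x (Pi0 *v U_opt V x t + ur) t"

definition P_xU :: "(real^'n \<Rightarrow> real^'m \<Rightarrow> real \<Rightarrow> real^'n)
    \<Rightarrow> (real^('h::{finite,linorder} \<times> 'm::finite) \<Rightarrow> real^'n \<Rightarrow> real \<Rightarrow> real)
    \<Rightarrow> (real^'n \<Rightarrow> real \<Rightarrow> real^'n^'n)
    \<Rightarrow> real^'n \<Rightarrow> real^'m \<Rightarrow> real \<Rightarrow> real^('h \<times> 'm)^'n" where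
  "P_xU f V P x ur t = P x t ** jacobian (\<lambda>ur. f_res f V x ur t) (at ur) ** Pi0"

definition K_mat :: "(real^'r \<Rightarrow> real^'n \<Rightarrow> real \<Rightarrow> real)
    \<Rightarrow> real^'r \<Rightarrow> real^'n \<Rightarrow> real \<Rightarrow> real^'n^'r" where
  "K_mat V U x t =
     - (matrix_inv (zeta_U V U x t) ** zeta_x V U x t) - jacobian (\<lambda>x. U_opt V x t) (at x)"

end

theory Submission
  imports Defs
begin

text \<open>
  The continuation method makes the residual \<open>z = \<zeta>(U, x, t)\<close> of the optimality condition follow the
  prescribed dynamics \<open>z' = \<eta>(z, t)\<close>.  Because the Hessian \<open>H = \<partial>\<zeta>/\<partial>U\<close> is uniformly positive
  definite, \<open>(x, U) \<mapsto> (x, z)\<close> is a change of coordinates, and the metric \<open>M\<close> is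
  \<open>diag(P, \<kappa> Q)\<close> written in the old ones.

  \<^emph>\<open>The matrix inequality.\<close>  The quadratic form of \<open>L[W, g, y, \<gamma>]\<close> at \<open>v\<close> is the derivative of the
  energy \<open>v \<bullet> W v\<close> along \<open>g\<close> and its variational equation, plus \<open>\<gamma>\<close> times the energy
  (\<open>inner_L_op\<close>).  A variation \<open>(\<delta>x, \<delta>U)\<close> induces the variation \<open>w = \<zeta>\<^sub>x \<delta>x + H \<delta>U\<close> of the residual,
  which obeys \<open>w' = \<eta>\<^sub>z w\<close> (\<open>virtual_variation\<close>, by symmetry of second derivatives).  Hence the energy of
  \<open>M\<close> splits into \<open>\<delta>x \<bullet> P \<delta>x\<close> and \<open>\<kappa> (w \<bullet> Q w)\<close> and so does its rate.  The second part decays at rate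
  \<open>\<beta>\<^sub>z\<close>.  In the first part \<open>\<delta>U = H\<^sup>-\<^sup>1 w + K \<delta>x + U\<^sup>*\<^sub>x \<delta>x\<close>, so the conditions on the residual
  dynamics and on \<open>K\<close> give decay at rate \<open>\<beta>\<^sub>x\<close> up to a term that is linear in \<open>w\<close>
  (\<open>plant_energy_rate_le\<close>).  That term is bounded because \<open>P\<close>, \<open>\<partial>f/\<partial>u\<close> and \<open>H\<^sup>-\<^sup>1\<close> are, and a large
  \<open>\<kappa>\<close> absorbs it (\<open>L_op_contr_metric_le\<close>).  The derivative \<open>U\<^sup>*\<^sub>x\<close> exists by implicit differentiation
  of \<open>\<zeta>(U\<^sup>*(x, t), x, t) = 0\<close>.

  \<^emph>\<open>Contraction.\<close>  If \<open>\<zeta>\<^sub>x\<close> is bounded, then \<open>\<delta>U = H\<^sup>-\<^sup>1 (w - \<zeta>\<^sub>x \<delta>x)\<close> is bounded by the energy, so \<open>M\<close> is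
  uniformly positive definite.

  \<^emph>\<open>Convergence.\<close>  If \<open>\<eta>(0, t) = 0\<close>, the optimally controlled state together with its optimal input
  is a solution of the closed loop (\<open>optimal_solution\<close>).  Any two closed loop solutions approach each
  other in the coordinates \<open>(x, z)\<close>, where the metric is uniformly positive definite: a curve
  joining them is transported in small Euler steps, and the energy of its tangent vectors decays
  (\<open>solutions_contract\<close>).
\<close>

section \<open>Calculus of smooth maps\<close>

named_theorems smooth_intros

lemma times_cont_diff_SucI:
  assumes "\<And>x. (f has_derivative D x) (at x)" and "\<And>v. times_cont_diff k (\<lambda>x. D x v)"
  shows "times_cont_diff (Suc k) f"
proof -
  have "frechet_derivative f (at x) = D x" for x
    using assms(1) by (metis frechet_derivative_at)
  then show ?thesis using assms by (auto simp: differentiable_def)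
qed

lemma times_cont_diff_has_derivative:
  "times_cont_diff (Suc k) f \<Longrightarrow> (f has_derivative frechet_derivative f (at x)) (at x)"
  by (simp add: frechet_derivative_works)

lemma times_cont_diff_Suc:
  "times_cont_diff (Suc k) f \<Longrightarrow> times_cont_diff k f"
proof (induction k arbitrary: f)
  case 0
  then show ?case
    by (auto intro!: continuous_at_imp_continuous_on differentiable_imp_continuous_within)
next
  case (Suc k)
  show ?case
    by (rule times_cont_diff_SucI[OF times_cont_diff_has_derivative[OF Suc.prems]])
       (use Suc in auto)
qed

lemma times_cont_diff_const: "times_cont_diff k (\<lambda>x. c)"
  by (induction k arbitrary: c) simp_all

lemma times_cont_diff_linear:
  assumes "bounded_linear L" shows "times_cont_diff k L"
proof (cases k)
  case 0
  then show ?thesis using assms by (simp add: linear_continuous_on)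
next
  case (Suc j)
  show ?thesis unfolding Suc
    by (rule times_cont_diff_SucI[OF bounded_linear_imp_has_derivative[OF assms]])
       (rule times_cont_diff_const)
qed

lemma times_cont_diff_compose_linear:
  assumes "bounded_linear L" and "times_cont_diff k f"
  shows "times_cont_diff k (\<lambda>x. L (f x))"
  using assms(2)
proof (induction k arbitrary: f)
  case 0
  then show ?case using assms(1)
    by (simp add: bounded_linear.continuous_on)
next
  case (Suc k)
  show ?case
    by (rule times_cont_diff_SucI[OF bounded_linear.has_derivative[OF assms(1)
          times_cont_diff_has_derivative[OF Suc.prems]]])
       (use Suc in auto)
qed

lemma times_cont_diff_add:
  "times_cont_diff k f \<Longrightarrow> times_cont_diff k g \<Longrightarrow> times_cont_diff k (\<lambda>x. f x + g x)"
proof (induction k arbitrary: f g)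
  case 0
  then show ?case by (simp add: continuous_on_add)
next
  case (Suc k)
  show ?case
    by (rule times_cont_diff_SucI[OF has_derivative_add[OF
          times_cont_diff_has_derivative[OF Suc.prems(1)]
          times_cont_diff_has_derivative[OF Suc.prems(2)]]])
       (use Suc in auto)
qed

lemma times_cont_diff_bilinear:
  assumes "bounded_bilinear B"
  shows "times_cont_diff k f \<Longrightarrow> times_cont_diff k g \<Longrightarrow> times_cont_diff k (\<lambda>x. B (f x) (g x))"
proof (induction k arbitrary: f g)
  case 0
  then show ?case using assms by (simp add: bounded_bilinear.continuous_on)
next
  case (Suc k)
  have k: "times_cont_diff k f" "times_cont_diff k g"
    using Suc.prems by (auto intro: times_cont_diff_Suc)
  show ?case
    by (rule times_cont_diff_SucI[OF bounded_bilinear.FDERIV[OF assms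
          times_cont_diff_has_derivative[OF Suc.prems(1)]
          times_cont_diff_has_derivative[OF Suc.prems(2)]]])
       (use Suc k in \<open>auto intro!: times_cont_diff_add\<close>)
qed

lemma times_cont_diff_sum:
  assumes "\<And>i. i \<in> I \<Longrightarrow> times_cont_diff k (f i)"
  shows "times_cont_diff k (\<lambda>x. \<Sum>i\<in>I. f i x)"
  using assms
  by (induction I rule: infinite_finite_induct)
     (simp_all add: times_cont_diff_const times_cont_diff_add)

lemma linear_euclidean_expansion:
  fixes L :: "'a::euclidean_space \<Rightarrow> 'b::real_normed_vector"
  assumes "bounded_linear L"
  shows "L v = (\<Sum>b\<in>Basis. (v \<bullet> b) *\<^sub>R L b)"
proof -
  interpret bounded_linear L by fact
  have "L v = L (\<Sum>b\<in>Basis. (v \<bullet> b) *\<^sub>R b)" by (simp add: euclidean_representation)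
  also have "\<dots> = (\<Sum>b\<in>Basis. (v \<bullet> b) *\<^sub>R L b)" by (simp add: sum scaleR)
  finally show ?thesis .
qed

text \<open>By the chain rule, the derivative of \<open>g \<circ> f\<close> in direction \<open>v\<close> is a sum of products of a
  directional derivative of \<open>f\<close> with one of \<open>g\<close> at \<open>f x\<close>, each of one order less; expanding
  over a basis of the intermediate space is what keeps the induction within directional
  derivatives.\<close>

lemma times_cont_diff_compose:
  fixes g :: "'b::euclidean_space \<Rightarrow> 'c::real_normed_vector"
  shows "times_cont_diff k g \<Longrightarrow> times_cont_diff k f \<Longrightarrow> times_cont_diff k (\<lambda>x. g (f x))"
proof (induction k arbitrary: f g)
  case 0
  then show ?case by (auto intro: continuous_on_compose2)
next
  case (Suc k)
  note f = times_cont_diff_has_derivative[OF Suc.prems(2)]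
  note g = times_cont_diff_has_derivative[OF Suc.prems(1)]
  have D: "((\<lambda>x. g (f x)) has_derivative
      (\<lambda>v. \<Sum>b\<in>Basis. (frechet_derivative f (at x) v \<bullet> b) *\<^sub>R frechet_derivative g (at (f x)) b)) (at x)"
    for x
    using has_derivative_compose[OF f g, of x]
    unfolding linear_euclidean_expansion[OF has_derivative_bounded_linear[OF g[of "f x"]],
        of "frechet_derivative f (at x) v" for v] .
  have k: "times_cont_diff k f" using Suc.prems(2) by (rule times_cont_diff_Suc)
  show ?case
  proof (rule times_cont_diff_SucI[OF D], rule times_cont_diff_sum)
    fix v and b :: 'b
    have "times_cont_diff k (\<lambda>x. frechet_derivative f (at x) v \<bullet> b)"
      using Suc.prems(2)
      by (auto intro!: times_cont_diff_compose_linear[OF bounded_linear_inner_left])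
    moreover have "times_cont_diff k (\<lambda>x. frechet_derivative g (at (f x)) b)"
      using Suc.IH[of "\<lambda>y. frechet_derivative g (at y) b" f] Suc.prems(1) k by simp
    ultimately show "times_cont_diff k (\<lambda>x. (frechet_derivative f (at x) v \<bullet> b) *\<^sub>R frechet_derivative g (at (f x)) b)"
      by (rule times_cont_diff_bilinear[OF bounded_bilinear_scaleR])
  qed
qed

lemma times_cont_diff_inverse:
  fixes f :: "'a::real_normed_vector \<Rightarrow> real"
  assumes "\<And>x. f x \<noteq> 0"
  shows "times_cont_diff k f \<Longrightarrow> times_cont_diff k (\<lambda>x. inverse (f x))"
proof (induction k)
  case 0
  then show ?case using assms by (auto intro!: continuous_on_inverse)
next
  case (Suc k)
  have k: "times_cont_diff k (\<lambda>x. inverse (f x))"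
    using Suc by (simp add: times_cont_diff_Suc del: times_cont_diff.simps)
  have D: "((\<lambda>x. inverse (f x)) has_derivative
     (\<lambda>v. - (inverse (f x) * frechet_derivative f (at x) v * inverse (f x)))) (at x)" for x
    by (rule Deriv.has_derivative_inverse[OF assms times_cont_diff_has_derivative[OF Suc.prems]])
  show ?case
    by (rule times_cont_diff_SucI[OF D])
       (use k Suc.prems in \<open>auto intro!: times_cont_diff_bilinear[OF bounded_bilinear_mult]
          times_cont_diff_compose_linear[OF bounded_linear_minus[OF bounded_linear_ident]]\<close>)
qed

lemma smooth_has_derivative:
  "smooth f \<Longrightarrow> (f has_derivative frechet_derivative f (at x)) (at x)"
  unfolding smooth_def using times_cont_diff_has_derivative by blast

lemma smooth_differentiable: "smooth f \<Longrightarrow> f differentiable (at x)"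
  using smooth_has_derivative differentiable_def by blast

lemma smooth_continuous_on: "smooth f \<Longrightarrow> continuous_on S f"
  unfolding smooth_def using times_cont_diff.simps(1) continuous_on_subset by blast

lemma smooth_const [smooth_intros]: "smooth (\<lambda>x. c)"
  by (simp add: smooth_def times_cont_diff_const)

lemma smooth_bounded_linear: "bounded_linear L \<Longrightarrow> smooth L"
  by (simp add: smooth_def times_cont_diff_linear)

lemma smooth_ident [smooth_intros]: "smooth (\<lambda>x. x)"
  by (simp add: smooth_bounded_linear)

lemma smooth_compose_linear: "bounded_linear L \<Longrightarrow> smooth f \<Longrightarrow> smooth (\<lambda>x. L (f x))"
  by (simp add: smooth_def times_cont_diff_compose_linear)

lemma smooth_add [smooth_intros]: "smooth f \<Longrightarrow> smooth g \<Longrightarrow> smooth (\<lambda>x. f x + g x)"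
  by (simp add: smooth_def times_cont_diff_add)

lemma smooth_bilinear:
  "bounded_bilinear B \<Longrightarrow> smooth f \<Longrightarrow> smooth g \<Longrightarrow> smooth (\<lambda>x. B (f x) (g x))"
  by (simp add: smooth_def times_cont_diff_bilinear)

lemma smooth_minus [smooth_intros]: "smooth f \<Longrightarrow> smooth (\<lambda>x. - f x)"
  by (rule smooth_compose_linear[OF bounded_linear_minus[OF bounded_linear_ident]])

lemma smooth_diff [smooth_intros]: "smooth f \<Longrightarrow> smooth g \<Longrightarrow> smooth (\<lambda>x. f x - g x)"
  using smooth_add[OF _ smooth_minus] by fastforce

lemmas smooth_mult [smooth_intros] = smooth_bilinear[OF bounded_bilinear_mult]
lemmas smooth_scaleR [smooth_intros] = smooth_bilinear[OF bounded_bilinear_scaleR]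
lemmas smooth_inner [smooth_intros] = smooth_bilinear[OF bounded_bilinear_inner]
lemmas smooth_fst [smooth_intros] = smooth_compose_linear[OF bounded_linear_fst]
lemmas smooth_snd [smooth_intros] = smooth_compose_linear[OF bounded_linear_snd]
lemmas smooth_vec_nth [smooth_intros] = smooth_compose_linear[OF bounded_linear_vec_nth]

lemma smooth_sum [smooth_intros]:
  "(\<And>i. i \<in> I \<Longrightarrow> smooth (f i)) \<Longrightarrow> smooth (\<lambda>x. \<Sum>i\<in>I. f i x)"
  by (simp add: smooth_def times_cont_diff_sum)

lemma smooth_prod [smooth_intros]:
  fixes f :: "'i \<Rightarrow> 'a::real_normed_vector \<Rightarrow> real"
  shows "(\<And>i. i \<in> I \<Longrightarrow> smooth (f i)) \<Longrightarrow> smooth (\<lambda>x. \<Prod>i\<in>I. f i x)"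
  by (induction I rule: infinite_finite_induct) (simp_all add: smooth_const smooth_mult)

lemma smooth_Pair [smooth_intros]:
  assumes "smooth f" "smooth g" shows "smooth (\<lambda>x. (f x, g x))"
proof -
  have "smooth (\<lambda>x. (f x, 0) + (0, g x))"
    using assms
    by (intro smooth_add smooth_compose_linear[of "\<lambda>y. (y, 0)"] smooth_compose_linear[of "\<lambda>y. (0, y)"]
        bounded_linear_Pair bounded_linear_ident bounded_linear_zero)
  then show ?thesis by simp
qed

lemma smooth_compose:
  fixes g :: "'b::euclidean_space \<Rightarrow> 'c::real_normed_vector"
  shows "smooth g \<Longrightarrow> smooth f \<Longrightarrow> smooth (\<lambda>x. g (f x))"
  by (simp add: smooth_def times_cont_diff_compose)

lemma smooth_compose2:
  fixes g :: "'a::euclidean_space \<Rightarrow> 'b::euclidean_space \<Rightarrow> 'c::real_normed_vector"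
  assumes "smooth (\<lambda>(a, b). g a b)" "smooth a" "smooth b"
  shows "smooth (\<lambda>x. g (a x) (b x))"
  using smooth_compose[OF assms(1) smooth_Pair[OF assms(2,3)]] by simp

lemma smooth_compose3:
  fixes g :: "'a::euclidean_space \<Rightarrow> 'b::euclidean_space \<Rightarrow> 'c::euclidean_space \<Rightarrow> 'd::real_normed_vector"
  assumes "smooth (\<lambda>(a, b, c). g a b c)" "smooth a" "smooth b" "smooth c"
  shows "smooth (\<lambda>x. g (a x) (b x) (c x))"
  using smooth_compose[OF assms(1) smooth_Pair[OF assms(2) smooth_Pair[OF assms(3,4)]]] by simp

lemma smooth_inverse [smooth_intros]:
  fixes f :: "'a::real_normed_vector \<Rightarrow> real"
  shows "(\<And>x. f x \<noteq> 0) \<Longrightarrow> smooth f \<Longrightarrow> smooth (\<lambda>x. inverse (f x))"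
  by (simp add: smooth_def times_cont_diff_inverse)

lemma smooth_vec_lambda [smooth_intros]:
  fixes f :: "'i::finite \<Rightarrow> 'a::real_normed_vector \<Rightarrow> 'b::real_normed_vector"
  assumes "\<And>i. smooth (f i)" shows "smooth (\<lambda>x. \<chi> i. f i x)"
proof -
  have "(\<chi> i. f i x) = (\<Sum>j\<in>UNIV. (\<chi> i. if i = j then f j x else 0))" for x
    by (simp add: vec_eq_iff)
  moreover have "bounded_linear (\<lambda>y. \<chi> i. if i = j then y else (0::'b))" for j :: 'i
  proof (rule bounded_linear_intro[where K=1])
    fix x :: 'b
    have "norm (\<chi> i. if i = j then x else (0::'b)) \<le> (\<Sum>i\<in>UNIV. norm (if i = j then x else 0))"
      unfolding norm_vec_def by (rule order_trans[OF L2_set_le_sum]) simp_all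
    then show "norm (\<chi> i. if i = j then x else (0::'b)) \<le> norm x * 1"
      by (simp add: if_distrib cong: if_cong)
  qed (simp_all add: vec_eq_iff)
  ultimately show ?thesis
    using assms by (auto intro!: smooth_sum smooth_compose_linear[of "\<lambda>y. \<chi> i. if i = j then y else 0" "f j" for j])
qed

lemma smooth_matrix_mult [smooth_intros]:
  fixes A :: "'a::real_normed_vector \<Rightarrow> real^'k^'m"
  shows "smooth A \<Longrightarrow> smooth B \<Longrightarrow> smooth (\<lambda>x. A x ** B x)"
  unfolding matrix_matrix_mult_def by (intro smooth_intros)

lemma smooth_matrix_vector_mult [smooth_intros]:
  fixes A :: "'a::real_normed_vector \<Rightarrow> real^'k^'m"
  shows "smooth A \<Longrightarrow> smooth v \<Longrightarrow> smooth (\<lambda>x. A x *v v x)"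
  unfolding matrix_vector_mult_def by (intro smooth_intros)

lemma smooth_transpose [smooth_intros]:
  fixes A :: "'a::real_normed_vector \<Rightarrow> real^'k^'m"
  shows "smooth A \<Longrightarrow> smooth (\<lambda>x. transpose (A x))"
  unfolding transpose_def by (intro smooth_intros)

lemma smooth_det [smooth_intros]:
  fixes A :: "'a::real_normed_vector \<Rightarrow> real^'k^'k"
  shows "smooth A \<Longrightarrow> smooth (\<lambda>x. det (A x))"
  unfolding det_def by (intro smooth_intros)

lemma smooth_frechet_derivative:
  fixes f :: "'a::euclidean_space \<Rightarrow> 'b::real_normed_vector"
  assumes "smooth f" "smooth g" "smooth v"
  shows "smooth (\<lambda>x. frechet_derivative f (at (g x)) (v x))"
proof -
  have D: "smooth (\<lambda>y. frechet_derivative f (at y) b)" for b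
    using assms(1) unfolding smooth_def by (metis times_cont_diff.simps(2))
  have "smooth (\<lambda>x. \<Sum>b\<in>Basis. (v x \<bullet> b) *\<^sub>R frechet_derivative f (at (g x)) b)"
    by (intro smooth_intros assms smooth_compose[OF D])
  moreover have "frechet_derivative f (at (g x)) (v x) =
      (\<Sum>b\<in>Basis. (v x \<bullet> b) *\<^sub>R frechet_derivative f (at (g x)) b)" for x
    by (rule linear_euclidean_expansion[OF has_derivative_bounded_linear[OF smooth_has_derivative[OF assms(1)]]])
  ultimately show ?thesis by presburger
qed

text \<open>Clairaut's theorem.  With \<open>S\<close> the second difference of \<open>f\<close> over the parallelogram with
  sides \<open>h u\<close> and \<open>h v\<close>, two applications of the mean value theorem give
  \<open>S = h\<^sup>2 D\<^sub>v D\<^sub>u f\<close> at some point of the parallelogram.  As \<open>S\<close> is symmetric in \<open>u\<close> and \<open>v\<close>,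
  letting \<open>h\<close> tend to \<open>0\<close> identifies the two mixed derivatives.\<close>

lemma second_difference_mean_value:
  fixes f :: "'a::euclidean_space \<Rightarrow> real"
  assumes "smooth f" "h > 0"
  shows "\<exists>a b. 0 < a \<and> a < h \<and> 0 < b \<and> b < h \<and>
    f (x + h *\<^sub>R u + h *\<^sub>R v) - f (x + h *\<^sub>R u) - f (x + h *\<^sub>R v) + f x =
    h * (h * frechet_derivative (\<lambda>y. frechet_derivative f (at y) u) (at (x + a *\<^sub>R u + b *\<^sub>R v)) v)"
proof -
  let ?D = "\<lambda>y. frechet_derivative f (at y) u"
  have smD: "smooth ?D" using smooth_frechet_derivative[OF assms(1) smooth_ident smooth_const] .
  have d1: "((\<lambda>s. f (x + s *\<^sub>R u + h *\<^sub>R v) - f (x + s *\<^sub>R u)) has_derivative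
     (\<lambda>r. frechet_derivative f (at (x + s *\<^sub>R u + h *\<^sub>R v)) (r *\<^sub>R u) -
          frechet_derivative f (at (x + s *\<^sub>R u)) (r *\<^sub>R u))) (at s)" for s
    by (intro has_derivative_diff has_derivative_compose[OF _ smooth_has_derivative[OF assms(1)]])
       (auto intro!: derivative_eq_intros)
  obtain a where a: "0 < a" "a < h" and
    "(f (x + h *\<^sub>R u + h *\<^sub>R v) - f (x + h *\<^sub>R u)) - (f (x + 0 *\<^sub>R u + h *\<^sub>R v) - f (x + 0 *\<^sub>R u)) =
     frechet_derivative f (at (x + a *\<^sub>R u + h *\<^sub>R v)) ((h - 0) *\<^sub>R u) -
          frechet_derivative f (at (x + a *\<^sub>R u)) ((h - 0) *\<^sub>R u)"
    using mvt_simple[OF \<open>h > 0\<close>, OF has_derivative_at_withinI[OF d1]] by auto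
  then have 1: "f (x + h *\<^sub>R u + h *\<^sub>R v) - f (x + h *\<^sub>R u) - f (x + h *\<^sub>R v) + f x =
     h * (?D (x + a *\<^sub>R u + h *\<^sub>R v) - ?D (x + a *\<^sub>R u))"
    using has_derivative_bounded_linear[OF smooth_has_derivative[OF assms(1)]]
    by (simp add: linear_simps(5) algebra_simps)
  have d2: "((\<lambda>s. ?D (x + a *\<^sub>R u + s *\<^sub>R v)) has_derivative
     (\<lambda>r. frechet_derivative ?D (at (x + a *\<^sub>R u + s *\<^sub>R v)) (r *\<^sub>R v))) (at s)" for s
    by (intro has_derivative_compose[OF _ smooth_has_derivative[OF smD]])
       (auto intro!: derivative_eq_intros)
  obtain b where b: "0 < b" "b < h" and
    "?D (x + a *\<^sub>R u + h *\<^sub>R v) - ?D (x + a *\<^sub>R u + 0 *\<^sub>R v) =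
     frechet_derivative ?D (at (x + a *\<^sub>R u + b *\<^sub>R v)) ((h - 0) *\<^sub>R v)"
    using mvt_simple[OF \<open>h > 0\<close>, OF has_derivative_at_withinI[OF d2]] by auto
  then have 2: "?D (x + a *\<^sub>R u + h *\<^sub>R v) - ?D (x + a *\<^sub>R u) =
     h * frechet_derivative ?D (at (x + a *\<^sub>R u + b *\<^sub>R v)) v"
    using has_derivative_bounded_linear[OF smooth_has_derivative[OF smD]]
    by (simp add: linear_simps(5))
  show ?thesis using a b 1 2 by auto
qed

lemma smooth_second_derivative_commute_real:
  fixes f :: "'a::euclidean_space \<Rightarrow> real"
  assumes "smooth f"
  shows "frechet_derivative (\<lambda>y. frechet_derivative f (at y) u) (at x) v =
         frechet_derivative (\<lambda>y. frechet_derivative f (at y) v) (at x) u"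
proof -
  define D where "D u v y = frechet_derivative (\<lambda>y. frechet_derivative f (at y) u) (at y) v" for u v y
  have smD: "smooth (D u v)" for u v
    unfolding D_def
    by (rule smooth_frechet_derivative[OF smooth_frechet_derivative[OF assms smooth_ident smooth_const]
          smooth_ident smooth_const])
  define h :: "nat \<Rightarrow> real" where "h n = inverse (Suc n)" for n
  have h: "h n > 0" for n by (simp add: h_def)
  have h0: "h \<longlonglongrightarrow> 0" unfolding h_def by (rule LIMSEQ_inverse_real_of_nat)
  \<comment> \<open>both mixed derivatives are limits of the same difference quotients\<close>
  have lim: "(\<lambda>n. (f (x + h n *\<^sub>R u + h n *\<^sub>R v) - f (x + h n *\<^sub>R u) - f (x + h n *\<^sub>R v) + f x) / (h n * h n))
    \<longlonglongrightarrow> D u v x" for u v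
  proof -
    have "\<forall>n. \<exists>a b. 0 < a \<and> a < h n \<and> 0 < b \<and> b < h n \<and>
       f (x + h n *\<^sub>R u + h n *\<^sub>R v) - f (x + h n *\<^sub>R u) - f (x + h n *\<^sub>R v) + f x =
       h n * (h n * D u v (x + a *\<^sub>R u + b *\<^sub>R v))"
      using second_difference_mean_value[OF assms h] unfolding D_def by blast
    then obtain a b where ab: "\<And>n. 0 < a n" "\<And>n. a n < h n" "\<And>n. 0 < b n" "\<And>n. b n < h n"
      and eq: "\<And>n. f (x + h n *\<^sub>R u + h n *\<^sub>R v) - f (x + h n *\<^sub>R u) - f (x + h n *\<^sub>R v) + f x =
       h n * (h n * D u v (x + a n *\<^sub>R u + b n *\<^sub>R v))"
      by metis
    have "a \<longlonglongrightarrow> 0"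
      by (rule tendsto_sandwich[OF _ _ tendsto_const h0]) (use ab in \<open>auto intro!: always_eventually less_imp_le\<close>)
    moreover have "b \<longlonglongrightarrow> 0"
      by (rule tendsto_sandwich[OF _ _ tendsto_const h0]) (use ab in \<open>auto intro!: always_eventually less_imp_le\<close>)
    ultimately have "(\<lambda>n. x + a n *\<^sub>R u + b n *\<^sub>R v) \<longlonglongrightarrow> x + 0 *\<^sub>R u + 0 *\<^sub>R v"
      by (intro tendsto_intros)
    then have "(\<lambda>n. D u v (x + a n *\<^sub>R u + b n *\<^sub>R v)) \<longlonglongrightarrow> D u v x"
      using smooth_continuous_on[OF smD, of UNIV]
      by (auto simp: continuous_on_eq_continuous_at intro: isCont_tendsto_compose)
    then show ?thesis using h by (simp add: eq less_imp_neq[symmetric])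
  qed
  have "(\<lambda>n. (f (x + h n *\<^sub>R u + h n *\<^sub>R v) - f (x + h n *\<^sub>R u) - f (x + h n *\<^sub>R v) + f x) / (h n * h n))
    \<longlonglongrightarrow> D v u x"
    using lim[of v u] by (simp add: algebra_simps)
  then have "D u v x = D v u x" using lim[of u v] LIMSEQ_unique by blast
  then show ?thesis by (simp add: D_def)
qed

lemma smooth_second_derivative_commute:
  fixes f :: "'a::euclidean_space \<Rightarrow> 'b::euclidean_space"
  assumes "smooth f"
  shows "frechet_derivative (\<lambda>y. frechet_derivative f (at y) u) (at x) v =
         frechet_derivative (\<lambda>y. frechet_derivative f (at y) v) (at x) u"
proof (rule euclidean_eqI)
  fix b :: 'b
  have comp: "frechet_derivative (\<lambda>y. g y \<bullet> b) (at y) = (\<lambda>v. frechet_derivative g (at y) v \<bullet> b)"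
    if "smooth g" for g :: "'a \<Rightarrow> 'b" and y
    using has_derivative_inner_left[OF smooth_has_derivative[OF that]] frechet_derivative_at by metis
  have D: "smooth (\<lambda>y. frechet_derivative f (at y) u)" for u
    by (rule smooth_frechet_derivative[OF assms smooth_ident smooth_const])
  have "smooth (\<lambda>y. f y \<bullet> b)" by (intro smooth_intros assms)
  then show "frechet_derivative (\<lambda>y. frechet_derivative f (at y) u) (at x) v \<bullet> b =
         frechet_derivative (\<lambda>y. frechet_derivative f (at y) v) (at x) u \<bullet> b"
    using smooth_second_derivative_commute_real[of "\<lambda>y. f y \<bullet> b" u x v]
    by (simp add: comp assms D)
qed

section \<open>Quadratic forms and the operator L\<close>

lemma smooth_case_prod: "smooth (\<lambda>(a, b). F a b) \<longleftrightarrow> smooth (\<lambda>p. F (fst p) (snd p))"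
  by (simp add: case_prod_beta')

lemma smooth_case_prod3:
  "smooth (\<lambda>(a, b, c). F a b c) \<longleftrightarrow> smooth (\<lambda>p. F (fst p) (fst (snd p)) (snd (snd p)))"
  by (simp add: case_prod_beta')

lemma has_derivative_partial:
  assumes "(\<lambda>(a, b). F a b) differentiable (at (a, b))"
  defines "D \<equiv> frechet_derivative (\<lambda>(a, b). F a b) (at (a, b))"
  shows "((\<lambda>a. F a b) has_derivative (\<lambda>d. D (d, 0))) (at a)"
    and "((\<lambda>b. F a b) has_derivative (\<lambda>d. D (0, d))) (at b)"
proof -
  have D: "((\<lambda>(a, b). F a b) has_derivative D) (at (a, b))"
    using assms by (simp add: frechet_derivative_works)
  show "((\<lambda>a. F a b) has_derivative (\<lambda>d. D (d, 0))) (at a)"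
    using has_derivative_compose[of "\<lambda>a. (a, b)" "\<lambda>d. (d, 0)" a UNIV, OF _ D]
    by (simp add: has_derivative_Pair)
  show "((\<lambda>b. F a b) has_derivative (\<lambda>d. D (0, d))) (at b)"
    using has_derivative_compose[of "\<lambda>b. (a, b)" "\<lambda>d. (0, d)" b UNIV, OF _ D]
    by (simp add: has_derivative_Pair)
qed

lemma jacobian_mult:
  fixes f :: "real^'a \<Rightarrow> real^'b"
  assumes "(f has_derivative f') (at x)"
  shows "jacobian f (at x) *v d = f' d"
  unfolding jacobian_def frechet_derivative_at[OF assms, symmetric]
  by (rule fun_cong[OF matrix_vector_mul(2)[OF has_derivative_linear[OF assms]]])

lemma loewner_le_mat_iff:
  "mat \<epsilon> \<preceq>\<^sub>L A \<longleftrightarrow> transpose A = A \<and> (\<forall>v. \<epsilon> * (v \<bullet> v) \<le> v \<bullet> (A *v v))"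
  "A \<preceq>\<^sub>L mat \<epsilon> \<longleftrightarrow> transpose A = A \<and> (\<forall>v. v \<bullet> (A *v v) \<le> \<epsilon> * (v \<bullet> v))"
proof -
  have t: "transpose (A - B) = transpose A - transpose B" for A B :: "real^'a^'a"
    by (simp add: transpose_def vec_eq_iff)
  have m: "mat \<epsilon> *v v = \<epsilon> *\<^sub>R v" for v :: "real^'a"
    by (simp add: matrix_vector_mult_def mat_def vec_eq_iff if_distrib[of "\<lambda>x. x * _"] cong: if_cong)
  show "mat \<epsilon> \<preceq>\<^sub>L A \<longleftrightarrow> transpose A = A \<and> (\<forall>v. \<epsilon> * (v \<bullet> v) \<le> v \<bullet> (A *v v))"
   "A \<preceq>\<^sub>L mat \<epsilon> \<longleftrightarrow> transpose A = A \<and> (\<forall>v. v \<bullet> (A *v v) \<le> \<epsilon> * (v \<bullet> v))"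
    by (simp_all add: loewner_le_def pos_semidef_def t m matrix_vector_mult_diff_rdistrib inner_diff_right)
qed

lemma loewner_le_0_iff:
  "A \<preceq>\<^sub>L 0 \<longleftrightarrow> transpose A = A \<and> (\<forall>v. v \<bullet> (A *v v) \<le> 0)"
proof -
  have "transpose (- A) = - transpose A"
    by (simp add: transpose_def vec_eq_iff)
  moreover have "(- A) *v v = - (A *v v)" for v
    using matrix_vector_mult_diff_rdistrib[of 0 A v] by simp
  ultimately show ?thesis by (simp add: loewner_le_def pos_semidef_def)
qed

lemma inner_sym_sum: "v \<bullet> (sym_sum A *v v) = 2 * (v \<bullet> (A *v v))"
  by (simp add: sym_sum_def matrix_vector_mult_add_rdistrib inner_add_right dot_lmul_matrix
      inner_commute[of v "v v* A"])

lemma symmetric_matrix_inner: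
  fixes A :: "real^'a^'a"
  assumes "transpose A = A" shows "v \<bullet> (A *v w) = w \<bullet> (A *v v)"
  by (metis assms dot_lmul_matrix inner_commute vector_transpose_matrix)

lemma has_derivative_matrix_vector_mult:
  fixes A :: "'a::real_normed_vector \<Rightarrow> real^'k^'m"
  assumes "(A has_derivative A') (at x)" "(v has_derivative v') (at x)"
  shows "((\<lambda>x. A x *v v x) has_derivative (\<lambda>d. A' d *v v x + A x *v v' d)) (at x)"
proof -
  have "bounded_bilinear (\<lambda>(A::real^'k^'m) v. A *v v)"
    by (rule bilinear_conv_bounded_bilinear[THEN iffD1])
       (auto simp: bilinear_def matrix_vector_right_distrib matrix_vector_mult_add_rdistrib
         matrix_vector_mult_scaleR scaleR_matrix_vector_assoc intro!: linearI)
  from bounded_bilinear.FDERIV[OF this assms] show ?thesis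
    by (simp add: add.commute)
qed

definition energy :: "('y \<Rightarrow> real \<Rightarrow> real^'N^'N) \<Rightarrow> 'y \<Rightarrow> real^'N \<Rightarrow> real \<Rightarrow> real" where
  "energy W y v t = v \<bullet> (W y t *v v)"

definition energy_rate ::
  "(real^'M \<Rightarrow> real \<Rightarrow> real^'N^'N) \<Rightarrow> real^'M \<Rightarrow> real^'N \<Rightarrow> real \<Rightarrow> (real^'M) \<times> (real^'N) \<times> real \<Rightarrow> real" where
  "energy_rate W y v t = frechet_derivative (\<lambda>(y, v, t). energy W y v t) (at (y, v, t))"

lemma smooth_energy:
  fixes W :: "real^'M \<Rightarrow> real \<Rightarrow> real^'N^'N"
  assumes "smooth (\<lambda>(y, t). W y t)"
  shows "smooth (\<lambda>(y, v, t). energy W y v t)"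
  unfolding energy_def smooth_case_prod3
  by (intro smooth_intros smooth_compose2[OF assms])

lemma energy_has_derivative:
  assumes "smooth (\<lambda>(y, t). W y t)"
  shows "((\<lambda>(y, v, t). energy W y v t) has_derivative energy_rate W y v t) (at (y, v, t))"
  unfolding energy_rate_def by (rule smooth_has_derivative[OF smooth_energy[OF assms]])

lemma energy_rate_eq:
  assumes "smooth (\<lambda>(y, t). W y t)" and "transpose (W y t) = W y t"
  shows "energy_rate W y v t (d, e, \<tau>) =
    v \<bullet> (frechet_derivative (\<lambda>(y, t). W y t) (at (y, t)) (d, \<tau>) *v v) + 2 * (v \<bullet> (W y t *v e))"
proof -
  let ?D = "frechet_derivative (\<lambda>(y, t). W y t) (at (y, t))"
  have "((\<lambda>p. (\<lambda>(y, t). W y t) (fst p, snd (snd p))) has_derivative (\<lambda>d. ?D (fst d, snd (snd d)))) (at (y, v, t))"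
    by (rule has_derivative_compose[where g="\<lambda>(y, t). W y t" and f="\<lambda>p. (fst p, snd (snd p))"])
       (use smooth_has_derivative[OF assms(1)] in \<open>auto intro!: derivative_eq_intros\<close>)
  then have W: "((\<lambda>p. W (fst p) (snd (snd p))) has_derivative (\<lambda>d. ?D (fst d, snd (snd d)))) (at (y, v, t))"
    by simp
  have v: "((\<lambda>p::(real^'a) \<times> (real^'b) \<times> real. fst (snd p)) has_derivative (\<lambda>d. fst (snd d))) (at (y, v, t))"
    by (auto intro!: derivative_eq_intros)
  have "((\<lambda>p. fst (snd p) \<bullet> (W (fst p) (snd (snd p)) *v fst (snd p))) has_derivative
     (\<lambda>d. v \<bullet> (?D (fst d, snd (snd d)) *v v + W y t *v fst (snd d)) + fst (snd d) \<bullet> (W y t *v v))) (at (y, v, t))"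
    using has_derivative_inner[OF v has_derivative_matrix_vector_mult[OF W v]] by simp
  from frechet_derivative_at[OF this] have "energy_rate W y v t (d, e, \<tau>) =
     v \<bullet> (?D (d, \<tau>) *v v + W y t *v e) + e \<bullet> (W y t *v v)"
    unfolding energy_rate_def energy_def by (simp add: case_prod_beta' fun_eq_iff)
  then show ?thesis
    using symmetric_matrix_inner[OF assms(2), of v e] by (simp add: inner_add_right)
qed

text \<open>The quadratic form of \<open>L[W, g, y, \<gamma>]\<close> is the derivative of the energy \<open>v \<bullet> W v\<close> along the
  flow of \<open>g\<close> and its variational equation \<open>v' = (\<partial>g/\<partial>y) v\<close>, plus \<open>\<gamma>\<close> times the energy.  This turns
  the matrix inequalities of contraction theory into differential inequalities for energies.\<close>

lemma
  fixes W :: "real^'N \<Rightarrow> real \<Rightarrow> real^'N^'N"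
  assumes "smooth (\<lambda>(y, t). W y t)" and sym: "\<And>y t. transpose (W y t) = W y t"
    and g: "((\<lambda>y. g y t) has_derivative g') (at y)"
  shows inner_L_op: "v \<bullet> (L_op W g \<gamma> y t *v v) = energy_rate W y v t (g y t, g' v, 1) + \<gamma> * energy W y v t"
    and transpose_L_op: "transpose (L_op W g \<gamma> y t) = L_op W g \<gamma> y t"
proof -
  let ?D = "frechet_derivative (\<lambda>(y, t). W y t) (at (y, t))"
  have D: "((\<lambda>(y, t). W y t) has_derivative ?D) (at (y, t))"
    by (rule smooth_has_derivative[OF assms(1)])
  interpret D: bounded_linear ?D using D by (rule has_derivative_bounded_linear)
  note part = has_derivative_partial[OF smooth_differentiable[OF assms(1)], where a=y and b=t]
  have 1: "frechet_derivative (\<lambda>y. W y t) (at y) d = ?D (d, 0)" for d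
    using frechet_derivative_at[OF part(1)] by metis
  have "?D (0, r) = r *\<^sub>R ?D (0, 1)" for r
  proof -
    have "?D (0, r) = ?D (r *\<^sub>R (0, 1))" by simp
    then show ?thesis by (simp only: D.scaleR)
  qed
  then have "(\<lambda>r. ?D (0, r)) = (\<lambda>r. r *\<^sub>R ?D (0, 1))" by blast
  with part(2) have "((\<lambda>t. W y t) has_vector_derivative ?D (0, 1)) (at t)"
    unfolding has_vector_derivative_def by metis
  then have 2: "vector_derivative (\<lambda>t. W y t) (at t) = ?D (0, 1)"
    by (rule vector_derivative_at)
  have "(\<Sum>i\<in>UNIV. (g y t $ i) *\<^sub>R ?D (axis i 1, 0)) = ?D (\<Sum>i\<in>UNIV. (g y t $ i) *\<^sub>R (axis i 1, 0))"
    by (simp only: D.sum D.scaleR)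
  also have "(\<Sum>i\<in>UNIV. (g y t $ i) *\<^sub>R (axis i 1, 0)) = (g y t, 0::real)"
    by (simp add: prod_eq_iff fst_sum snd_sum vec_eq_iff axis_def if_distrib cong: if_cong)
  finally have L: "L_op W g \<gamma> y t = ?D (g y t, 1) + sym_sum (W y t ** jacobian (\<lambda>y. g y t) (at y)) + \<gamma> *\<^sub>R W y t"
    unfolding L_op_def by (simp add: 1 2 D.add[symmetric])
  show "v \<bullet> (L_op W g \<gamma> y t *v v) = energy_rate W y v t (g y t, g' v, 1) + \<gamma> * energy W y v t"
    unfolding L energy_rate_eq[OF assms(1) sym] energy_def
    by (simp add: matrix_vector_mult_add_rdistrib inner_add_right inner_sym_sum
        matrix_vector_mul_assoc[symmetric] jacobian_mult[OF g] scaleR_matrix_vector_assoc[symmetric])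
  have tr: "bounded_linear (transpose :: real^'N^'N \<Rightarrow> _)"
    by (intro linear_conv_bounded_linear[THEN iffD1] linearI) (simp_all add: transpose_def vec_eq_iff)
  have "((\<lambda>p. transpose ((\<lambda>(y, t). W y t) p)) has_derivative (\<lambda>d. transpose (?D d))) (at (y, t))"
    by (rule bounded_linear.has_derivative[OF tr D])
  then have "((\<lambda>(y, t). W y t) has_derivative (\<lambda>d. transpose (?D d))) (at (y, t))"
    by (simp add: case_prod_beta' sym)
  then have "transpose (?D d) = ?D d" for d
    using frechet_derivative_at by metis
  then show "transpose (L_op W g \<gamma> y t) = L_op W g \<gamma> y t"
    by (simp only: L linear_simps(1)[OF tr] sym_sum_def transpose_transpose transpose_scalar sym
        add.commute[of "transpose (_ ** _)"])
qed

section \<open>Solving linear equations with uniformly positive definite matrices\<close>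

lemma invertible_of_pos_def:
  fixes A :: "real^'a^'a"
  assumes "\<epsilon> > 0" "mat \<epsilon> \<preceq>\<^sub>L A"
  shows "invertible A"
proof -
  have "v = 0" if "A *v v = 0" for v
  proof -
    have "\<epsilon> * (v \<bullet> v) \<le> 0" using assms(2) that unfolding loewner_le_mat_iff by (metis inner_zero_right)
    then show ?thesis using assms(1) by (metis inner_gt_zero_iff mult_pos_pos not_le)
  qed
  then show ?thesis
    using matrix_left_invertible_ker invertible_left_inverse by blast
qed

lemma matrix_inv_cancel:
  fixes A :: "real^'a^'a"
  assumes "invertible A"
  shows "A *v (matrix_inv A *v b) = b" "matrix_inv A *v (A *v b) = b"
proof -
  have "A ** matrix_inv A = mat 1 \<and> matrix_inv A ** A = mat 1"
    using assms unfolding invertible_def matrix_inv_def by (rule someI_ex)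
  then show "A *v (matrix_inv A *v b) = b" "matrix_inv A *v (A *v b) = b"
    by (simp_all add: matrix_vector_mul_assoc)
qed

lemma norm_le_of_pos_def:
  fixes A :: "real^'a^'a"
  assumes "mat \<epsilon> \<preceq>\<^sub>L A"
  shows "\<epsilon> * norm v \<le> norm (A *v v)"
proof (cases "v = 0")
  case False
  have "\<epsilon> * (v \<bullet> v) \<le> norm v * norm (A *v v)"
    using assms norm_cauchy_schwarz[of v "A *v v"] unfolding loewner_le_mat_iff by (meson order_trans)
  then show ?thesis using False by (simp add: dot_square_norm power2_eq_square)
qed simp

text \<open>By Cramer's rule the solution of a linear system is a quotient of determinants.\<close>

lemma smooth_matrix_inv_mult:
  fixes A :: "'a::real_normed_vector \<Rightarrow> real^'k^'k"
  assumes "smooth A" "smooth b" "\<And>x. invertible (A x)"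
  shows "smooth (\<lambda>x. matrix_inv (A x) *v b x)"
proof -
  have det: "det (A x) \<noteq> 0" for x using assms(3) invertible_det_nz by blast
  have eq: "matrix_inv (A x) *v b x =
    (\<chi> k. det (\<chi> i j. if j = k then b x $ i else A x $ i $ j) * inverse (det (A x)))" for x
    using cramer[OF det, THEN iffD1, OF matrix_inv_cancel(1)[OF assms(3)]]
    by (simp add: divide_inverse)
  have "smooth (\<lambda>x. if j = k then b x $ i else A x $ i $ j)" for i j k
    using assms by (cases "j = k") (auto intro!: smooth_vec_nth)
  then show ?thesis unfolding eq using assms det
    by (intro smooth_vec_lambda smooth_mult smooth_det smooth_inverse) auto
qed

section \<open>Strongly convex parametric optimization\<close>

lemma has_derivative_partial3:
  assumes "(\<lambda>(a, b, c). F a b c) differentiable (at (a, b, c))"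
  defines "D \<equiv> frechet_derivative (\<lambda>(a, b, c). F a b c) (at (a, b, c))"
  shows "((\<lambda>a. F a b c) has_derivative (\<lambda>d. D (d, 0, 0))) (at a)"
    and "((\<lambda>b. F a b c) has_derivative (\<lambda>d. D (0, d, 0))) (at b)"
    and "((\<lambda>c. F a b c) has_derivative (\<lambda>d. D (0, 0, d))) (at c)"
proof -
  have D: "((\<lambda>(a, b, c). F a b c) has_derivative D) (at (a, b, c))"
    using assms by (simp add: frechet_derivative_works)
  show "((\<lambda>a. F a b c) has_derivative (\<lambda>d. D (d, 0, 0))) (at a)"
    using has_derivative_compose[of "\<lambda>a. (a, b, c)" "\<lambda>d. (d, 0, 0)" a UNIV, OF _ D]
    by (simp add: has_derivative_Pair)
  show "((\<lambda>b. F a b c) has_derivative (\<lambda>d. D (0, d, 0))) (at b)"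
    using has_derivative_compose[of "\<lambda>b. (a, b, c)" "\<lambda>d. (0, d, 0)" b UNIV, OF _ D]
    by (simp add: has_derivative_Pair)
  show "((\<lambda>c. F a b c) has_derivative (\<lambda>d. D (0, 0, d))) (at c)"
    using has_derivative_compose[of "\<lambda>c. (a, b, c)" "\<lambda>d. (0, 0, d)" c UNIV, OF _ D]
    by (simp add: has_derivative_Pair)
qed

text \<open>Implicit differentiation for a zero \<open>g p\<close> of \<open>F (\<cdot>, p)\<close> that is known to be unique with a
  linear error bound.  The error bound makes \<open>g\<close> Lipschitz at \<open>p0\<close>, after which the first order
  expansion of \<open>F\<close> can be solved for \<open>g p - g p0\<close>.\<close>

lemma has_derivative_implicit:
  fixes F :: "'u::real_normed_vector \<times> 'p::real_normed_vector \<Rightarrow> 'v::real_normed_vector"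
  assumes F: "(F has_derivative (\<lambda>(u, p). A u + B p)) (at (g p0, p0))"
    and A': "bounded_linear A'" "\<And>u. A' (A u) = u" and B: "bounded_linear B"
    and zero: "\<And>p. F (g p, p) = 0"
    and bound: "\<And>u p. lam * norm (u - g p) \<le> norm (F (u, p))" and lam: "lam > 0"
  shows "(g has_derivative (\<lambda>p. - A' (B p))) (at p0)"
proof -
  interpret A': bounded_linear A' by fact
  interpret B: bounded_linear B by fact
  interpret FD: bounded_linear "\<lambda>(u, p). A u + B p"
    using F by (rule has_derivative_bounded_linear)
  have A0: "A 0 = 0" using FD.zero B.zero by (simp add: zero_prod_def)
  have expansion: "\<exists>d>0. \<forall>u p. norm (u - g p0, p - p0) < d \<longrightarrow>
      norm (F (u, p) - (A (u - g p0) + B (p - p0))) \<le> e * norm (u - g p0, p - p0)" if "e > 0" for e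
  proof -
    obtain d where "d > 0" "\<And>y. norm (y - (g p0, p0)) < d \<Longrightarrow>
      norm (F y - F (g p0, p0) - (case y - (g p0, p0) of (u, p) \<Rightarrow> A u + B p)) \<le> e * norm (y - (g p0, p0))"
      using F \<open>e > 0\<close> unfolding has_derivative_at_alt by metis
    then show ?thesis using zero[of p0] by (intro exI[of _ d]) force
  qed
  obtain KB where KB: "KB > 0" "\<And>p. norm (B p) \<le> norm p * KB" using B.pos_bounded by blast
  obtain KA where KA: "KA > 0" "\<And>p. norm (A' p) \<le> norm p * KA" using A'.pos_bounded by blast
  define L where "L = (1 + KB) / lam"
  have L: "L > 0" using KB lam by (simp add: L_def)
  obtain d1 where d1: "d1 > 0" and lip: "\<And>p. norm (p - p0) < d1 \<Longrightarrow> norm (g p - g p0) \<le> L * norm (p - p0)"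
  proof -
    obtain d where "d > 0" and ex: "\<And>u p. norm (u - g p0, p - p0) < d \<Longrightarrow>
        norm (F (u, p) - (A (u - g p0) + B (p - p0))) \<le> 1 * norm (u - g p0, p - p0)"
      using expansion[of 1] by auto
    have d: "norm (F (g p0, p) - B (p - p0)) \<le> norm (p - p0)" if "norm (p - p0) < d" for p
      using ex[of "g p0" p] that A0 by (simp add: norm_Pair)
    show ?thesis
    proof (rule that[OF \<open>d > 0\<close>])
      fix p assume p: "norm (p - p0) < d"
      have "lam * norm (g p - g p0) \<le> norm (F (g p0, p))"
        using bound[of "g p0" p] by (simp add: norm_minus_commute)
      also have "\<dots> \<le> norm (F (g p0, p) - B (p - p0)) + norm (B (p - p0))"
        using norm_triangle_ineq[of "F (g p0, p) - B (p - p0)" "B (p - p0)"] by simp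
      also have "\<dots> \<le> (1 + KB) * norm (p - p0)"
        using d[OF p] KB(2)[of "p - p0"] by (simp add: algebra_simps)
      finally show "norm (g p - g p0) \<le> L * norm (p - p0)"
        using lam by (simp add: L_def field_simps)
    qed
  qed
  show ?thesis
    unfolding has_derivative_at_alt
  proof (intro conjI allI impI)
    show "bounded_linear (\<lambda>p. - A' (B p))"
      by (intro bounded_linear_minus bounded_linear_compose[OF A'(1) B])
  next
    fix e :: real assume "e > 0"
    define e' where "e' = e / (KA * (1 + L))"
    have e': "e' > 0" "KA * e' * (1 + L) = e" using \<open>e > 0\<close> KA L by (simp_all add: e'_def)
    obtain d2 where d2: "d2 > 0" and ex: "\<And>u p. norm (u - g p0, p - p0) < d2 \<Longrightarrow>
      norm (F (u, p) - (A (u - g p0) + B (p - p0))) \<le> e' * norm (u - g p0, p - p0)"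
      using expansion[OF e'(1)] by blast
    show "\<exists>d>0. \<forall>p. norm (p - p0) < d \<longrightarrow>
      norm (g p - g p0 - (- A' (B (p - p0)))) \<le> e * norm (p - p0)"
    proof (intro exI[of _ "min d1 (d2 / (1 + L))"] conjI allI impI)
      show "0 < min d1 (d2 / (1 + L))" using d1 d2 L by simp
      fix p assume p: "norm (p - p0) < min d1 (d2 / (1 + L))"
      then have lp: "norm (g p - g p0) \<le> L * norm (p - p0)" using lip by simp
      have n: "norm (g p - g p0, p - p0) \<le> (1 + L) * norm (p - p0)"
        using norm_Pair_le[of "g p - g p0" "p - p0"] lp by (simp add: algebra_simps)
      also have "\<dots> < d2" using p L by (simp add: field_simps)
      finally have "norm (F (g p, p) - (A (g p - g p0) + B (p - p0))) \<le> e' * norm (g p - g p0, p - p0)"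
        by (rule ex)
      also have "\<dots> \<le> e' * ((1 + L) * norm (p - p0))" using n e' by (intro mult_left_mono) auto
      finally have r: "norm (A (g p - g p0) + B (p - p0)) \<le> e' * (1 + L) * norm (p - p0)"
        using zero[of p] norm_minus_cancel[of "A (g p - g p0) + B (p - p0)"]
        by (simp add: mult.assoc)
      have "g p - g p0 - (- A' (B (p - p0))) = A' (A (g p - g p0) + B (p - p0))"
        using A'(2)[of "g p - g p0"] by (simp add: A'.add)
      then have "norm (g p - g p0 - (- A' (B (p - p0)))) \<le> norm (A (g p - g p0) + B (p - p0)) * KA"
        using KA(2) by metis
      also have "\<dots> \<le> (e' * (1 + L) * norm (p - p0)) * KA"
        using r KA by (intro mult_right_mono) auto
      also have "\<dots> = (KA * e' * (1 + L)) * norm (p - p0)" by (simp add: algebra_simps)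
      finally show "norm (g p - g p0 - (- A' (B (p - p0)))) \<le> e * norm (p - p0)" by (simp only: e'(2))
    qed
  qed
qed

locale strongly_convex_cost =
  fixes V :: "real^'r \<Rightarrow> real^'n \<Rightarrow> real \<Rightarrow> real" and lam :: real
  assumes smooth_V: "smooth (\<lambda>(U, x, t). V U x t)"
    and lam_pos: "lam > 0"
    and hessian_bound: "mat lam \<preceq>\<^sub>L zeta_U V U x t"
begin

lemma V_has_derivative: "((\<lambda>U. V U x t) has_derivative (\<lambda>d. zeta V U x t \<bullet> d)) (at U)"
proof -
  have D: "((\<lambda>U. V U x t) has_derivative frechet_derivative (\<lambda>U. V U x t) (at U)) (at U)"
    using has_derivative_partial3(1)[OF smooth_differentiable[OF smooth_V]]
    unfolding differentiable_def frechet_derivative_works[symmetric] by blast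
  have "frechet_derivative (\<lambda>U. V U x t) (at U) d = zeta V U x t \<bullet> d" for d
  proof -
    have "d = (\<Sum>i\<in>UNIV. (d $ i) *\<^sub>R axis i 1)"
      by (simp add: vec_eq_iff axis_def if_distrib cong: if_cong)
    then have "frechet_derivative (\<lambda>U. V U x t) (at U) d =
      frechet_derivative (\<lambda>U. V U x t) (at U) (\<Sum>i\<in>UNIV. (d $ i) *\<^sub>R axis i 1)" by simp
    also have "\<dots> = (\<Sum>i\<in>UNIV. d $ i * frechet_derivative (\<lambda>U. V U x t) (at U) (axis i 1))"
      using has_derivative_linear[OF D] by (simp add: linear_sum linear_scale)
    finally show ?thesis
      by (simp add: zeta_def gradient_def inner_vec_def mult.commute)
  qed
  then have "frechet_derivative (\<lambda>U. V U x t) (at U) = (\<lambda>d. zeta V U x t \<bullet> d)" by blast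
  with D show ?thesis by simp
qed

lemma smooth_zeta: "smooth (\<lambda>(U, x, t). zeta V U x t)"
proof -
  let ?D = "frechet_derivative (\<lambda>(U, x, t). V U x t)"
  have "frechet_derivative (\<lambda>U. V U x t) (at U) d = ?D (at (U, x, t)) (d, 0, 0)" for U x t d
    by (rule frechet_derivative_at[symmetric, THEN fun_cong])
       (rule has_derivative_partial3(1)[OF smooth_differentiable[OF smooth_V]])
  then have "(\<lambda>(U, x, t). zeta V U x t) = (\<lambda>p. \<chi> i. ?D (at p) (axis i 1, 0, 0))"
    unfolding zeta_def gradient_def by auto
  then show ?thesis
    by (auto intro!: smooth_vec_lambda smooth_frechet_derivative[OF smooth_V smooth_ident smooth_const])
qed

definition zeta_deriv :: "real^'r \<Rightarrow> real^'n \<Rightarrow> real \<Rightarrow> (real^'r) \<times> (real^'n) \<times> real \<Rightarrow> real^'r" where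
  "zeta_deriv U x t = frechet_derivative (\<lambda>(U, x, t). zeta V U x t) (at (U, x, t))"

lemma zeta_partials:
  "((\<lambda>U. zeta V U x t) has_derivative (\<lambda>d. zeta_deriv U x t (d, 0, 0))) (at U)"
  "((\<lambda>x. zeta V U x t) has_derivative (\<lambda>d. zeta_deriv U x t (0, d, 0))) (at x)"
  "((\<lambda>t. zeta V U x t) has_derivative (\<lambda>d. zeta_deriv U x t (0, 0, d))) (at t)"
  unfolding zeta_deriv_def by (rule has_derivative_partial3[OF smooth_differentiable[OF smooth_zeta]])+

lemma linear_zeta_deriv: "linear (zeta_deriv U x t)"
  unfolding zeta_deriv_def by (rule has_derivative_linear[OF smooth_has_derivative[OF smooth_zeta]])

lemma zeta_U_mult: "zeta_U V U x t *v d = zeta_deriv U x t (d, 0, 0)"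
  unfolding zeta_U_def by (rule jacobian_mult[OF zeta_partials(1)])

lemma zeta_x_mult: "zeta_x V U x t *v d = zeta_deriv U x t (0, d, 0)"
  unfolding zeta_x_def by (rule jacobian_mult[OF zeta_partials(2)])

lemma zeta_t_eq: "zeta_t V U x t = zeta_deriv U x t (0, 0, 1)"
  unfolding zeta_t_def
proof (rule vector_derivative_at)
  have "zeta_deriv U x t (0, 0, d) = d *\<^sub>R zeta_deriv U x t (0, 0, 1)" for d
    using linear_scale[OF linear_zeta_deriv, of U x t d "(0, 0, 1)", symmetric] by simp
  then have eq: "(\<lambda>d. zeta_deriv U x t (0, 0, d)) = (\<lambda>d. d *\<^sub>R zeta_deriv U x t (0, 0, 1))"
    by blast
  show "((\<lambda>t. zeta V U x t) has_vector_derivative zeta_deriv U x t (0, 0, 1)) (at t)"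
    unfolding has_vector_derivative_def eq[symmetric] by (rule zeta_partials(3))
qed

lemma zeta_has_derivative:
  "((\<lambda>(U, x, t). zeta V U x t) has_derivative
    (\<lambda>(dU, dx, dt). zeta_U V U x t *v dU + zeta_x V U x t *v dx + dt *\<^sub>R zeta_t V U x t)) (at (U, x, t))"
proof -
  have "zeta_deriv U x t (dU, dx, dt) =
    zeta_U V U x t *v dU + zeta_x V U x t *v dx + dt *\<^sub>R zeta_t V U x t" for dU dx dt
  proof -
    have "zeta_deriv U x t (dU, dx, dt) = zeta_deriv U x t ((dU, 0, 0) + (0, dx, 0) + dt *\<^sub>R (0, 0, 1))"
      by simp
    then show ?thesis
      by (simp only: linear_add[OF linear_zeta_deriv] linear_scale[OF linear_zeta_deriv]
          zeta_U_mult zeta_x_mult zeta_t_eq)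
  qed
  then have "zeta_deriv U x t =
    (\<lambda>(dU, dx, dt). zeta_U V U x t *v dU + zeta_x V U x t *v dx + dt *\<^sub>R zeta_t V U x t)"
    by auto
  then show ?thesis
    unfolding zeta_deriv_def using smooth_has_derivative[OF smooth_zeta, of "(U, x, t)"] by simp
qed

lemma smooth_zeta_partials:
  "smooth (\<lambda>(U, x, t). zeta_U V U x t)"
  "smooth (\<lambda>(U, x, t). zeta_x V U x t)"
  "smooth (\<lambda>(U, x, t). zeta_t V U x t)"
proof -
  let ?D = "frechet_derivative (\<lambda>(U, x, t). zeta V U x t)"
  have D: "smooth (\<lambda>p. ?D (at p) v)" for v
    by (rule smooth_frechet_derivative[OF smooth_zeta smooth_ident smooth_const])
  have U: "(\<lambda>(U, x, t). zeta_U V U x t) = (\<lambda>p. \<chi> i j. ?D (at p) (axis j 1, 0, 0) $ i)"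
    by (auto simp: frechet_derivative_at[OF zeta_partials(1), symmetric] zeta_U_def jacobian_def matrix_def zeta_deriv_def)
  show "smooth (\<lambda>(U, x, t). zeta_U V U x t)" unfolding U by (intro smooth_intros D)
  have x: "(\<lambda>(U, x, t). zeta_x V U x t) = (\<lambda>p. \<chi> i j. ?D (at p) (0, axis j 1, 0) $ i)"
    by (auto simp: frechet_derivative_at[OF zeta_partials(2), symmetric] zeta_x_def jacobian_def matrix_def zeta_deriv_def)
  show "smooth (\<lambda>(U, x, t). zeta_x V U x t)" unfolding x by (intro smooth_intros D)
  have t: "(\<lambda>(U, x, t). zeta_t V U x t) = (\<lambda>p. ?D (at p) (0, 0, 1))"
    by (auto simp: zeta_t_eq zeta_deriv_def)
  show "smooth (\<lambda>(U, x, t). zeta_t V U x t)" unfolding t by (rule D)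
qed

lemma zeta_strongly_monotone:
  "lam * (norm (U - U'))\<^sup>2 \<le> (zeta V U x t - zeta V U' x t) \<bullet> (U - U')"
proof -
  let ?d = "U - U'"
  have D: "((\<lambda>r. zeta V (U' + r *\<^sub>R ?d) x t \<bullet> ?d) has_derivative
     (\<lambda>r. (zeta_U V (U' + s *\<^sub>R ?d) x t *v (r *\<^sub>R ?d)) \<bullet> ?d)) (at s within {0..1})" for s
    unfolding zeta_U_mult
    by (intro has_derivative_inner_left has_derivative_compose[OF _ zeta_partials(1)])
       (auto intro!: derivative_eq_intros)
  obtain s where "zeta V (U' + 1 *\<^sub>R ?d) x t \<bullet> ?d - zeta V (U' + 0 *\<^sub>R ?d) x t \<bullet> ?d =
     (zeta_U V (U' + s *\<^sub>R ?d) x t *v ((1 - 0) *\<^sub>R ?d)) \<bullet> ?d"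
    using mvt_simple[of 0 "1::real", OF _ D] by force
  then have "(zeta V U x t - zeta V U' x t) \<bullet> ?d = ?d \<bullet> (zeta_U V (U' + s *\<^sub>R ?d) x t *v ?d)"
    by (simp add: inner_diff_left inner_diff_right inner_commute)
  moreover have "lam * (?d \<bullet> ?d) \<le> ?d \<bullet> (zeta_U V (U' + s *\<^sub>R ?d) x t *v ?d)"
    using hessian_bound unfolding loewner_le_mat_iff by blast
  ultimately show ?thesis by (simp add: power2_norm_eq_inner)
qed

lemma zeta_lower_bound: "lam * norm (U - U') \<le> norm (zeta V U x t - zeta V U' x t)"
proof (cases "U = U'")
  case False
  have "lam * (norm (U - U'))\<^sup>2 \<le> norm (zeta V U x t - zeta V U' x t) * norm (U - U')"
    using zeta_strongly_monotone norm_cauchy_schwarz order_trans by blast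
  then show ?thesis using False by (simp add: power2_eq_square)
qed simp

text \<open>Strong convexity makes the cost grow quadratically, so it attains its minimum.  The growth
  is read off from the increment over the outer half of the segment from \<open>0\<close> to \<open>U\<close>, where strong
  monotonicity has raised the slope by at least \<open>lam / 2\<close> times the square of the length.\<close>

lemma cost_lower_bound:
  "V 0 x t - norm (zeta V 0 x t) * norm U + lam / 4 * (norm U)\<^sup>2 \<le> V U x t"
proof -
  have slope: "zeta V 0 x t \<bullet> U + lam * r * (norm U)\<^sup>2 \<le> zeta V (r *\<^sub>R U) x t \<bullet> U" if "0 < r" for r
  proof -
    have "r * (lam * r * (norm U)\<^sup>2) \<le> r * ((zeta V (r *\<^sub>R U) x t - zeta V 0 x t) \<bullet> U)"
      using zeta_strongly_monotone[of "r *\<^sub>R U" 0 x t] by (simp add: power2_eq_square algebra_simps)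
    then show ?thesis using that by (simp add: inner_diff_left)
  qed
  have d: "((\<lambda>r. V (r *\<^sub>R U) x t) has_derivative (\<lambda>s. zeta V (r *\<^sub>R U) x t \<bullet> (s *\<^sub>R U))) (at r within S)" for r S
    by (intro has_derivative_compose[OF _ V_has_derivative]) (auto intro!: derivative_eq_intros)
  obtain a where a: "0 < a" "V ((1/2) *\<^sub>R U) x t - V (0 *\<^sub>R U) x t = zeta V (a *\<^sub>R U) x t \<bullet> ((1/2 - 0) *\<^sub>R U)"
    using mvt_simple[of 0 "1/2::real", OF _ d] by auto
  obtain b where b: "1/2 < b" "V (1 *\<^sub>R U) x t - V ((1/2) *\<^sub>R U) x t = zeta V (b *\<^sub>R U) x t \<bullet> ((1 - 1/2) *\<^sub>R U)"
    using mvt_simple[of "1/2" "1::real", OF _ d] by auto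
  have "lam * a * (norm U)\<^sup>2 \<ge> 0" using lam_pos a by simp
  moreover have "lam * b * (norm U)\<^sup>2 \<ge> lam * (1/2) * (norm U)\<^sup>2"
    using lam_pos b by (intro mult_right_mono mult_left_mono) auto
  moreover have "\<bar>zeta V 0 x t \<bullet> U\<bar> \<le> norm (zeta V 0 x t) * norm U" by (rule Cauchy_Schwarz_ineq2)
  ultimately show ?thesis
    using a b slope[of a] slope[of b] by (simp add: abs_le_iff field_simps)
qed

lemma U_opt_minimizes: "V (U_opt V x t) x t \<le> V U x t"
proof -
  define R where "R = 4 * norm (zeta V 0 x t) / lam"
  have R: "0 \<le> R" using lam_pos by (simp add: R_def)
  have "continuous_on (cball 0 R) (\<lambda>U. V U x t)"
    using V_has_derivative by (intro continuous_at_imp_continuous_on) (blast intro: has_derivative_continuous)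
  moreover have "cball (0::real^'r) R \<noteq> {}" using R by simp
  ultimately obtain U0 where U0: "\<And>U. U \<in> cball 0 R \<Longrightarrow> V U0 x t \<le> V U x t"
    using continuous_attains_inf[OF compact_cball] by metis
  have "V U0 x t \<le> V U x t" for U
  proof (cases "U \<in> cball 0 R")
    case False
    have "norm (zeta V 0 x t) * norm U \<le> lam / 4 * norm U * norm U"
      using False lam_pos by (intro mult_right_mono) (auto simp: R_def field_simps)
    then have "V 0 x t \<le> V U x t" using cost_lower_bound[of x t U] by (simp add: power2_eq_square)
    then show ?thesis using U0[of 0] R by simp
  qed (rule U0)
  then have "is_arg_min (\<lambda>U. V U x t) (\<lambda>U. True) U0" by (simp add: is_arg_min_linorder)
  then have "is_arg_min (\<lambda>U. V U x t) (\<lambda>U. True) (U_opt V x t)"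
    unfolding U_opt_def arg_min_def by (rule someI)
  then show ?thesis by (simp add: is_arg_min_linorder)
qed

lemma zeta_U_opt: "zeta V (U_opt V x t) x t = 0"
proof -
  have "(\<lambda>d. zeta V (U_opt V x t) x t \<bullet> d) = (\<lambda>d. 0)"
    by (rule has_derivative_local_min[OF V_has_derivative]) (simp add: U_opt_minimizes)
  then show ?thesis by (metis inner_eq_zero_iff)
qed

lemma invertible_zeta_U: "invertible (zeta_U V U x t)"
  using invertible_of_pos_def[OF lam_pos hessian_bound] .

lemma norm_zeta_U_inv: "norm (matrix_inv (zeta_U V U x t) *v w) \<le> norm w / lam"
proof -
  have "lam * norm (matrix_inv (zeta_U V U x t) *v w) \<le> norm w"
    using norm_le_of_pos_def[OF hessian_bound] matrix_inv_cancel(1)[OF invertible_zeta_U] by metis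
  then show ?thesis using lam_pos by (simp add: field_simps)
qed

lemma U_opt_has_derivative:
  "((\<lambda>(x, t). U_opt V x t) has_derivative
     (\<lambda>(dx, dt). - (matrix_inv (zeta_U V (U_opt V x t) x t) *v
        (zeta_x V (U_opt V x t) x t *v dx + dt *\<^sub>R zeta_t V (U_opt V x t) x t)))) (at (x, t))"
proof -
  let ?U = "U_opt V x t"
  let ?B = "\<lambda>p. zeta_x V ?U x t *v fst p + snd p *\<^sub>R zeta_t V ?U x t"
  have "((\<lambda>(x, t). U_opt V x t) has_derivative
     (\<lambda>p. - (matrix_inv (zeta_U V ?U x t) *v ?B p))) (at (x, t))"
  proof (rule has_derivative_implicit[where lam=lam and A="(*v) (zeta_U V ?U x t)"
        and A'="(*v) (matrix_inv (zeta_U V ?U x t))" and B="?B"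
        and F="\<lambda>p. zeta V (fst p) (fst (snd p)) (snd (snd p))"])
    show "((\<lambda>p. zeta V (fst p) (fst (snd p)) (snd (snd p))) has_derivative
        (\<lambda>(u, p). zeta_U V ?U x t *v u + ?B p)) (at ((\<lambda>(x, t). U_opt V x t) (x, t), (x, t)))"
      using zeta_has_derivative[of ?U x t] by (simp add: case_prod_beta' add.assoc)
    show "lam * norm (u - (\<lambda>(x, t). U_opt V x t) p)
        \<le> norm (zeta V (fst (u, p)) (fst (snd (u, p))) (snd (snd (u, p))))"
      for u p using zeta_lower_bound[of u "U_opt V (fst p) (snd p)" "fst p" "snd p"]
      by (simp add: zeta_U_opt case_prod_beta')
  qed (auto simp: zeta_U_opt matrix_inv_cancel[OF invertible_zeta_U] lam_pos
      intro!: bounded_linear_add bounded_linear_compose[OF matrix_vector_mul_bounded_linear]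
        bounded_linear_fst bounded_linear_snd bounded_linear_scaleR_const)
  then show ?thesis by (simp add: case_prod_beta')
qed

end

section \<open>Smoothness of the predicted cost\<close>

lemma smooth_input_at: "smooth g \<Longrightarrow> smooth (\<lambda>p. input_at (g p) k)"
  unfolding input_at_def by (intro smooth_intros)

lemma smooth_predicted_state:
  fixes fd :: "real^'n \<Rightarrow> real^'m \<Rightarrow> real \<Rightarrow> real^'n"
  assumes "smooth (\<lambda>(x, u, t). fd x u t)"
  shows "(\<And>j. j < k \<Longrightarrow> smooth (tk j)) \<Longrightarrow>
    smooth (\<lambda>(U :: real^('h::{finite,linorder} \<times> 'm), x, t). predicted_state fd tk U x t k)"
proof (induction k)
  case 0
  then show ?case unfolding smooth_case_prod3 by (simp add: smooth_intros)
next
  case (Suc k)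
  have tk: "smooth (tk k)" using Suc.prems by simp
  have "smooth (\<lambda>p :: (real^('h \<times> 'm)) \<times> (real^'n) \<times> real.
      fd (predicted_state fd tk (fst p) (fst (snd p)) (snd (snd p)) k) (input_at (fst p) k) (tk k (snd (snd p))))"
    using Suc by (intro smooth_compose3[OF assms] smooth_input_at smooth_compose[OF tk] smooth_intros)
      (simp add: smooth_case_prod3)
  then show ?case unfolding smooth_case_prod3 by simp
qed

lemma smooth_ocp_cost:
  fixes fd :: "real^'n \<Rightarrow> real^'m \<Rightarrow> real \<Rightarrow> real^'n"
    and ell :: "real^'n \<Rightarrow> real^'m \<Rightarrow> real \<Rightarrow> real"
  assumes fd: "smooth (\<lambda>(x, u, t). fd x u t)" and ell: "smooth (\<lambda>(x, u, t). ell x u t)"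
    and \<Phi>: "smooth (\<lambda>(x, t). \<Phi> x t)"
    and tk: "\<And>k. k \<le> CARD('h) \<Longrightarrow> smooth (tk k)"
  shows "smooth (\<lambda>(U :: real^('h::{finite,linorder} \<times> 'm), x, t). ocp_cost fd tk ell \<Phi> U x t)"
proof -
  have x: "smooth (\<lambda>p. predicted_state fd tk (fst p :: real^('h \<times> 'm)) (fst (snd p)) (snd (snd p)) k)"
    if "k \<le> CARD('h)" for k
    using smooth_predicted_state[OF fd, of k tk, where 'h='h] tk that
    unfolding smooth_case_prod3 by simp
  show ?thesis
    unfolding smooth_case_prod3 ocp_cost_def
    by (intro smooth_add smooth_sum smooth_compose2[OF \<Phi>] smooth_compose3[OF ell] x
        smooth_compose[OF tk] smooth_input_at smooth_intros) auto
qed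

section \<open>The closed loop in the coordinates of the virtual dynamics\<close>

text \<open>The directional derivative of a smooth map is smooth jointly in the point and the direction,
  and linear in the direction; when both move, the two partial derivatives add up.\<close>

lemma has_derivative_frechet_apply:
  fixes G :: "'a::euclidean_space \<Rightarrow> 'b::real_normed_vector"
  assumes "smooth G" and g: "(g has_derivative g') (at p)" and X: "(X has_derivative X') (at p)"
  shows "((\<lambda>q. frechet_derivative G (at (g q)) (X q)) has_derivative
    (\<lambda>d. frechet_derivative (\<lambda>y. frechet_derivative G (at y) (X p)) (at (g p)) (g' d)
       + frechet_derivative G (at (g p)) (X' d))) (at p)"
proof -
  let ?H = "\<lambda>(y, v). frechet_derivative G (at y) v"
  have smH: "smooth ?H"
    unfolding smooth_case_prod by (intro smooth_frechet_derivative assms smooth_intros)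
  let ?D = "frechet_derivative ?H (at (g p, X p))"
  have D: "(?H has_derivative ?D) (at (g p, X p))" by (rule smooth_has_derivative[OF smH])
  interpret D: bounded_linear ?D using D by (rule has_derivative_bounded_linear)
  note part = has_derivative_partial[OF smooth_differentiable[OF smH], where a="g p" and b="X p"]
  have 1: "?D (d, 0) = frechet_derivative (\<lambda>y. frechet_derivative G (at y) (X p)) (at (g p)) d" for d
    by (rule frechet_derivative_at[OF part(1), THEN fun_cong])
  have "bounded_linear (frechet_derivative G (at (g p)))"
    by (rule has_derivative_bounded_linear[OF smooth_has_derivative[OF assms(1)]])
  then have "(frechet_derivative G (at (g p)) has_derivative frechet_derivative G (at (g p))) (at (X p))"
    by (rule bounded_linear_imp_has_derivative)
  then have 2: "?D (0, d) = frechet_derivative G (at (g p)) d" for d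
    using has_derivative_unique[OF part(2)] by metis
  have "?D (a, b) = ?D (a, 0) + ?D (0, b)" for a b
    by (simp add: D.add[symmetric])
  then have "(\<lambda>d. ?D (g' d, X' d)) = (\<lambda>d. frechet_derivative (\<lambda>y. frechet_derivative G (at y) (X p)) (at (g p)) (g' d)
       + frechet_derivative G (at (g p)) (X' d))"
    unfolding 1 2 by presburger
  moreover have "((\<lambda>q. ?H (g q, X q)) has_derivative (\<lambda>d. ?D (g' d, X' d))) (at p)"
    by (rule has_derivative_compose[OF has_derivative_Pair[OF g X] D])
  ultimately show ?thesis by simp
qed

lemma bounded_linear_upper_part: "bounded_linear upper_part"
  and bounded_linear_lower_part: "bounded_linear lower_part"
  by (auto simp: linear_conv_bounded_linear[symmetric] upper_part_def lower_part_def vec_eq_iff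
      intro!: linearI)

lemma upper_part_vcat [simp]: "upper_part (vcat x U) = x"
  and lower_part_vcat [simp]: "lower_part (vcat x U) = U"
  by (auto simp: upper_part_def lower_part_def vcat_def vec_eq_iff split: sum.splits)

lemma sum_UNIV_Plus:
  fixes F :: "'a::finite + 'b::finite \<Rightarrow> 'c::comm_monoid_add"
  shows "(\<Sum>i\<in>UNIV. F i) = (\<Sum>a\<in>UNIV. F (Inl a)) + (\<Sum>b\<in>UNIV. F (Inr b))"
  by (simp add: sum.Plus UNIV_Plus_UNIV[symmetric] del: UNIV_Plus_UNIV)

lemma inner_sum_parts: "s \<bullet> s' = upper_part s \<bullet> upper_part s' + lower_part s \<bullet> lower_part s'"
  by (simp add: inner_vec_def sum_UNIV_Plus upper_part_def lower_part_def)

lemmas smooth_upper_part [smooth_intros] = smooth_compose_linear[OF bounded_linear_upper_part]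
lemmas smooth_lower_part [smooth_intros] = smooth_compose_linear[OF bounded_linear_lower_part]

lemma smooth_vcat [smooth_intros]:
  assumes "smooth x" "smooth U" shows "smooth (\<lambda>p. vcat (x p) (U p))"
proof -
  have "smooth (\<lambda>p. case i of Inl a \<Rightarrow> x p $ a | Inr b \<Rightarrow> U p $ b)" for i
    by (cases i) (simp_all add: smooth_vec_nth assms)
  then show ?thesis unfolding vcat_def by (rule smooth_vec_lambda)
qed

lemma inner_upper_left_block: "v \<bullet> (upper_left_block A *v v) = upper_part v \<bullet> (A *v upper_part v)"
  by (simp add: inner_vec_def matrix_vector_mult_def sum_UNIV_Plus upper_left_block_def upper_part_def)

lemma inner_congruence:
  fixes A :: "real^'a^'b"
  shows "v \<bullet> ((transpose A ** B ** A) *v v) = (A *v v) \<bullet> (B *v (A *v v))"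
  by (simp add: matrix_vector_mul_assoc[symmetric]) (metis dot_lmul_matrix inner_commute)

locale continuation_control = strongly_convex_cost V lam
  for V :: "real^('h::{finite,linorder} \<times> 'm::finite) \<Rightarrow> real^'n::finite \<Rightarrow> real \<Rightarrow> real" and lam :: real +
  fixes f :: "real^'n \<Rightarrow> real^'m \<Rightarrow> real \<Rightarrow> real^'n"
    and \<eta> :: "real^('h \<times> 'm) \<Rightarrow> real \<Rightarrow> real^('h \<times> 'm)"
    and P :: "real^'n \<Rightarrow> real \<Rightarrow> real^'n^'n"
    and Q :: "real^('h \<times> 'm) \<Rightarrow> real \<Rightarrow> real^('h \<times> 'm)^('h \<times> 'm)"
  assumes smooth_f: "smooth (\<lambda>(x, u, t). f x u t)"
    and smooth_\<eta>: "smooth (\<lambda>(z, t). \<eta> z t)"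
    and smooth_P: "smooth (\<lambda>(x, t). P x t)"
    and smooth_Q: "smooth (\<lambda>(z, t). Q z t)"
    and sym_P: "transpose (P x t) = P x t"
    and sym_Q: "transpose (Q z t) = Q z t"
begin

abbreviation "\<phi> \<equiv> closed_loop f V \<eta>"

definition zeta_at :: "real^('n + 'h \<times> 'm) \<Rightarrow> real \<Rightarrow> real^('h \<times> 'm)" where
  "zeta_at s t = zeta V (lower_part s) (upper_part s) t"

lemma smooth_zeta_at: "smooth (\<lambda>(s, t). zeta_at s t)"
  unfolding zeta_at_def smooth_case_prod
  by (intro smooth_compose3[OF smooth_zeta] smooth_intros)

lemma zeta_at_has_derivative:
  "((\<lambda>(s, t). zeta_at s t) has_derivative
    (\<lambda>(v, \<tau>). zeta_U V (lower_part s) (upper_part s) t *v lower_part v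
      + zeta_x V (lower_part s) (upper_part s) t *v upper_part v
      + \<tau> *\<^sub>R zeta_t V (lower_part s) (upper_part s) t)) (at (s, t))"
proof -
  have "((\<lambda>p. (lower_part (fst p), upper_part (fst p), snd p)) has_derivative
     (\<lambda>p. (lower_part (fst p), upper_part (fst p), snd p))) (at (s, t))"
    by (intro bounded_linear_imp_has_derivative bounded_linear_Pair bounded_linear_compose[OF bounded_linear_upper_part]
        bounded_linear_compose[OF bounded_linear_lower_part] bounded_linear_fst bounded_linear_snd)
  from has_derivative_compose[OF this, of "\<lambda>(U, x, t). zeta V U x t",
      unfolded fst_conv snd_conv, OF zeta_has_derivative]
  show ?thesis by (simp add: zeta_at_def case_prod_beta')
qed

lemma zeta_s_mult:
  "zeta_s V s t *v v = zeta_U V (lower_part s) (upper_part s) t *v lower_part v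
      + zeta_x V (lower_part s) (upper_part s) t *v upper_part v"
proof -
  note D = zeta_at_has_derivative[of s t]
  have "((\<lambda>s. zeta_at s t) has_derivative (\<lambda>v. frechet_derivative (\<lambda>(s, t). zeta_at s t) (at (s, t)) (v, 0))) (at s)"
    by (rule has_derivative_partial(1)) (use D in \<open>auto simp: differentiable_def\<close>)
  then show ?thesis
    unfolding zeta_s_def zeta_at_def[symmetric] frechet_derivative_at[OF D, symmetric]
    by (subst jacobian_mult) auto
qed

lemma zeta_s_mult_frechet:
  "zeta_s V s t *v v = frechet_derivative (\<lambda>(s, t). zeta_at s t) (at (s, t)) (v, 0)"
  unfolding zeta_s_mult frechet_derivative_at[OF zeta_at_has_derivative, symmetric] by simp

lemma upper_part_closed_loop: "upper_part (\<phi> s t) = f (upper_part s) (Pi0 *v lower_part s) t"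
  by (simp add: closed_loop_def Let_def)

text \<open>The input update of the continuation method is chosen so that the residual
  \<open>z = \<zeta>(U, x, t)\<close> follows the virtual dynamics \<open>z' = \<eta>(z, t)\<close> exactly.\<close>

lemma virtual_dynamics:
  "frechet_derivative (\<lambda>(s, t). zeta_at s t) (at (s, t)) (\<phi> s t, 1) = \<eta> (zeta_at s t) t"
  unfolding frechet_derivative_at[OF zeta_at_has_derivative, symmetric]
  by (simp add: closed_loop_def Let_def matrix_inv_cancel[OF invertible_zeta_U]
      continuation_rhs_def zeta_at_def)

lemma smooth_closed_loop: "smooth (\<lambda>(s, t). \<phi> s t)"
  unfolding smooth_case_prod closed_loop_def Let_def continuation_rhs_def
  by (intro smooth_vcat smooth_matrix_inv_mult smooth_compose3[OF smooth_f] smooth_compose2[OF smooth_\<eta>]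
      smooth_compose3[OF smooth_zeta_partials(1)] smooth_compose3[OF smooth_zeta_partials(2)]
      smooth_compose3[OF smooth_zeta_partials(3)] smooth_compose3[OF smooth_zeta]
      invertible_zeta_U smooth_intros)

definition \<phi>_s :: "real^('n + 'h \<times> 'm) \<Rightarrow> real \<Rightarrow> real^('n + 'h \<times> 'm) \<Rightarrow> real^('n + 'h \<times> 'm)" where
  "\<phi>_s s t = frechet_derivative (\<lambda>s. \<phi> s t) (at s)"

lemma \<phi>_s_eq: "\<phi>_s s t v = frechet_derivative (\<lambda>(s, t). \<phi> s t) (at (s, t)) (v, 0)"
  unfolding \<phi>_s_def
  by (rule frechet_derivative_at[symmetric, THEN fun_cong])
     (rule has_derivative_partial(1)[OF smooth_differentiable[OF smooth_closed_loop]])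

lemma \<phi>_has_derivative: "((\<lambda>s. \<phi> s t) has_derivative \<phi>_s s t) (at s)"
  using has_derivative_partial(1)[OF smooth_differentiable[OF smooth_closed_loop]]
  unfolding \<phi>_s_eq[abs_def] .

lemma smooth_zeta_s: "smooth (\<lambda>(s, t). zeta_s V s t)"
proof -
  have "zeta_s V s t = (\<chi> i j. frechet_derivative (\<lambda>(s, t). zeta_at s t) (at (s, t)) (axis j 1, 0) $ i)" for s t
    by (simp add: zeta_s_mult_frechet[symmetric] matrix_vector_mult_basis column_def vec_eq_iff)
  then show ?thesis
    unfolding smooth_case_prod
    by (simp only:) (intro smooth_intros smooth_frechet_derivative smooth_zeta_at)
qed

text \<open>Along the closed loop, a variation \<open>v\<close> of the state induces the variation \<open>w = \<zeta>\<^sub>s v\<close> of the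
  residual, which obeys the variational equation \<open>w' = \<eta>\<^sub>z w\<close> of the virtual dynamics.  This is the
  derivative of \<open>virtual_dynamics\<close> with respect to the state, rearranged with the symmetry of
  second derivatives.\<close>

lemma virtual_variation:
  "((\<lambda>(s, v, t). zeta_s V s t *v v) has_derivative
     (\<lambda>(d, e, \<tau>). frechet_derivative (\<lambda>p. frechet_derivative (\<lambda>(s, t). zeta_at s t) (at p) (v, 0)) (at (s, t)) (d, \<tau>)
        + zeta_s V s t *v e)) (at (s, v, t))" (is ?D)
  "frechet_derivative (\<lambda>p. frechet_derivative (\<lambda>(s, t). zeta_at s t) (at p) (v, 0)) (at (s, t)) (\<phi> s t, 1)
     + zeta_s V s t *v \<phi>_s s t v
   = frechet_derivative (\<lambda>z. \<eta> z t) (at (zeta_at s t)) (zeta_s V s t *v v)" (is ?E)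
proof -
  let ?G = "\<lambda>(s, t). zeta_at s t"
  let ?DG = "\<lambda>p. frechet_derivative ?G (at p)"
  have 1: "((\<lambda>p. (fst p, snd (snd p))) has_derivative (\<lambda>d. (fst d, snd (snd d)))) (at (s, v, t))"
    and 2: "((\<lambda>p. (fst (snd p), 0)) has_derivative (\<lambda>d. (fst (snd d), 0))) (at (s, v, t))"
    by (auto intro!: derivative_eq_intros)
  show ?D
    using has_derivative_frechet_apply[OF smooth_zeta_at 1 2]
    by (simp add: zeta_s_mult_frechet case_prod_beta')
  have X: "((\<lambda>p. ((\<lambda>(s, t). \<phi> s t) p, 1)) has_derivative
      (\<lambda>d. (frechet_derivative (\<lambda>(s, t). \<phi> s t) (at (s, t)) d, 0))) (at (s, t))"
    by (intro has_derivative_Pair smooth_has_derivative[OF smooth_closed_loop] has_derivative_const)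
  have lhs: "((\<lambda>p. ?DG p ((\<lambda>(s, t). \<phi> s t) p, 1)) has_derivative
     (\<lambda>d. frechet_derivative (\<lambda>q. ?DG q (\<phi> s t, 1)) (at (s, t)) d
        + ?DG (s, t) (frechet_derivative (\<lambda>(s, t). \<phi> s t) (at (s, t)) d, 0))) (at (s, t))"
    using has_derivative_frechet_apply[OF smooth_zeta_at has_derivative_ident X] by simp
  have eq: "(\<lambda>p. ?DG p ((\<lambda>(s, t). \<phi> s t) p, 1)) = (\<lambda>p. (\<lambda>(z, t). \<eta> z t) (?G p, snd p))"
    using virtual_dynamics by auto
  have rhs: "((\<lambda>p. (\<lambda>(z, t). \<eta> z t) (?G p, snd p)) has_derivative
     (\<lambda>d. frechet_derivative (\<lambda>(z, t). \<eta> z t) (at (?G (s, t), snd (s, t))) (?DG (s, t) d, snd d))) (at (s, t))"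
    by (rule has_derivative_compose[OF has_derivative_Pair[OF smooth_has_derivative[OF smooth_zeta_at]
           has_derivative_snd[OF has_derivative_ident]] smooth_has_derivative[OF smooth_\<eta>]])
  have "(\<lambda>d. frechet_derivative (\<lambda>q. ?DG q (\<phi> s t, 1)) (at (s, t)) d
        + ?DG (s, t) (frechet_derivative (\<lambda>(s, t). \<phi> s t) (at (s, t)) d, 0)) =
     (\<lambda>d. frechet_derivative (\<lambda>(z, t). \<eta> z t) (at (?G (s, t), snd (s, t))) (?DG (s, t) d, snd d))"
    by (rule has_derivative_unique[OF lhs[unfolded eq] rhs])
  from fun_cong[OF this, of "(v, 0)"]
  have "frechet_derivative (\<lambda>q. ?DG q (\<phi> s t, 1)) (at (s, t)) (v, 0) + zeta_s V s t *v \<phi>_s s t v =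
    frechet_derivative (\<lambda>(z, t). \<eta> z t) (at (zeta_at s t, t)) (zeta_s V s t *v v, 0)"
    by (simp add: \<phi>_s_eq zeta_s_mult_frechet)
  also have "\<dots> = frechet_derivative (\<lambda>z. \<eta> z t) (at (zeta_at s t)) (zeta_s V s t *v v)"
    by (rule frechet_derivative_at[THEN fun_cong])
       (rule has_derivative_partial(1)[OF smooth_differentiable[OF smooth_\<eta>]])
  finally show ?E
    using smooth_second_derivative_commute[OF smooth_zeta_at, of "(v, 0)" "(s, t)" "(\<phi> s t, 1)"] by simp
qed

lemma energy_contr_metric:
  "energy (contr_metric V P Q \<kappa>) s v t =
     energy P (upper_part s) (upper_part v) t + \<kappa> * energy Q (zeta_at s t) (zeta_s V s t *v v) t"
  by (simp add: energy_def contr_metric_def Let_def matrix_vector_mult_add_rdistrib inner_add_right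
      inner_upper_left_block scaleR_matrix_vector_assoc[symmetric] inner_congruence zeta_at_def)

lemma smooth_contr_metric: "smooth (\<lambda>(s, t). contr_metric V P Q \<kappa> s t)"
proof -
  have "smooth (\<lambda>p. case (i, j) of (Inl a, Inl a') \<Rightarrow> P (upper_part (fst p)) (snd p) $ a $ a' | _ \<Rightarrow> 0)"
    for i j :: "'n + 'h \<times> 'm"
    by (cases i; cases j) (auto intro!: smooth_intros smooth_compose2[OF smooth_P])
  then have "smooth (\<lambda>p. upper_left_block (P (upper_part (fst p)) (snd p)) :: real^('n + 'h \<times> 'm)^('n + 'h \<times> 'm))"
    unfolding upper_left_block_def by (intro smooth_vec_lambda)
  then show ?thesis
    unfolding contr_metric_def Let_def smooth_case_prod
    by (intro smooth_intros smooth_compose2[OF smooth_Q] smooth_compose2[OF smooth_zeta_s]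
        smooth_compose3[OF smooth_zeta])
qed

lemma transpose_contr_metric: "transpose (contr_metric V P Q \<kappa> s t) = contr_metric V P Q \<kappa> s t"
proof -
  have add: "transpose (A + B) = transpose A + transpose B" for A B :: "real^'k^'k"
    by (simp add: transpose_def vec_eq_iff)
  have "P x t $ a $ b = P x t $ b $ a" for x t a b
    using sym_P[of x t] by (metis transpose_def vec_lambda_beta)
  then have "transpose (upper_left_block (P x t)) = (upper_left_block (P x t) :: real^('n + 'h \<times> 'm)^('n + 'h \<times> 'm))" for x t
    by (auto simp: transpose_def upper_left_block_def vec_eq_iff split: sum.splits)
  then show ?thesis
    by (simp add: contr_metric_def Let_def add transpose_scalar matrix_transpose_mul sym_Q matrix_mul_assoc)
qed

text \<open>In the coordinates \<open>(x, z)\<close> the metric is block diagonal, so its energy and the rate of its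
  energy along the closed loop split into a plant part and a virtual part.\<close>

lemma energy_rate_contr_metric:
  "energy_rate (contr_metric V P Q \<kappa>) s v t (\<phi> s t, \<phi>_s s t v, 1) =
     energy_rate P (upper_part s) (upper_part v) t
       (f (upper_part s) (Pi0 *v lower_part s) t, upper_part (\<phi>_s s t v), 1)
     + \<kappa> * energy_rate Q (zeta_at s t) (zeta_s V s t *v v) t
       (\<eta> (zeta_at s t) t, frechet_derivative (\<lambda>z. \<eta> z t) (at (zeta_at s t)) (zeta_s V s t *v v), 1)"
proof -
  let ?EP = "\<lambda>(y, v, t). energy P y v t" and ?EQ = "\<lambda>(y, v, t). energy Q y v t"
  let ?z = "\<lambda>p. (\<lambda>(s, t). zeta_at s t) (fst p, snd (snd p))"
  let ?w = "\<lambda>(s, v, t). zeta_s V s t *v v"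
  define w' where "w' = (\<lambda>(d, e, \<tau>). frechet_derivative (\<lambda>p. frechet_derivative (\<lambda>(s, t). zeta_at s t) (at p) (v, 0)) (at (s, t)) (d, \<tau>)
        + zeta_s V s t *v e)"
  define z' where "z' = (\<lambda>d. frechet_derivative (\<lambda>(s, t). zeta_at s t) (at (s, t)) (fst d, snd (snd d :: (real^('n + 'h \<times> 'm)) \<times> real)))"
  have x: "((\<lambda>p. (upper_part (fst p), upper_part (fst (snd p)), snd (snd p))) has_derivative
     (\<lambda>p. (upper_part (fst p), upper_part (fst (snd p)), snd (snd p)))) (at (s, v, t))"
    by (intro bounded_linear_imp_has_derivative bounded_linear_Pair bounded_linear_compose[OF bounded_linear_upper_part]
         bounded_linear_fst bounded_linear_compose[OF bounded_linear_fst] bounded_linear_compose[OF bounded_linear_snd] bounded_linear_snd)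
  have z: "(?z has_derivative z') (at (s, v, t))"
    unfolding z'_def
    by (rule has_derivative_compose[where g="\<lambda>(s, t). zeta_at s t" and f="\<lambda>p. (fst p, snd (snd p))"])
       (use smooth_has_derivative[OF smooth_zeta_at] in \<open>auto intro!: derivative_eq_intros\<close>)
  have w: "(?w has_derivative w') (at (s, v, t))"
    unfolding w'_def by (rule virtual_variation(1))
  have t: "((\<lambda>p. snd (snd p)) has_derivative (\<lambda>d. snd (snd d))) (at (s, v, t))"
    by (auto intro!: derivative_eq_intros)
  have EP: "((\<lambda>p. ?EP (upper_part (fst p), upper_part (fst (snd p)), snd (snd p))) has_derivative
     (\<lambda>d. energy_rate P (upper_part s) (upper_part v) t (upper_part (fst d), upper_part (fst (snd d)), snd (snd d))))
     (at (s, v, t))"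
    using has_derivative_compose[OF x, of ?EP] energy_has_derivative[OF smooth_P] by simp
  have EQ: "((\<lambda>p. ?EQ (?z p, ?w p, snd (snd p))) has_derivative
     (\<lambda>d. energy_rate Q (zeta_at s t) (zeta_s V s t *v v) t (z' d, w' d, snd (snd d)))) (at (s, v, t))"
    using has_derivative_compose[OF has_derivative_Pair[OF z has_derivative_Pair[OF w t]], of ?EQ]
      energy_has_derivative[OF smooth_Q] by simp
  have "((\<lambda>(s, v, t). energy (contr_metric V P Q \<kappa>) s v t) has_derivative
     (\<lambda>d. energy_rate P (upper_part s) (upper_part v) t (upper_part (fst d), upper_part (fst (snd d)), snd (snd d))
      + \<kappa> * energy_rate Q (zeta_at s t) (zeta_s V s t *v v) t (z' d, w' d, snd (snd d)))) (at (s, v, t))"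
    using has_derivative_add[OF EP has_derivative_mult_right[OF EQ, of \<kappa>]]
    by (simp add: energy_contr_metric case_prod_beta')
  from frechet_derivative_at[OF this, THEN fun_cong, of "(\<phi> s t, \<phi>_s s t v, 1)"]
  show ?thesis
    unfolding energy_rate_def[of "contr_metric V P Q \<kappa>"]
    by (simp add: z'_def w'_def virtual_variation(2) virtual_dynamics upper_part_closed_loop)
qed

end

section \<open>Contraction of the closed loop\<close>

lemma norm_matrix_vector_mult_le: "norm (A *v v) \<le> mat_norm A * norm v" for A :: "real^'a^'b"
  unfolding mat_norm_def by (rule onorm[OF matrix_vector_mul_bounded_linear])

lemma mat_norm_nonneg: "0 \<le> mat_norm A" for A :: "real^'a^'b"
  unfolding mat_norm_def by (rule onorm_pos_le[OF matrix_vector_mul_bounded_linear])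

context continuation_control
begin

definition f_deriv :: "real^'n \<Rightarrow> real^'m \<Rightarrow> real \<Rightarrow> (real^'n) \<times> (real^'m) \<times> real \<Rightarrow> real^'n" where
  "f_deriv x u t = frechet_derivative (\<lambda>(x, u, t). f x u t) (at (x, u, t))"

lemma f_has_derivative: "((\<lambda>(x, u, t). f x u t) has_derivative f_deriv x u t) (at (x, u, t))"
  unfolding f_deriv_def by (rule smooth_has_derivative[OF smooth_f])

lemma linear_f_deriv: "linear (f_deriv x u t)"
  by (rule has_derivative_linear[OF f_has_derivative])

lemma jacobian_f_u_mult: "jacobian (\<lambda>u. f x u t) (at u) *v d = f_deriv x u t (0, d, 0)"
  unfolding f_deriv_def by (rule jacobian_mult[OF has_derivative_partial3(2)[OF smooth_differentiable[OF smooth_f]]])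

lemma f_res_has_derivative_u:
  "((\<lambda>ur. f_res f V x ur t) has_derivative (\<lambda>d. f_deriv x (Pi0 *v U_opt V x t + ur) t (0, d, 0))) (at ur)"
proof -
  have "((\<lambda>ur. (x, Pi0 *v U_opt V x t + ur, t)) has_derivative (\<lambda>d. (0, d, 0))) (at ur)"
    by (auto intro!: derivative_eq_intros)
  from has_derivative_compose[OF this f_has_derivative] show ?thesis by (simp add: f_res_def)
qed

lemma U_opt_has_derivative_x:
  "((\<lambda>x. U_opt V x t) has_derivative (\<lambda>d. jacobian (\<lambda>x. U_opt V x t) (at x) *v d)) (at x)"
proof -
  have "(\<lambda>x. U_opt V x t) differentiable (at x)"
    using has_derivative_partial(1)[of "\<lambda>x t. U_opt V x t" x t] U_opt_has_derivative[of x t]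
    unfolding differentiable_def by blast
  then show ?thesis by (simp add: jacobian_works)
qed

lemma f_res_has_derivative_x:
  "((\<lambda>x. f_res f V x ur t) has_derivative
     (\<lambda>d. f_deriv x (Pi0 *v U_opt V x t + ur) t (d, Pi0 *v (jacobian (\<lambda>x. U_opt V x t) (at x) *v d), 0))) (at x)"
proof -
  have "((\<lambda>x. (x, Pi0 *v U_opt V x t + ur, t)) has_derivative
     (\<lambda>d. (d, Pi0 *v (jacobian (\<lambda>x. U_opt V x t) (at x) *v d), 0))) (at x)"
    by (intro has_derivative_Pair has_derivative_ident has_derivative_const has_derivative_add_const
        bounded_linear.has_derivative[OF matrix_vector_mul_bounded_linear U_opt_has_derivative_x])
  from has_derivative_compose[OF this f_has_derivative] show ?thesis by (simp add: f_res_def)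
qed

lemma upper_part_\<phi>_s:
  "upper_part (\<phi>_s s t v) =
     f_deriv (upper_part s) (Pi0 *v lower_part s) t (upper_part v, Pi0 *v lower_part v, 0)"
proof -
  have 1: "((\<lambda>s. upper_part (\<phi> s t)) has_derivative (\<lambda>v. upper_part (\<phi>_s s t v))) (at s)"
    by (rule bounded_linear.has_derivative[OF bounded_linear_upper_part \<phi>_has_derivative])
  have "((\<lambda>s. (upper_part s, Pi0 *v lower_part s, t)) has_derivative
     (\<lambda>v. (upper_part v, Pi0 *v lower_part v, 0))) (at s)"
    by (intro has_derivative_Pair has_derivative_const bounded_linear_imp_has_derivative
        bounded_linear_upper_part bounded_linear_compose[OF matrix_vector_mul_bounded_linear]
        bounded_linear_lower_part)
  from has_derivative_compose[OF this f_has_derivative]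
  have 2: "((\<lambda>s. upper_part (\<phi> s t)) has_derivative
     (\<lambda>v. f_deriv (upper_part s) (Pi0 *v lower_part s) t (upper_part v, Pi0 *v lower_part v, 0))) (at s)"
    by (simp add: upper_part_closed_loop)
  show ?thesis by (rule fun_cong[OF has_derivative_unique[OF 1 2]])
qed

lemma lower_part_variation:
  "lower_part v = matrix_inv (zeta_U V (lower_part s) (upper_part s) t) *v
     (zeta_s V s t *v v - zeta_x V (lower_part s) (upper_part s) t *v upper_part v)"
  by (simp add: zeta_s_mult matrix_inv_cancel[OF invertible_zeta_U])

text \<open>The input variation splits as \<open>\<delta>U = H\<^sup>-\<^sup>1 w + K \<delta>x + U\<^sup>*\<^sub>x \<delta>x\<close>.  The last summand completes
  the Jacobian of \<open>f\<close> to that of the residual dynamics, whose contraction rate is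
  \<open>\<beta>\<^sub>x + \<beta>\<^sub>p\<close>; the second one costs at most \<open>\<beta>\<^sub>p\<close>; the first one remains as coupling with the
  residual.\<close>

lemma plant_energy_rate_le:
  assumes P_K: "\<And>U x t. sym_sum (P_xU f V P x (Pi0 *v U - Pi0 *v U_opt V x t) t ** K_mat V U x t)
                - \<beta>\<^sub>p *\<^sub>R P x t \<preceq>\<^sub>L 0"
    and L_P: "\<And>x ur t. L_op P (\<lambda>x t. f_res f V x ur t) (\<beta>\<^sub>x + \<beta>\<^sub>p) x t \<preceq>\<^sub>L 0"
  shows "energy_rate P (upper_part s) (upper_part v) t
       (f (upper_part s) (Pi0 *v lower_part s) t, upper_part (\<phi>_s s t v), 1)
     \<le> - \<beta>\<^sub>x * energy P (upper_part s) (upper_part v) t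
       + 2 * (upper_part v \<bullet> (P (upper_part s) t *v f_deriv (upper_part s) (Pi0 *v lower_part s) t
           (0, Pi0 *v (matrix_inv (zeta_U V (lower_part s) (upper_part s) t) *v (zeta_s V s t *v v)), 0)))"
proof -
  define x U \<delta> w where "x = upper_part s" and "U = lower_part s" and "\<delta> = upper_part v"
    and "w = zeta_s V s t *v v"
  define u ur J Hw where "u = Pi0 *v U" and "ur = Pi0 *v U - Pi0 *v U_opt V x t"
    and "J = jacobian (\<lambda>x. U_opt V x t) (at x)" and "Hw = matrix_inv (zeta_U V U x t) *v w"
  have u: "Pi0 *v U_opt V x t + ur = u" by (simp add: u_def ur_def)
  define g' where "g' d = f_deriv x u t (d, Pi0 *v (J *v d), 0)" for d
  let ?fu = "\<lambda>d. f_deriv x u t (0, d, 0)"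
  have g: "((\<lambda>x. f_res f V x ur t) has_derivative g') (at x)"
    using f_res_has_derivative_x[of ur t x] unfolding u g'_def J_def .
  have "lower_part v = Hw + K_mat V U x t *v \<delta> + J *v \<delta>"
    unfolding lower_part_variation[of v s t]
    by (simp add: Hw_def K_mat_def J_def x_def U_def \<delta>_def w_def matrix_vector_mult_diff_rdistrib
        matrix_vector_mult_diff_distrib matrix_vector_mul_assoc
        matrix_vector_mult_diff_rdistrib[of 0, simplified])
  then have "upper_part (\<phi>_s s t v) = f_deriv x u t
      ((\<delta>, Pi0 *v (J *v \<delta>), 0) + (0, Pi0 *v (K_mat V U x t *v \<delta>), 0) + (0, Pi0 *v Hw, 0))"
    unfolding upper_part_\<phi>_s x_def[symmetric] U_def[symmetric] \<delta>_def[symmetric] u_def[symmetric]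
    by (simp add: matrix_vector_right_distrib ac_simps)
  then have up: "upper_part (\<phi>_s s t v) = g' \<delta> + ?fu (Pi0 *v (K_mat V U x t *v \<delta>)) + ?fu (Pi0 *v Hw)"
    by (simp only: linear_add[OF linear_f_deriv] g'_def)
  have rate: "energy_rate P x \<delta> t (f x u t, upper_part (\<phi>_s s t v), 1) = energy_rate P x \<delta> t (f x u t, g' \<delta>, 1)
     + 2 * (\<delta> \<bullet> (P x t *v ?fu (Pi0 *v (K_mat V U x t *v \<delta>)))) + 2 * (\<delta> \<bullet> (P x t *v ?fu (Pi0 *v Hw)))"
    unfolding up energy_rate_eq[OF smooth_P sym_P]
    by (simp add: matrix_vector_right_distrib inner_add_right algebra_simps)
  have "\<delta> \<bullet> (L_op P (\<lambda>x t. f_res f V x ur t) (\<beta>\<^sub>x + \<beta>\<^sub>p) x t *v \<delta>) \<le> 0"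
    using L_P unfolding loewner_le_0_iff by blast
  moreover have "f_res f V x ur t = f x u t" by (simp add: f_res_def u)
  ultimately have 1: "energy_rate P x \<delta> t (f x u t, g' \<delta>, 1) \<le> - (\<beta>\<^sub>x + \<beta>\<^sub>p) * energy P x \<delta> t"
    unfolding inner_L_op[where g="\<lambda>x t. f_res f V x ur t", OF smooth_P sym_P g]
    by (simp add: algebra_simps)
  have "jacobian (\<lambda>ur. f_res f V x ur t) (at ur) *v d = ?fu d" for d
    using jacobian_mult[OF f_res_has_derivative_u[of x t ur]] unfolding u .
  then have "P_xU f V P x ur t ** K_mat V U x t *v \<delta> = P x t *v ?fu (Pi0 *v (K_mat V U x t *v \<delta>))"
    by (simp add: P_xU_def matrix_vector_mul_assoc[symmetric])
  moreover have "\<delta> \<bullet> ((sym_sum (P_xU f V P x ur t ** K_mat V U x t) - \<beta>\<^sub>p *\<^sub>R P x t) *v \<delta>) \<le> 0"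
    using P_K unfolding loewner_le_0_iff ur_def by blast
  ultimately have 2: "2 * (\<delta> \<bullet> (P x t *v ?fu (Pi0 *v (K_mat V U x t *v \<delta>)))) \<le> \<beta>\<^sub>p * energy P x \<delta> t"
    by (simp add: matrix_vector_mult_diff_rdistrib inner_diff_right inner_sym_sum energy_def
        scaleR_matrix_vector_assoc[symmetric])
  have "energy_rate P x \<delta> t (f x u t, upper_part (\<phi>_s s t v), 1)
     \<le> - \<beta>\<^sub>x * energy P x \<delta> t + 2 * (\<delta> \<bullet> (P x t *v ?fu (Pi0 *v Hw)))"
    using 1 2 unfolding rate by (simp add: algebra_simps)
  then show ?thesis unfolding x_def U_def \<delta>_def w_def u_def Hw_def .
qed

text \<open>The coupling is absorbed by Young's inequality for the form \<open>P\<close>: a fraction of the plant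
  decay pays for the part in \<open>\<delta>x\<close>, and a large weight \<open>\<kappa>\<close> lets the decay of the residual energy pay
  for the part in \<open>w\<close>.\<close>

lemma young_pos_semidef:
  fixes A :: "real^'a^'a"
  assumes "transpose A = A" "\<And>v. 0 \<le> v \<bullet> (A *v v)" "\<theta> > 0"
  shows "2 * (v \<bullet> (A *v y)) \<le> \<theta> * (v \<bullet> (A *v v)) + (y \<bullet> (A *v y)) / \<theta>"
proof -
  have "0 \<le> (\<theta> *\<^sub>R v - y) \<bullet> (A *v (\<theta> *\<^sub>R v - y))" by (rule assms)
  also have "\<dots> = \<theta> * \<theta> * (v \<bullet> (A *v v)) - 2 * \<theta> * (v \<bullet> (A *v y)) + y \<bullet> (A *v y)"
    using symmetric_matrix_inner[OF assms(1), of y v]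
    by (simp add: matrix_vector_mult_diff_distrib matrix_vector_mult_scaleR inner_diff_left inner_diff_right
        algebra_simps)
  finally show ?thesis using assms(3) by (simp add: field_simps)
qed

theorem L_op_contr_metric_le:
  assumes f_u_bound: "\<And>x u t. mat_norm (jacobian (\<lambda>u. f x u t) (at u)) \<le> cuf"
    and P_pos: "uniformly_pos_def P" and Q_pos: "uniformly_pos_def Q"
    and P_upper: "\<And>x t. P x t \<preceq>\<^sub>L mat cP"
    and betas: "\<beta>\<^sub>x > 0" "\<beta>\<^sub>z > 0"
    and L_Q: "\<And>z t. L_op Q \<eta> \<beta>\<^sub>z z t \<preceq>\<^sub>L 0"
    and P_K: "\<And>U x t. sym_sum (P_xU f V P x (Pi0 *v U - Pi0 *v U_opt V x t) t ** K_mat V U x t)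
                - \<beta>\<^sub>p *\<^sub>R P x t \<preceq>\<^sub>L 0"
    and L_P: "\<And>x ur t. L_op P (\<lambda>x t. f_res f V x ur t) (\<beta>\<^sub>x + \<beta>\<^sub>p) x t \<preceq>\<^sub>L 0"
  shows "\<exists>\<kappa>>0. \<exists>\<gamma>>0. \<forall>s t. L_op (contr_metric V P Q \<kappa>) \<phi> \<gamma> s t \<preceq>\<^sub>L 0"
proof -
  obtain \<epsilon>P where \<epsilon>P: "\<epsilon>P > 0" "\<And>x t v. \<epsilon>P * (v \<bullet> v) \<le> energy P x v t"
    using P_pos unfolding uniformly_pos_def_def loewner_le_mat_iff energy_def by blast
  obtain \<epsilon>Q where \<epsilon>Q: "\<epsilon>Q > 0" "\<And>x t v. \<epsilon>Q * (v \<bullet> v) \<le> energy Q x v t"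
    using Q_pos unfolding uniformly_pos_def_def loewner_le_mat_iff energy_def by blast
  define c where "c = cuf * mat_norm (Pi0 :: real^('h \<times> 'm)^'m) / lam"
  \<comment> \<open>half of the plant rate is spent on the coupling; \<open>C\<close> bounds what it costs the residual\<close>
  define \<theta> where "\<theta> = \<beta>\<^sub>x / 2"
  define C where "C = \<bar>cP\<bar> * c\<^sup>2 / (\<theta> * \<epsilon>Q)"
  define \<kappa> where "\<kappa> = 2 * C / \<beta>\<^sub>z + 1"
  define \<gamma> where "\<gamma> = min (\<beta>\<^sub>x / 2) (\<beta>\<^sub>z / 2)"
  have \<theta>: "\<theta> > 0" using betas by (simp add: \<theta>_def)
  have C: "C \<ge> 0" using \<theta> \<epsilon>Q by (simp add: C_def mult_ac)
  have \<kappa>: "\<kappa> > 0" "C \<le> \<kappa> * \<beta>\<^sub>z / 2"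
    using C betas by (simp_all add: \<kappa>_def field_simps add_nonneg_pos)
  have \<gamma>: "\<gamma> > 0" "\<gamma> \<le> \<beta>\<^sub>x / 2" "\<gamma> \<le> \<beta>\<^sub>z / 2" using betas by (simp_all add: \<gamma>_def)
  have cuf: "cuf \<ge> 0" using f_u_bound mat_norm_nonneg order_trans by blast
  have EP: "0 \<le> energy P x v t" for x v t
    by (rule order_trans[OF mult_nonneg_nonneg[OF less_imp_le[OF \<epsilon>P(1)] inner_ge_zero] \<epsilon>P(2)])
  have EQ: "0 \<le> energy Q z v t" for z v t
    by (rule order_trans[OF mult_nonneg_nonneg[OF less_imp_le[OF \<epsilon>Q(1)] inner_ge_zero] \<epsilon>Q(2)])
  have "v \<bullet> (L_op (contr_metric V P Q \<kappa>) \<phi> \<gamma> s t *v v) \<le> 0" for s t v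
  proof -
    define x U z \<delta> w where "x = upper_part s" and "U = lower_part s" and "z = zeta_at s t"
      and "\<delta> = upper_part v" and "w = zeta_s V s t *v v"
    define y where "y = f_deriv x (Pi0 *v U) t (0, Pi0 *v (matrix_inv (zeta_U V U x t) *v w), 0)"
    have "norm y \<le> cuf * norm (Pi0 *v (matrix_inv (zeta_U V U x t) *v w))"
      unfolding y_def jacobian_f_u_mult[symmetric]
      using norm_matrix_vector_mult_le f_u_bound by (meson mult_right_mono norm_ge_zero order_trans)
    also have "\<dots> \<le> cuf * (mat_norm (Pi0 :: real^('h \<times> 'm)^'m) * (norm w / lam))"
      using cuf norm_matrix_vector_mult_le norm_zeta_U_inv mat_norm_nonneg
      by (meson mult_left_mono order_trans)
    finally have "norm y \<le> c * norm w" by (simp add: c_def)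
    then have "y \<bullet> y \<le> c\<^sup>2 * (w \<bullet> w)"
      using power_mono[of "norm y" "c * norm w" 2] by (simp add: power_mult_distrib dot_square_norm)
    then have "y \<bullet> y \<le> c\<^sup>2 * (energy Q z w t / \<epsilon>Q)"
      using \<epsilon>Q(1) \<epsilon>Q(2)[of w z t] by (smt (verit) mult_left_mono pos_le_divide_eq mult.commute zero_le_power2)
    then have "\<bar>cP\<bar> * (y \<bullet> y) / \<theta> \<le> \<bar>cP\<bar> * (c\<^sup>2 * (energy Q z w t / \<epsilon>Q)) / \<theta>"
      using \<theta> by (intro divide_right_mono mult_left_mono) auto
    also have "\<dots> = C * energy Q z w t" by (simp add: C_def mult_ac)
    finally have "\<bar>cP\<bar> * (y \<bullet> y) / \<theta> \<le> C * energy Q z w t" .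
    moreover have "y \<bullet> (P x t *v y) \<le> \<bar>cP\<bar> * (y \<bullet> y)"
      using P_upper[of x t] unfolding loewner_le_mat_iff
      by (meson abs_ge_self inner_ge_zero mult_right_mono order_trans)
    then have "(y \<bullet> (P x t *v y)) / \<theta> \<le> \<bar>cP\<bar> * (y \<bullet> y) / \<theta>"
      using \<theta> by (simp add: divide_right_mono)
    moreover have "2 * (\<delta> \<bullet> (P x t *v y)) \<le> \<theta> * energy P x \<delta> t + (y \<bullet> (P x t *v y)) / \<theta>"
      unfolding energy_def
      by (rule young_pos_semidef[OF sym_P EP[unfolded energy_def] \<theta>])
    ultimately have coupling: "2 * (\<delta> \<bullet> (P x t *v y)) \<le> \<theta> * energy P x \<delta> t + C * energy Q z w t" by linarith
    have Qv: "w \<bullet> (L_op Q \<eta> \<beta>\<^sub>z z t *v w) \<le> 0" using L_Q unfolding loewner_le_0_iff by blast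
    have D: "((\<lambda>z. \<eta> z t) has_derivative frechet_derivative (\<lambda>z. \<eta> z t) (at z)) (at z)"
      using has_derivative_partial(1)[OF smooth_differentiable[OF smooth_\<eta>]]
      unfolding frechet_derivative_works[symmetric] differentiable_def by blast
    have Qrate: "energy_rate Q z w t (\<eta> z t, frechet_derivative (\<lambda>z. \<eta> z t) (at z) w, 1) \<le> - \<beta>\<^sub>z * energy Q z w t"
      using Qv unfolding inner_L_op[where g=\<eta>, OF smooth_Q sym_Q D] by simp
    have Prate: "energy_rate P x \<delta> t (f x (Pi0 *v U) t, upper_part (\<phi>_s s t v), 1)
        \<le> - \<beta>\<^sub>x * energy P x \<delta> t + 2 * (\<delta> \<bullet> (P x t *v y))"
      using plant_energy_rate_le[OF P_K L_P] unfolding x_def U_def \<delta>_def y_def w_def .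
    have "v \<bullet> (L_op (contr_metric V P Q \<kappa>) \<phi> \<gamma> s t *v v) =
       energy_rate P x \<delta> t (f x (Pi0 *v U) t, upper_part (\<phi>_s s t v), 1)
       + \<kappa> * energy_rate Q z w t (\<eta> z t, frechet_derivative (\<lambda>z. \<eta> z t) (at z) w, 1)
       + \<gamma> * (energy P x \<delta> t + \<kappa> * energy Q z w t)"
      unfolding inner_L_op[where g=\<phi>, OF smooth_contr_metric transpose_contr_metric \<phi>_has_derivative]
        energy_rate_contr_metric energy_contr_metric x_def U_def z_def \<delta>_def w_def ..
    also have "\<dots> \<le> (- \<beta>\<^sub>x * energy P x \<delta> t + (\<theta> * energy P x \<delta> t + C * energy Q z w t))
       + \<kappa> * (- \<beta>\<^sub>z * energy Q z w t) + \<gamma> * (energy P x \<delta> t + \<kappa> * energy Q z w t)"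
      using Prate coupling mult_left_mono[OF Qrate, of \<kappa>] \<kappa> by linarith
    also have "\<dots> = (\<gamma> - \<beta>\<^sub>x / 2) * energy P x \<delta> t + (C - \<kappa> * \<beta>\<^sub>z / 2) * energy Q z w t
       + (\<kappa> * energy Q z w t) * (\<gamma> - \<beta>\<^sub>z / 2)"
      by (simp add: \<theta>_def field_simps)
    also have "\<dots> \<le> 0"
      using mult_nonpos_nonneg[OF _ EP[of x \<delta> t], of "\<gamma> - \<beta>\<^sub>x / 2"] mult_nonpos_nonneg[OF _ EQ[of z w t], of "C - \<kappa> * \<beta>\<^sub>z / 2"]
        mult_nonneg_nonpos[of "\<kappa> * energy Q z w t" "\<gamma> - \<beta>\<^sub>z / 2"] \<gamma> \<kappa> EQ[of z w t] by simp
    finally show ?thesis .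
  qed
  then have "L_op (contr_metric V P Q \<kappa>) \<phi> \<gamma> s t \<preceq>\<^sub>L 0" for s t
    unfolding loewner_le_0_iff
    using transpose_L_op[where g=\<phi>, OF smooth_contr_metric transpose_contr_metric \<phi>_has_derivative] by blast
  then show ?thesis using \<kappa>(1) \<gamma>(1) by blast
qed

text \<open>The map \<open>(\<delta>x, \<delta>U) \<mapsto> (\<delta>x, w)\<close> has the inverse \<open>\<delta>U = H\<^sup>-\<^sup>1 (w - \<zeta>\<^sub>x \<delta>x)\<close>, which is uniformly
  bounded when \<open>\<zeta>\<^sub>x\<close> is.\<close>

lemma norm_lower_part_le:
  "norm (lower_part v) \<le> (norm (zeta_s V s t *v v)
     + mat_norm (zeta_x V (lower_part s) (upper_part s) t) * norm (upper_part v)) / lam"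
proof -
  have "norm (lower_part v) \<le> norm (zeta_s V s t *v v - zeta_x V (lower_part s) (upper_part s) t *v upper_part v) / lam"
    by (subst lower_part_variation[of v s t]) (rule norm_zeta_U_inv)
  also have "\<dots> \<le> (norm (zeta_s V s t *v v)
     + mat_norm (zeta_x V (lower_part s) (upper_part s) t) * norm (upper_part v)) / lam"
    using lam_pos norm_triangle_ineq4[of "zeta_s V s t *v v" "zeta_x V (lower_part s) (upper_part s) t *v upper_part v"]
      norm_matrix_vector_mult_le[of "zeta_x V (lower_part s) (upper_part s) t" "upper_part v"]
    by (intro divide_right_mono) auto
  finally show ?thesis .
qed

lemma uniformly_pos_def_contr_metric:
  assumes P_pos: "uniformly_pos_def P" and Q_pos: "uniformly_pos_def Q" and \<kappa>: "\<kappa> > 0"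
    and c: "\<And>U x t. mat_norm (zeta_x V U x t) \<le> c"
  shows "uniformly_pos_def (contr_metric V P Q \<kappa>)"
proof -
  obtain \<epsilon>P where \<epsilon>P: "\<epsilon>P > 0" "\<And>x t v. \<epsilon>P * (v \<bullet> v) \<le> energy P x v t"
    using P_pos unfolding uniformly_pos_def_def loewner_le_mat_iff energy_def by blast
  obtain \<epsilon>Q where \<epsilon>Q: "\<epsilon>Q > 0" "\<And>x t v. \<epsilon>Q * (v \<bullet> v) \<le> energy Q x v t"
    using Q_pos unfolding uniformly_pos_def_def loewner_le_mat_iff energy_def by blast
  define a where "a = 1 + 2 * c\<^sup>2 / lam\<^sup>2"
  define \<epsilon> where "\<epsilon> = min (\<epsilon>P / a) (\<kappa> * \<epsilon>Q * lam\<^sup>2 / 2)"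
  have a: "a > 0" by (simp add: a_def add_pos_nonneg)
  have \<epsilon>: "\<epsilon> > 0" "\<epsilon> * a \<le> \<epsilon>P" "\<epsilon> * (2 / lam\<^sup>2) \<le> \<kappa> * \<epsilon>Q"
    using \<epsilon>P \<epsilon>Q \<kappa> a lam_pos by (simp_all add: \<epsilon>_def min_def field_simps)
  have "\<epsilon> * (v \<bullet> v) \<le> v \<bullet> (contr_metric V P Q \<kappa> s t *v v)" for v s t
  proof -
    define \<delta> w where "\<delta> = upper_part v" and "w = zeta_s V s t *v v"
    have "norm (lower_part v) \<le> (norm w + c * norm \<delta>) / lam"
      using norm_lower_part_le[of v s t] mult_right_mono[OF c, of "norm \<delta>"] lam_pos
      unfolding \<delta>_def w_def by (smt (verit) divide_right_mono norm_ge_zero)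
    then have "(norm (lower_part v))\<^sup>2 \<le> ((norm w + c * norm \<delta>) / lam)\<^sup>2"
      by (rule power_mono) simp
    also have "\<dots> \<le> (2 * (norm w)\<^sup>2 + 2 * (c * norm \<delta>)\<^sup>2) / lam\<^sup>2"
      unfolding power_divide
      using sum_squares_bound[of "norm w" "c * norm \<delta>"] lam_pos
      by (intro divide_right_mono) (simp_all add: power2_sum)
    finally have "lower_part v \<bullet> lower_part v \<le> (2 / lam\<^sup>2) * (w \<bullet> w) + (2 * c\<^sup>2 / lam\<^sup>2) * (\<delta> \<bullet> \<delta>)"
      by (simp add: dot_square_norm power_mult_distrib add_divide_distrib)
    then have "v \<bullet> v \<le> a * (\<delta> \<bullet> \<delta>) + (2 / lam\<^sup>2) * (w \<bullet> w)"
      unfolding inner_sum_parts[of v v] \<delta>_def[symmetric] a_def by (simp add: algebra_simps)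
    then have "\<epsilon> * (v \<bullet> v) \<le> \<epsilon> * (a * (\<delta> \<bullet> \<delta>) + (2 / lam\<^sup>2) * (w \<bullet> w))"
      using \<epsilon>(1) by (simp add: mult_left_mono)
    also have "\<dots> = (\<epsilon> * a) * (\<delta> \<bullet> \<delta>) + (\<epsilon> * (2 / lam\<^sup>2)) * (w \<bullet> w)" by (simp add: algebra_simps)
    also have "\<dots> \<le> \<epsilon>P * (\<delta> \<bullet> \<delta>) + (\<kappa> * \<epsilon>Q) * (w \<bullet> w)"
      by (intro add_mono mult_right_mono \<epsilon>) auto
    also have "\<dots> \<le> energy (contr_metric V P Q \<kappa>) s v t"
      unfolding energy_contr_metric \<delta>_def w_def mult.assoc
      by (intro add_mono \<epsilon>P(2) mult_left_mono \<epsilon>Q(2)) (use \<kappa> in simp)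
    finally show ?thesis by (simp add: energy_def)
  qed
  then show ?thesis
    unfolding uniformly_pos_def_def loewner_le_mat_iff using \<epsilon>(1) transpose_contr_metric by blast
qed

end

section \<open>Contraction of pairs of solutions\<close>

text \<open>A uniform version of the first order expansion: since the derivative of \<open>G\<close> is uniformly
  continuous near a compact set, one step size and one tolerance for the direction serve all
  points of the set.\<close>

lemma uniform_one_step:
  fixes G :: "'a::euclidean_space \<Rightarrow> real"
  assumes G: "smooth G" and K: "compact K" and F: "continuous_on K F" and \<delta>: "\<delta> > 0"
  obtains h0 where "h0 > 0" and "\<And>y h e. \<lbrakk>y \<in> K; 0 < h; h \<le> h0; norm e \<le> h0\<rbrakk> \<Longrightarrow>
    G (y + h *\<^sub>R (F y + e)) \<le> G y + h * (frechet_derivative G (at y) (F y) + \<delta>)"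
proof -
  obtain R where R: "R > 0" "\<And>y. y \<in> K \<Longrightarrow> norm (F y) \<le> R"
    using compact_imp_bounded[OF compact_continuous_image[OF F K]] bounded_pos by (metis imageI)
  let ?H = "\<lambda>(a, w). frechet_derivative G (at a) w"
  let ?T = "((\<lambda>(y, b). y + b) ` (K \<times> cball 0 (R + 1))) \<times> cball (0 :: 'a) (R + 1)"
  have "compact ?T"
    by (intro compact_Times compact_continuous_image K compact_cball)
       (auto simp: case_prod_beta' intro!: continuous_intros)
  moreover have "smooth ?H"
    unfolding smooth_case_prod by (intro smooth_frechet_derivative G smooth_intros)
  ultimately have "uniformly_continuous_on ?T ?H"
    by (intro compact_uniformly_continuous smooth_continuous_on)
  then obtain d where d: "d > 0"
    "\<And>p q. \<lbrakk>p \<in> ?T; q \<in> ?T; dist q p < d\<rbrakk> \<Longrightarrow> dist (?H q) (?H p) < \<delta>"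
    using \<delta> unfolding uniformly_continuous_on_def by metis
  define h0 where "h0 = min 1 (d / (2 * (R + 2)))"
  have "h0 * (R + 2) \<le> d / (2 * (R + 2)) * (R + 2)"
    using R by (intro mult_right_mono) (auto simp: h0_def)
  also have "\<dots> = d / 2" using R by (simp add: field_simps)
  finally have h0: "h0 > 0" "h0 \<le> 1" "h0 * (R + 2) < d"
    using d R by (auto simp: h0_def)
  show thesis
  proof (rule that[OF h0(1)])
    fix y e :: 'a and h :: real assume y: "y \<in> K" and h: "0 < h" "h \<le> h0" and e: "norm e \<le> h0"
    define w where "w = F y + e"
    have w: "norm w \<le> R + 1"
      using norm_triangle_ineq[of "F y" e] R(2)[OF y] e h0 by (simp add: w_def)
    have "((\<lambda>r. G (y + r *\<^sub>R w)) has_derivative (\<lambda>s. frechet_derivative G (at (y + r *\<^sub>R w)) (s *\<^sub>R w))) (at r within S)" for r S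
      by (intro has_derivative_compose[OF _ smooth_has_derivative[OF G]]) (auto intro!: derivative_eq_intros)
    from mvt_simple[OF h(1) this] obtain r where r: "0 < r" "r < h" and
      eq: "G (y + h *\<^sub>R w) - G (y + 0 *\<^sub>R w) = frechet_derivative G (at (y + r *\<^sub>R w)) ((h - 0) *\<^sub>R w)"
      by auto
    have rw: "norm (r *\<^sub>R w) \<le> h0 * (R + 1)"
      using r h w R by (simp add: mult_mono)
    moreover have "h0 * (R + 1) \<le> R + 1" using h0 R by (simp add: mult_left_le_one_le)
    ultimately have "(y + r *\<^sub>R w, w) \<in> ?T" using y w by (auto intro!: image_eqI[of _ _ "(y, r *\<^sub>R w)"])
    moreover have "(y, F y) \<in> ?T" using y R by (force intro!: image_eqI[of _ _ "(y, 0)"])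
    moreover have "dist (y + r *\<^sub>R w, w) (y, F y) < d"
    proof -
      have "dist (y + r *\<^sub>R w, w) (y, F y) \<le> norm (r *\<^sub>R w) + norm e"
        using norm_Pair_le[of "r *\<^sub>R w" e] by (simp add: dist_norm w_def)
      also have "\<dots> \<le> h0 * (R + 2)" using rw e by (simp add: algebra_simps)
      finally show ?thesis using h0 by simp
    qed
    ultimately have "dist (?H (y + r *\<^sub>R w, w)) (?H (y, F y)) < \<delta>" by (intro d(2)) auto
    then have "frechet_derivative G (at (y + r *\<^sub>R w)) w \<le> frechet_derivative G (at y) (F y) + \<delta>"
      by (simp add: dist_real_def)
    then have "h * frechet_derivative G (at (y + r *\<^sub>R w)) w \<le> h * (frechet_derivative G (at y) (F y) + \<delta>)"
      using h by simp
    moreover have "frechet_derivative G (at (y + r *\<^sub>R w)) (h *\<^sub>R w) = h * frechet_derivative G (at (y + r *\<^sub>R w)) w"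
      using linear_scale[OF has_derivative_linear[OF smooth_has_derivative[OF G]]] by simp
    ultimately show "G (y + h *\<^sub>R (F y + e)) \<le> G y + h * (frechet_derivative G (at y) (F y) + \<delta>)"
      using eq by (simp add: w_def)
  qed
qed

lemma solution_continuous: "solution_from g t0 y \<Longrightarrow> continuous_on {t0..} y"
  unfolding solution_from_def
  by (auto intro!: continuous_on_vector_derivative)

lemma uniform_euler_residual:
  fixes \<phi> :: "'a::euclidean_space \<Rightarrow> real \<Rightarrow> 'a"
  assumes \<phi>: "continuous_on UNIV (\<lambda>(s, t). \<phi> s t)" and s: "solution_from \<phi> t0 s" and \<omega>: "\<omega> > 0"
  obtains h0 where "h0 > 0" and "\<And>t h. \<lbrakk>t0 \<le> t; 0 < h; h \<le> h0; t + h \<le> T\<rbrakk> \<Longrightarrow>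
    norm (s (t + h) - s t - h *\<^sub>R \<phi> (s t) t) \<le> h * \<omega>"
proof -
  have "continuous_on {t0..T} (\<lambda>t. (\<lambda>(s, t). \<phi> s t) (s t, t))"
    by (rule continuous_on_compose2[OF \<phi>])
       (auto intro!: continuous_intros continuous_on_subset[OF solution_continuous[OF s]])
  then have "uniformly_continuous_on {t0..T} (\<lambda>t. \<phi> (s t) t)"
    by (simp add: compact_uniformly_continuous)
  then obtain d where d: "d > 0" "\<And>r t. \<lbrakk>t \<in> {t0..T}; r \<in> {t0..T}; dist r t < d\<rbrakk> \<Longrightarrow>
      dist (\<phi> (s r) r) (\<phi> (s t) t) < \<omega>"
    using \<omega> unfolding uniformly_continuous_on_def by metis
  show thesis
  proof (rule that[of "d / 2"])
    fix t h assume t: "t0 \<le> t" "0 < h" "h \<le> d / 2" "t + h \<le> T"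
    have "((\<lambda>r. s r - r *\<^sub>R \<phi> (s t) t) has_derivative (\<lambda>a. a *\<^sub>R (\<phi> (s r) r - \<phi> (s t) t))) (at r within {t..t+h})"
      if "r \<in> {t..t+h}" for r
    proof -
      have "(s has_vector_derivative \<phi> (s r) r) (at r within {t..t+h})"
        by (rule has_vector_derivative_within_subset[where S="{t0..}"])
           (use s that t in \<open>auto simp: solution_from_def\<close>)
      then show ?thesis
        unfolding has_vector_derivative_def by (auto intro!: derivative_eq_intros simp: algebra_simps)
    qed
    moreover have "onorm (\<lambda>a. a *\<^sub>R (\<phi> (s r) r - \<phi> (s t) t)) \<le> \<omega>" if "r \<in> {t..t+h}" for r
    proof -
      have "norm (\<phi> (s r) r - \<phi> (s t) t) \<le> \<omega>"
        using d(2)[of t r] that t d(1) by (auto simp: dist_norm)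
      then show ?thesis
        using onorm_scaleR_left[of "\<lambda>a::real. a" "\<phi> (s r) r - \<phi> (s t) t"] bounded_linear_ident
        by (simp add: onorm_id)
    qed
    ultimately have "norm ((s (t + h) - (t + h) *\<^sub>R \<phi> (s t) t) - (s t - t *\<^sub>R \<phi> (s t) t)) \<le> \<omega> * norm ((t + h) - t)"
      using t by (intro differentiable_bound[where S="{t..t+h}"]) auto
    then show "norm (s (t + h) - s t - h *\<^sub>R \<phi> (s t) t) \<le> h * \<omega>"
      using t by (simp add: algebra_simps)
  qed (use d in simp)
qed

lemma path_energy_bound:
  fixes \<psi> :: "'a::euclidean_space \<Rightarrow> 'b::euclidean_space"
  assumes \<psi>: "\<And>s. (\<psi> has_derivative \<psi>' s) (at s)" and C: "\<And>s v. (norm (\<psi>' s v))\<^sup>2 \<le> C * E s v"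
    and c: "\<And>r. r \<in> {0..1} \<Longrightarrow> (c has_vector_derivative v r) (at r within {0..1})"
    and B: "\<And>r. r \<in> {0..1} \<Longrightarrow> E (c r) (v r) \<le> B" and "C \<ge> 0" and r: "r \<in> {0..1::real}"
  shows "norm (\<psi> (c r) - \<psi> (c 0)) \<le> sqrt (C * B)"
proof -
  have "((\<lambda>r. \<psi> (c r)) has_derivative (\<lambda>a. \<psi>' (c r) (a *\<^sub>R v r))) (at r within {0..1})"
    if "r \<in> {0..1}" for r
    using has_derivative_compose[OF c[OF that, unfolded has_vector_derivative_def] \<psi>] .
  moreover have "onorm (\<lambda>a. \<psi>' (c r) (a *\<^sub>R v r)) \<le> sqrt (C * B)" if "r \<in> {0..1}" for r
  proof (rule onorm_le)
    fix a :: real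
    have "(norm (\<psi>' (c r) (v r)))\<^sup>2 \<le> C * B"
      using C[of "c r" "v r"] B[OF that] \<open>C \<ge> 0\<close> by (meson mult_left_mono order_trans)
    then have "norm (\<psi>' (c r) (v r)) \<le> sqrt (C * B)" by (rule real_le_rsqrt)
    moreover have "\<psi>' (c r) (a *\<^sub>R v r) = a *\<^sub>R \<psi>' (c r) (v r)"
      by (rule linear_scale[OF has_derivative_linear[OF \<psi>]])
    ultimately show "norm (\<psi>' (c r) (a *\<^sub>R v r)) \<le> sqrt (C * B) * norm a"
      by (simp add: mult.commute[of _ "\<bar>a\<bar>"] mult_left_mono)
  qed
  ultimately have "norm (\<psi> (c r) - \<psi> (c 0)) \<le> sqrt (C * B) * norm (r - 0)"
    using r by (intro differentiable_bound[where S="{0..1::real}" and f="\<lambda>r. \<psi> (c r)"]) auto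
  moreover have "0 \<le> C * B"
    using C[of "c 0" "v 0"] B[of 0] \<open>C \<ge> 0\<close> by (smt (verit) atLeastAtMost_iff mult_left_mono zero_le_power2)
  ultimately show ?thesis using r by (smt (verit) atLeastAtMost_iff mult_left_le real_norm_def real_sqrt_ge_zero)
qed

text \<open>Infinitesimal contraction makes any two solutions approach each other.  A curve joining them
  is transported by Euler steps, which, unlike the flow, are defined for all points of the curve and
  differentiable along it.  In each step the curve is corrected so that its endpoints stay on the
  two solutions, and the energy of its tangent vectors is followed pointwise along the curve.  A
  one-step error \<open>h \<delta>\<close> accumulates to at most \<open>\<delta> / \<gamma>\<close>, with \<open>\<delta>\<close> arbitrarily small for small
  steps.  The map \<open>\<psi>\<close> is Lipschitz with respect to the energy; it measures the distance of the
  solutions and, through \<open>bounded\<close>, confines the curves to a compact set over any finite time.\<close>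

theorem solutions_contract:
  fixes \<phi> :: "'a::euclidean_space \<Rightarrow> real \<Rightarrow> 'a"
    and E :: "'a \<Rightarrow> 'a \<Rightarrow> real \<Rightarrow> real"
    and \<psi> :: "'a \<Rightarrow> real \<Rightarrow> 'b::euclidean_space"
  assumes \<phi>: "smooth (\<lambda>(s, t). \<phi> s t)" and \<phi>_s: "\<And>s t. ((\<lambda>s. \<phi> s t) has_derivative \<phi>_s s t) (at s)"
    and E: "smooth (\<lambda>(s, v, t). E s v t)"
    and rate: "\<And>s v t. frechet_derivative (\<lambda>(s, v, t). E s v t) (at (s, v, t)) (\<phi> s t, \<phi>_s s t v, 1) \<le> - \<gamma> * E s v t"
    and \<gamma>: "\<gamma> > 0"
    and \<psi>_cont: "continuous_on UNIV (\<lambda>(s, t). \<psi> s t)"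
    and \<psi>: "\<And>s t. ((\<lambda>s. \<psi> s t) has_derivative \<psi>' s t) (at s)"
    and C: "C > 0" "\<And>s v t. (norm (\<psi>' s t v))\<^sup>2 \<le> C * E s v t"
    and bounded: "\<And>T R. bounded {(s, v). \<exists>t\<in>{t0..T}. norm (\<psi> s t) \<le> R \<and> E s v t \<le> R}"
    and s1: "solution_from \<phi> t0 s1" and s2: "solution_from \<phi> t0 s2"
  shows "\<exists>A. \<forall>T>t0. (norm (\<psi> (s2 T) T - \<psi> (s1 T) T))\<^sup>2 \<le> A * exp (- \<gamma> * (T - t0))"
proof -
  have E_nonneg: "0 \<le> E s v t" for s v t
    using C(2)[of s t v] C(1) by (smt (verit) mult_less_0_iff zero_le_power2 zero_less_mult_iff)
  define c0 where "c0 r = s1 t0 + r *\<^sub>R (s2 t0 - s1 t0)" for r :: real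
  have "continuous_on {0..1} (\<lambda>r. (\<lambda>(s, v, t). E s v t) (c0 r, s2 t0 - s1 t0, t0))"
    unfolding c0_def
    by (rule continuous_on_compose2[OF smooth_continuous_on[OF E, of UNIV]]) (auto intro!: continuous_intros)
  then have "bounded ((\<lambda>r. E (c0 r) (s2 t0 - s1 t0) t0) ` {0..1})"
    by (intro compact_imp_bounded compact_continuous_image) auto
  then obtain E0 where E0: "E0 > 0" "\<And>r. r \<in> {0..1} \<Longrightarrow> E (c0 r) (s2 t0 - s1 t0) t0 \<le> E0"
    unfolding bounded_pos by (force simp: abs_le_iff)
  have "(norm (\<psi> (s2 T) T - \<psi> (s1 T) T))\<^sup>2 \<le> C * (exp (- \<gamma> * (T - t0)) * E0 + \<delta> / \<gamma>)"
    if T: "T > t0" and \<delta>: "0 < \<delta>" "\<delta> \<le> \<gamma>" for T \<delta>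
  proof -
    have "continuous_on {t0..T} (\<lambda>t. (\<lambda>(s, t). \<psi> s t) (s1 t, t))"
      by (rule continuous_on_compose2[OF \<psi>_cont])
         (auto intro!: continuous_intros continuous_on_subset[OF solution_continuous[OF s1]])
    then have "bounded ((\<lambda>t. \<psi> (s1 t) t) ` {t0..T})"
      by (intro compact_imp_bounded compact_continuous_image) auto
    then obtain R1 where "\<forall>y\<in>(\<lambda>t. \<psi> (s1 t) t) ` {t0..T}. norm y \<le> R1"
      unfolding bounded_iff by blast
    then have R1: "norm (\<psi> (s1 t) t) \<le> R1" if "t \<in> {t0..T}" for t
      using that by blast
    \<comment> \<open>\<open>B\<close> bounds the energies along all curves because \<open>\<delta> / \<gamma> \<le> 1\<close>; hence the curves and
      their tangent vectors stay in the compact set \<open>K\<close>\<close>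
    define B where "B = E0 + 1"
    define R where "R = max B (R1 + sqrt (C * B))"
    define K0 where "K0 = closure {(s, v). \<exists>t\<in>{t0..T}. norm (\<psi> s t) \<le> R \<and> E s v t \<le> R}"
    define K where "K = (\<lambda>((s, v), t). (s, v, t)) ` (K0 \<times> {t0..T})"
    have "compact K"
      unfolding K_def K0_def
      by (intro compact_continuous_image compact_Times compact_Icc)
         (use bounded in \<open>auto simp: case_prod_beta' intro!: continuous_intros\<close>)
    have K: "(s, v, t) \<in> K" if "t \<in> {t0..T}" "norm (\<psi> s t) \<le> R" "E s v t \<le> R" for s v t
      unfolding K_def K0_def
      by (rule image_eqI[of _ _ "((s, v), t)"]) (use that in \<open>auto intro!: closure_subset[THEN subsetD]\<close>)
    define F where "F = (\<lambda>(s, v, t). (\<phi> s t, \<phi>_s s t v, 1 :: real))"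
    have "\<phi>_s s t v = frechet_derivative (\<lambda>(s, t). \<phi> s t) (at (s, t)) (v, 0)" for s t v
      by (rule fun_cong[OF has_derivative_unique[OF \<phi>_s has_derivative_partial(1)[OF smooth_differentiable[OF \<phi>]]]])
    then have "F = (\<lambda>p. (\<phi> (fst p) (snd (snd p)),
       frechet_derivative (\<lambda>(s, t). \<phi> s t) (at (fst p, snd (snd p))) (fst (snd p), 0), 1))"
      by (auto simp: F_def)
    then have "continuous_on K F"
      by (simp only:) (intro smooth_continuous_on smooth_Pair smooth_compose2[OF \<phi>]
          smooth_frechet_derivative[OF \<phi>] smooth_intros)
    obtain h0 where h0: "h0 > 0" and step: "\<And>y h e. \<lbrakk>y \<in> K; 0 < h; h \<le> h0; norm e \<le> h0\<rbrakk> \<Longrightarrow>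
      (\<lambda>(s, v, t). E s v t) (y + h *\<^sub>R (F y + e)) \<le> (\<lambda>(s, v, t). E s v t) y
         + h * (frechet_derivative (\<lambda>(s, v, t). E s v t) (at y) (F y) + \<delta>)"
      by (rule uniform_one_step[OF E \<open>compact K\<close> \<open>continuous_on K F\<close> \<delta>(1)]) (rule that)
    \<comment> \<open>the correction enters the point once and the tangent vector, as a difference, twice\<close>
    have \<omega>: "h0 / 3 > 0" using h0 by simp
    obtain h1 where h1: "h1 > 0" and res1: "\<And>t h. \<lbrakk>t0 \<le> t; 0 < h; h \<le> h1; t + h \<le> T\<rbrakk> \<Longrightarrow>
        norm (s1 (t + h) - s1 t - h *\<^sub>R \<phi> (s1 t) t) \<le> h * (h0 / 3)"
      by (rule uniform_euler_residual[OF smooth_continuous_on[OF \<phi>] s1 \<omega>, where T=T]) (rule that)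
    obtain h2 where h2: "h2 > 0" and res2: "\<And>t h. \<lbrakk>t0 \<le> t; 0 < h; h \<le> h2; t + h \<le> T\<rbrakk> \<Longrightarrow>
        norm (s2 (t + h) - s2 t - h *\<^sub>R \<phi> (s2 t) t) \<le> h * (h0 / 3)"
      by (rule uniform_euler_residual[OF smooth_continuous_on[OF \<phi>] s2 \<omega>, where T=T]) (rule that)
    define h' where "h' = min (min h0 (1 / \<gamma>)) (min h1 h2)"
    have h': "h' > 0" using h0 h1 h2 \<gamma> by (simp add: h'_def)
    obtain N :: nat where N: "(T - t0) / h' < real N" using reals_Archimedean2 by blast
    then have "real N > 0" using T h' by (smt (verit) divide_pos_pos)
    define h where "h = (T - t0) / real N"
    have h: "h > 0" "h \<le> h'" "real N * h = T - t0"
      using T N h' \<open>real N > 0\<close> by (simp_all add: h_def field_simps)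
    then have hle: "h \<le> h0" "h \<le> h1" "h \<le> h2" and \<gamma>h: "\<gamma> * h \<le> 1"
      using \<gamma> by (auto simp: h'_def field_simps)
    define tk where "tk k = t0 + real k * h" for k :: nat
    have tk: "tk k \<in> {t0..T}" if "k \<le> N" for k
    proof -
      have "real k * h \<le> real N * h" using that h(1) by (intro mult_right_mono) auto
      then show ?thesis using h(1,3) by (simp add: tk_def)
    qed
    have tk_Suc: "tk (Suc k) = tk k + h" for k by (simp add: tk_def algebra_simps)
    define b where "b k = (1 - \<gamma> * h) ^ k * E0 + \<delta> / \<gamma>" for k
    have b_Suc: "(1 - \<gamma> * h) * b k + h * \<delta> = b (Suc k)" for k
      using \<gamma> by (simp add: b_def field_simps)
    have b_le: "b k \<le> B" for k
    proof -
      have "(1 - \<gamma> * h) ^ k \<le> 1" using \<gamma>h \<gamma> h by (intro power_le_one) auto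
      then have "(1 - \<gamma> * h) ^ k * E0 \<le> E0" using E0 by simp
      moreover have "\<delta> / \<gamma> \<le> 1" using \<delta> \<gamma> by simp
      ultimately show ?thesis by (simp add: b_def B_def)
    qed
    have "\<exists>c v. (\<forall>r\<in>{0..1}. (c has_vector_derivative v r) (at r within {0..1::real})) \<and>
        c 0 = s1 (tk k) \<and> c 1 = s2 (tk k) \<and> (\<forall>r\<in>{0..1}. E (c r) (v r) (tk k) \<le> b k)"
      if "k \<le> N" for k
      using that
    proof (induction k)
      case 0
      show ?case
      proof (rule exI[of _ c0], rule exI[of _ "\<lambda>_. s2 t0 - s1 t0"], intro conjI ballI)
        show "(c0 has_vector_derivative (s2 t0 - s1 t0)) (at r within {0..1})" for r
          unfolding c0_def by (auto intro!: derivative_eq_intros)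
        show "c0 0 = s1 (tk 0)" "c0 1 = s2 (tk 0)" by (simp_all add: c0_def tk_def)
        have "E0 \<le> b 0" using \<delta> \<gamma> by (simp add: b_def)
        then show "E (c0 r) (s2 t0 - s1 t0) (tk 0) \<le> b 0" if "r \<in> {0..1}" for r
          using E0(2)[OF that] by (simp add: tk_def)
      qed
    next
      case (Suc k)
      obtain c v where cv: "\<forall>r\<in>{0..1}. (c has_vector_derivative v r) (at r within {0..1})"
        and ends: "c 0 = s1 (tk k)" "c 1 = s2 (tk k)" and en': "\<forall>r\<in>{0..1}. E (c r) (v r) (tk k) \<le> b k"
        using Suc.IH[OF Suc_leD[OF Suc.prems]] by blast
      note c = cv[rule_format] and en = en'[rule_format]
      have t: "tk k \<in> {t0..T}" using tk Suc.prems by simp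
      have "tk k + h \<le> T" using tk[of "Suc k"] Suc.prems by (simp add: tk_Suc)
      have inK: "(c r, v r, tk k) \<in> K" if r: "r \<in> {0..1}" for r
      proof (rule K[OF t])
        have "norm (\<psi> (c r) (tk k) - \<psi> (c 0) (tk k)) \<le> sqrt (C * b k)"
          by (rule path_energy_bound[OF \<psi> C(2) c en _ r]) (use C in auto)
        also have "\<dots> \<le> sqrt (C * B)" using b_le C(1) by simp
        finally show "norm (\<psi> (c r) (tk k)) \<le> R"
          using R1[OF t] norm_triangle_sub[of "\<psi> (c r) (tk k)" "\<psi> (c 0) (tk k)"]
          unfolding ends R_def by linarith
        show "E (c r) (v r) (tk k) \<le> R" using en[OF r] b_le[of k] by (simp add: R_def)
      qed
      define e1 where "e1 = s1 (tk k + h) - s1 (tk k) - h *\<^sub>R \<phi> (s1 (tk k)) (tk k)"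
      define e2 where "e2 = s2 (tk k + h) - s2 (tk k) - h *\<^sub>R \<phi> (s2 (tk k)) (tk k)"
      have e: "norm e1 \<le> h * (h0 / 3)" "norm e2 \<le> h * (h0 / 3)"
        unfolding e1_def e2_def
        using t h(1) hle \<open>tk k + h \<le> T\<close> res1[of "tk k" h] res2[of "tk k" h] by auto
      \<comment> \<open>an Euler step, with the endpoint errors interpolated linearly so that both ends stay on the solutions\<close>
      define c' where "c' r = c r + h *\<^sub>R \<phi> (c r) (tk k) + (1 - r) *\<^sub>R e1 + r *\<^sub>R e2" for r
      define v' where "v' r = v r + h *\<^sub>R \<phi>_s (c r) (tk k) (v r) + (e2 - e1)" for r
      have der: "(c' has_vector_derivative v' r) (at r within {0..1})" if "r \<in> {0..1}" for r
      proof -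
        have "((\<lambda>r. \<phi> (c r) (tk k)) has_vector_derivative \<phi>_s (c r) (tk k) (v r)) (at r within {0..1})"
          using has_derivative_compose[OF c[OF that, unfolded has_vector_derivative_def] \<phi>_s]
          unfolding has_vector_derivative_def
          by (simp add: linear_scale[OF has_derivative_linear[OF \<phi>_s]])
        then show ?thesis
          unfolding c'_def v'_def using c[OF that] by (auto intro!: derivative_eq_intros)
      qed
      have "E (c' r) (v' r) (tk k + h) \<le> b (Suc k)" if r: "r \<in> {0..1}" for r
      proof -
        define q where "q = ((1 / h) *\<^sub>R ((1 - r) *\<^sub>R e1 + r *\<^sub>R e2), (1 / h) *\<^sub>R (e2 - e1), 0 :: real)"
        have scale: "norm ((1 / h) *\<^sub>R a) \<le> d" if "norm a \<le> h * d" for a :: 'a and d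
          using that h(1) by (simp add: field_simps)
        have "norm ((1 - r) *\<^sub>R e1 + r *\<^sub>R e2) \<le> (1 - r) * norm e1 + r * norm e2"
          using norm_triangle_ineq[of "(1 - r) *\<^sub>R e1" "r *\<^sub>R e2"] r by simp
        also have "\<dots> \<le> h * (h0 / 3)"
          using r convex_bound_le[OF e(1) e(2), of "1 - r" r] by simp
        finally have 1: "norm ((1 / h) *\<^sub>R ((1 - r) *\<^sub>R e1 + r *\<^sub>R e2)) \<le> h0 / 3"
          by (rule scale)
        have 2: "norm ((1 / h) *\<^sub>R (e2 - e1)) \<le> 2 * (h0 / 3)"
          using norm_triangle_ineq4[of e2 e1] e by (intro scale) linarith
        have "norm q \<le> norm ((1 / h) *\<^sub>R ((1 - r) *\<^sub>R e1 + r *\<^sub>R e2)) + norm ((1 / h) *\<^sub>R (e2 - e1))"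
          unfolding q_def
          using norm_Pair_le[of "(1 / h) *\<^sub>R ((1 - r) *\<^sub>R e1 + r *\<^sub>R e2)" "((1 / h) *\<^sub>R (e2 - e1), 0::real)"]
          by (simp add: norm_Pair)
        then have q: "norm q \<le> h0" using 1 2 by linarith
        have eq: "(c r, v r, tk k) + h *\<^sub>R (F (c r, v r, tk k) + q) = (c' r, v' r, tk k + h)"
          using h by (simp add: F_def q_def c'_def v'_def algebra_simps)
        have "E (c' r) (v' r) (tk k + h) \<le> E (c r) (v r) (tk k)
           + h * (frechet_derivative (\<lambda>(s, v, t). E s v t) (at (c r, v r, tk k)) (F (c r, v r, tk k)) + \<delta>)"
          using step[OF inK[OF r] h(1) hle(1) q] unfolding eq by simp
        also have "\<dots> \<le> E (c r) (v r) (tk k) + h * (- \<gamma> * E (c r) (v r) (tk k) + \<delta>)"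
          unfolding F_def using rate h by simp
        also have "\<dots> = (1 - \<gamma> * h) * E (c r) (v r) (tk k) + h * \<delta>" by (simp add: algebra_simps)
        also have "\<dots> \<le> (1 - \<gamma> * h) * b k + h * \<delta>"
          using en[OF r] \<gamma>h by (intro add_right_mono mult_left_mono) auto
        finally show ?thesis by (simp only: b_Suc)
      qed
      moreover have "c' 0 = s1 (tk k + h)" "c' 1 = s2 (tk k + h)"
        by (simp_all add: c'_def e1_def e2_def ends)
      ultimately show ?case
        using der unfolding tk_Suc by blast
    qed
    from this[OF order_refl] obtain c v
      where cv: "\<forall>r\<in>{0..1}. (c has_vector_derivative v r) (at r within {0..1})"
        and ends: "c 0 = s1 (tk N)" "c 1 = s2 (tk N)" and en': "\<forall>r\<in>{0..1}. E (c r) (v r) (tk N) \<le> b N"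
      by blast
    note c = cv[rule_format] and en = en'[rule_format]
    have "tk N = T" using h by (simp add: tk_def)
    have "norm (\<psi> (c 1) (tk N) - \<psi> (c 0) (tk N)) \<le> sqrt (C * b N)"
      by (rule path_energy_bound[OF \<psi> C(2) c en]) (use C in auto)
    then have "(norm (\<psi> (s2 T) T - \<psi> (s1 T) T))\<^sup>2 \<le> (sqrt (C * b N))\<^sup>2"
      unfolding ends \<open>tk N = T\<close> by (rule power_mono) simp
    also have "\<dots> = C * b N"
      using C(1) en[of 0] E_nonneg[of "c 0" "v 0" "tk N"] by simp
    also have "\<dots> \<le> C * (exp (- \<gamma> * (T - t0)) * E0 + \<delta> / \<gamma>)"
    proof -
      have "(1 - \<gamma> * h) ^ N \<le> exp (- \<gamma> * h) ^ N"
        using \<gamma>h exp_ge_add_one_self[of "- \<gamma> * h"] by (intro power_mono) auto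
      also have "\<dots> = exp (- \<gamma> * (T - t0))"
        by (simp add: exp_of_nat_mult[symmetric] h(3)[symmetric])
      finally show ?thesis using C(1) E0 by (simp add: b_def mult_right_mono)
    qed
    finally show ?thesis .
  qed
  note approx = this
  have "(norm (\<psi> (s2 T) T - \<psi> (s1 T) T))\<^sup>2 \<le> (C * E0) * exp (- \<gamma> * (T - t0))" if T: "T > t0" for T
  proof (rule field_le_epsilon)
    fix e :: real assume e: "e > 0"
    define \<delta> where "\<delta> = min \<gamma> (\<gamma> * e / C)"
    have \<delta>: "0 < \<delta>" "\<delta> \<le> \<gamma>" "C * (\<delta> / \<gamma>) \<le> e"
      using e \<gamma> C by (auto simp: \<delta>_def min_def field_simps)
    show "(norm (\<psi> (s2 T) T - \<psi> (s1 T) T))\<^sup>2 \<le> (C * E0) * exp (- \<gamma> * (T - t0)) + e"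
      using approx[OF T \<delta>(1,2)] \<delta>(3) by (simp add: algebra_simps)
  qed
  then show ?thesis by blast
qed

section \<open>Convergence to the optimally controlled state\<close>

lemma has_derivative_vcat:
  assumes "(x has_derivative x') (at t within S)" "(U has_derivative U') (at t within S)"
  shows "((\<lambda>t. vcat (x t) (U t)) has_derivative (\<lambda>h. vcat (x' h) (U' h))) (at t within S)"
proof -
  have "bounded_linear (\<lambda>p :: (real^'k::finite) \<times> (real^'l::finite). vcat (fst p) (snd p))"
    by (auto simp: linear_conv_bounded_linear[symmetric] vcat_def vec_eq_iff intro!: linearI split: sum.splits)
  from bounded_linear.has_derivative[OF this has_derivative_Pair[OF assms]] show ?thesis by simp
qed

lemma norm_le_norm_parts: "norm s \<le> norm (upper_part s) + norm (lower_part s)"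
proof (rule power2_le_imp_le)
  show "(norm s)\<^sup>2 \<le> (norm (upper_part s) + norm (lower_part s))\<^sup>2"
    using inner_sum_parts[of s s] by (simp add: power2_norm_eq_inner[symmetric] power2_sum)
qed simp

context continuation_control
begin

text \<open>Since \<open>\<eta>\<close> vanishes at \<open>0\<close>, the set \<open>\<zeta> = 0\<close> of optimal inputs is invariant under the closed
  loop, and on it the plant is optimally controlled.\<close>

lemma optimal_solution:
  assumes \<eta>0: "\<And>t. \<eta> 0 t = 0"
    and xs: "solution_from (\<lambda>x t. f x (Pi0 *v U_opt V x t) t) t0 xs"
  shows "solution_from \<phi> t0 (\<lambda>t. vcat (xs t) (U_opt V (xs t) t))"
  unfolding solution_from_def
proof (intro allI impI)
  fix t assume t: "t \<ge> t0"
  let ?F = "at t within {t0..}"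
  define U where "U = U_opt V (xs t) t"
  define x' where "x' = f (xs t) (Pi0 *v U) t"
  define U' where "U' = - (matrix_inv (zeta_U V U (xs t) t) *v (zeta_x V U (xs t) t *v x' + zeta_t V U (xs t) t))"
  have x: "(xs has_derivative (\<lambda>h. h *\<^sub>R x')) ?F"
    using xs t unfolding solution_from_def has_vector_derivative_def x'_def U_def by simp
  have "((\<lambda>r. (xs r, r)) has_derivative (\<lambda>h. (h *\<^sub>R x', h))) ?F"
    by (intro has_derivative_Pair x has_derivative_ident)
  from has_derivative_compose[OF this U_opt_has_derivative]
  have "((\<lambda>r. U_opt V (xs r) r) has_derivative (\<lambda>h. - (matrix_inv (zeta_U V U (xs t) t) *v
      (zeta_x V U (xs t) t *v (h *\<^sub>R x') + h *\<^sub>R zeta_t V U (xs t) t)))) ?F"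
    by (simp add: U_def)
  moreover have eq: "- (matrix_inv (zeta_U V U (xs t) t) *v
      (zeta_x V U (xs t) t *v (h *\<^sub>R x') + h *\<^sub>R zeta_t V U (xs t) t)) = h *\<^sub>R U'" for h
    unfolding U'_def
    by (simp add: matrix_vector_mult_scaleR scaleR_add_right[symmetric] del: scaleR_add_right)
  ultimately have "((\<lambda>r. U_opt V (xs r) r) has_derivative (\<lambda>h. h *\<^sub>R U')) ?F" by (simp only: eq)
  from has_derivative_vcat[OF x this]
  have "((\<lambda>r. vcat (xs r) (U_opt V (xs r) r)) has_derivative (\<lambda>h. vcat (h *\<^sub>R x') (h *\<^sub>R U'))) ?F" .
  moreover have "vcat (h *\<^sub>R x') (h *\<^sub>R U') = h *\<^sub>R vcat x' U'" for h
    by (simp add: vcat_def vec_eq_iff split: sum.splits)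
  moreover have "\<phi> (vcat (xs t) (U_opt V (xs t) t)) t = vcat x' U'"
  proof -
    have "zeta V U (xs t) t = 0" unfolding U_def by (rule zeta_U_opt)
    then have "continuation_rhs f V \<eta> U (xs t) t = - (zeta_x V U (xs t) t *v x' + zeta_t V U (xs t) t)"
      by (simp add: continuation_rhs_def \<eta>0 x'_def)
    moreover have "A *v (- w) = - (A *v w)" for A :: "real^('h \<times> 'm)^('h \<times> 'm)" and w
      using matrix_vector_mult_diff_distrib[of A 0 w] by simp
    ultimately show ?thesis
      unfolding U_def[symmetric]
      by (simp only: closed_loop_def Let_def upper_part_vcat lower_part_vcat x'_def U'_def)
  qed
  ultimately show "((\<lambda>t. vcat (xs t) (U_opt V (xs t) t)) has_vector_derivative
      \<phi> (vcat (xs t) (U_opt V (xs t) t)) t) ?F"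
    unfolding has_vector_derivative_def by simp
qed

definition coords :: "real^('n + 'h \<times> 'm) \<Rightarrow> real \<Rightarrow> (real^'n) \<times> (real^('h \<times> 'm))" where
  "coords s t = (upper_part s, zeta_at s t)"

definition coords_s :: "real^('n + 'h \<times> 'm) \<Rightarrow> real \<Rightarrow> real^('n + 'h \<times> 'm) \<Rightarrow> (real^'n) \<times> (real^('h \<times> 'm))" where
  "coords_s s t v = (upper_part v, zeta_s V s t *v v)"

lemma coords_has_derivative: "((\<lambda>s. coords s t) has_derivative coords_s s t) (at s)"
  unfolding coords_def coords_s_def[abs_def] zeta_s_mult_frechet
  by (intro has_derivative_Pair bounded_linear_imp_has_derivative bounded_linear_upper_part
      has_derivative_partial(1)[OF smooth_differentiable[OF smooth_zeta_at]])

lemma coords_le_energy: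
  assumes P_pos: "uniformly_pos_def P" and Q_pos: "uniformly_pos_def Q" and \<kappa>: "\<kappa> > 0"
  obtains C where "C > 0" "\<And>s v t. (norm (coords_s s t v))\<^sup>2 \<le> C * energy (contr_metric V P Q \<kappa>) s v t"
proof -
  obtain \<epsilon>P where \<epsilon>P: "\<epsilon>P > 0" "\<And>x t v. \<epsilon>P * (v \<bullet> v) \<le> energy P x v t"
    using P_pos unfolding uniformly_pos_def_def loewner_le_mat_iff energy_def by blast
  obtain \<epsilon>Q where \<epsilon>Q: "\<epsilon>Q > 0" "\<And>x t v. \<epsilon>Q * (v \<bullet> v) \<le> energy Q x v t"
    using Q_pos unfolding uniformly_pos_def_def loewner_le_mat_iff energy_def by blast
  define m where "m = min \<epsilon>P (\<kappa> * \<epsilon>Q)"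
  have m: "m > 0" "m \<le> \<epsilon>P" "m \<le> \<kappa> * \<epsilon>Q" using \<epsilon>P \<epsilon>Q \<kappa> by (simp_all add: m_def)
  show thesis
  proof (rule that[of "1 / m"])
    fix s v t
    define \<delta> w where "\<delta> = upper_part v" and "w = zeta_s V s t *v v"
    have "m * (\<delta> \<bullet> \<delta> + w \<bullet> w) \<le> \<epsilon>P * (\<delta> \<bullet> \<delta>) + \<kappa> * \<epsilon>Q * (w \<bullet> w)"
      unfolding distrib_left by (intro add_mono mult_right_mono m) auto
    also have "\<dots> \<le> energy (contr_metric V P Q \<kappa>) s v t"
      unfolding energy_contr_metric \<delta>_def w_def mult.assoc
      by (intro add_mono \<epsilon>P(2) mult_left_mono \<epsilon>Q(2)) (use \<kappa> in simp)
    finally show "(norm (coords_s s t v))\<^sup>2 \<le> 1 / m * energy (contr_metric V P Q \<kappa>) s v t"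
      using m(1) by (simp add: coords_s_def \<delta>_def w_def power2_norm_eq_inner field_simps)
  qed (use m in simp)
qed

text \<open>Strong monotonicity of \<open>\<zeta>\<close> in \<open>U\<close> bounds the input in terms of \<open>x\<close> and the residual.  Over a
  finite time the states therefore stay in a compact set; there \<open>\<zeta>\<^sub>x\<close> is bounded, and the energy
  controls the variation of the input as well.\<close>

lemma bounded_energy_sublevel:
  assumes C: "\<And>s v t. (norm (coords_s s t v))\<^sup>2 \<le> C * energy (contr_metric V P Q \<kappa>) s v t" and "C > 0"
  shows "bounded {(s, v). \<exists>t\<in>{t0..T}. norm (coords s t) \<le> R \<and> energy (contr_metric V P Q \<kappa>) s v t \<le> R}"
proof -
  have "compact ((\<lambda>p. zeta V 0 (fst p) (snd p)) ` (cball 0 R \<times> {t0..T}))"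
    by (intro compact_continuous_image smooth_continuous_on smooth_compose3[OF smooth_zeta] smooth_intros
        compact_Times compact_cball compact_Icc)
  from compact_imp_bounded[OF this] obtain b1 where "\<forall>y \<in> (\<lambda>p. zeta V 0 (fst p) (snd p)) ` (cball 0 R \<times> {t0..T}). norm y \<le> b1"
    unfolding bounded_iff by blast
  then have b1: "norm (zeta V 0 x t) \<le> b1" if "norm x \<le> R" "t \<in> {t0..T}" for x t
    using that by force
  define R1 where "R1 = (R + b1) / lam"
  define r where "r = sqrt (C * R)"
  let ?w = "\<lambda>p. zeta_x V (fst p) (fst (snd p)) (fst (snd (snd p))) *v (snd (snd (snd p)))"
  have "compact (?w ` (cball 0 R1 \<times> cball 0 R \<times> {t0..T} \<times> cball 0 r))"
    by (intro compact_continuous_image smooth_continuous_on smooth_matrix_vector_mult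
        smooth_compose3[OF smooth_zeta_partials(2)] smooth_intros compact_Times compact_cball compact_Icc)
  from compact_imp_bounded[OF this] obtain b2 where "\<forall>y \<in> ?w ` (cball 0 R1 \<times> cball 0 R \<times> {t0..T} \<times> cball 0 r). norm y \<le> b2"
    unfolding bounded_iff by blast
  then have b2: "norm (zeta_x V U x t *v d) \<le> b2"
    if "norm U \<le> R1" "norm x \<le> R" "t \<in> {t0..T}" "norm d \<le> r" for U x t d
    using that by force
  have "norm (s, v) \<le> (R + R1) + (r + (r + b2) / lam)"
    if t: "t \<in> {t0..T}" and cR: "norm (coords s t) \<le> R" and eR: "energy (contr_metric V P Q \<kappa>) s v t \<le> R" for s v t
  proof -
    define x U where "x = upper_part s" and "U = lower_part s"
    have x: "norm x \<le> R" and z: "norm (zeta_at s t) \<le> R"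
      using cR norm_fst_le[of x "zeta_at s t"] norm_snd_le[of "zeta_at s t" x]
      by (auto simp: coords_def x_def)
    have "lam * norm (U - 0) \<le> norm (zeta V U x t - zeta V 0 x t)" by (rule zeta_lower_bound)
    also have "\<dots> \<le> R + b1"
      using norm_triangle_ineq4[of "zeta V U x t" "zeta V 0 x t"] z b1[OF x t]
      by (simp add: zeta_at_def x_def U_def)
    finally have U: "norm U \<le> R1" using lam_pos by (simp add: R1_def field_simps)
    have "(norm (coords_s s t v))\<^sup>2 \<le> C * R"
      using C[of s t v] eR \<open>C > 0\<close> by (meson less_imp_le mult_left_mono order_trans)
    then have "norm (coords_s s t v) \<le> r" unfolding r_def by (rule real_le_rsqrt)
    then have d: "norm (upper_part v) \<le> r" and w: "norm (zeta_s V s t *v v) \<le> r"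
      using norm_fst_le[of "upper_part v" "zeta_s V s t *v v"] norm_snd_le[of "zeta_s V s t *v v" "upper_part v"]
      by (auto simp: coords_s_def)
    have "norm (lower_part v) \<le> norm (zeta_s V s t *v v - zeta_x V U x t *v upper_part v) / lam"
      unfolding x_def U_def by (subst lower_part_variation[of v s t]) (rule norm_zeta_U_inv)
    also have "\<dots> \<le> (r + b2) / lam"
      using norm_triangle_ineq4[of "zeta_s V s t *v v" "zeta_x V U x t *v upper_part v"] w b2[OF U x t d] lam_pos
      by (intro divide_right_mono) auto
    finally have "norm v \<le> r + (r + b2) / lam"
      using norm_le_norm_parts[of v] d by linarith
    moreover have "norm s \<le> R + R1"
      using norm_le_norm_parts[of s] x U by (simp add: x_def U_def)
    ultimately show ?thesis using norm_Pair_le[of s v] by linarith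
  qed
  then show ?thesis unfolding bounded_iff by blast
qed

theorem converges_to_optimal_state:
  assumes P_pos: "uniformly_pos_def P" and Q_pos: "uniformly_pos_def Q" and \<kappa>: "\<kappa> > 0" and \<gamma>: "\<gamma> > 0"
    and L: "\<And>s t. L_op (contr_metric V P Q \<kappa>) \<phi> \<gamma> s t \<preceq>\<^sub>L 0"
    and \<eta>0: "\<And>t. \<eta> 0 t = 0"
    and s: "solution_from \<phi> t0 s"
    and xs: "solution_from (\<lambda>x t. f x (Pi0 *v U_opt V x t) t) t0 xs"
  shows "((\<lambda>t. upper_part (s t) - xs t) \<longlongrightarrow> 0) at_top"
proof -
  let ?M = "contr_metric V P Q \<kappa>"
  let ?ss = "\<lambda>t. vcat (xs t) (U_opt V (xs t) t)"
  obtain C where C: "C > 0" "\<And>s v t. (norm (coords_s s t v))\<^sup>2 \<le> C * energy ?M s v t"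
    using coords_le_energy[OF P_pos Q_pos \<kappa>] by blast
  have rate: "frechet_derivative (\<lambda>(s, v, t). energy ?M s v t) (at (s, v, t)) (\<phi> s t, \<phi>_s s t v, 1)
      \<le> - \<gamma> * energy ?M s v t" for s v t
  proof -
    have "v \<bullet> (L_op ?M \<phi> \<gamma> s t *v v) \<le> 0" using L unfolding loewner_le_0_iff by blast
    then show ?thesis
      unfolding inner_L_op[where g=\<phi>, OF smooth_contr_metric transpose_contr_metric \<phi>_has_derivative]
        energy_rate_def by simp
  qed
  have cont: "continuous_on UNIV (\<lambda>(s, t). coords s t)"
    unfolding coords_def case_prod_beta'
    by (intro smooth_continuous_on smooth_Pair smooth_compose2[OF smooth_zeta_at] smooth_intros)
  obtain A where A: "\<And>T. T > t0 \<Longrightarrow> (norm (coords (s T) T - coords (?ss T) T))\<^sup>2 \<le> A * exp (- \<gamma> * (T - t0))"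
    using solutions_contract[OF smooth_closed_loop \<phi>_has_derivative smooth_energy[OF smooth_contr_metric]
        rate \<gamma> cont coords_has_derivative C bounded_energy_sublevel[OF C(2,1)] optimal_solution[OF \<eta>0 xs] s]
    by blast
  have le: "norm (upper_part (s T) - xs T) \<le> sqrt (A * exp (- \<gamma> * (T - t0)))" if "T > t0" for T
  proof (rule real_le_rsqrt)
    have "norm (upper_part (s T) - xs T) \<le> norm (coords (s T) T - coords (?ss T) T)"
      unfolding coords_def by (simp add: norm_fst_le)
    then show "(norm (upper_part (s T) - xs T))\<^sup>2 \<le> A * exp (- \<gamma> * (T - t0))"
      using A[OF that] by (meson norm_ge_zero order_trans power_mono)
  qed
  have "filterlim (\<lambda>T. \<gamma> * (- t0 + T)) at_top at_top"
    by (intro filterlim_tendsto_pos_mult_at_top[OF tendsto_const \<gamma>]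
        filterlim_tendsto_add_at_top[OF tendsto_const filterlim_ident])
  then have "((\<lambda>T. exp (- (\<gamma> * (- t0 + T)))) \<longlongrightarrow> 0) at_top"
    by (intro filterlim_compose[OF exp_at_bot] filterlim_compose[OF filterlim_uminus_at_bot_at_top])
  then have "((\<lambda>T. sqrt (A * exp (- (\<gamma> * (- t0 + T))))) \<longlongrightarrow> sqrt (A * 0)) at_top"
    by (intro tendsto_intros)
  then have "((\<lambda>T. sqrt (A * exp (- \<gamma> * (T - t0)))) \<longlongrightarrow> 0) at_top"
    by (simp add: algebra_simps)
  then show ?thesis
    by (rule Lim_null_comparison[rotated]) (use le in \<open>auto intro!: eventually_mono[OF eventually_gt_at_top[of t0]]\<close>)
qed

end

theorem corollary1:
  fixes f :: "real^'n \<Rightarrow> real^'m \<Rightarrow> real \<Rightarrow> real^'n"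
    and fd :: "real^'n \<Rightarrow> real^'m \<Rightarrow> real \<Rightarrow> real^'n"
    and tk :: "nat \<Rightarrow> real \<Rightarrow> real"
    and ell :: "real^'n \<Rightarrow> real^'m \<Rightarrow> real \<Rightarrow> real"
    and \<Phi> :: "real^'n \<Rightarrow> real \<Rightarrow> real"
    and \<eta> :: "real^('h::{finite,linorder} \<times> 'm) \<Rightarrow> real \<Rightarrow> real^('h \<times> 'm)"
    and P :: "real^'n \<Rightarrow> real \<Rightarrow> real^'n^'n"
    and Q :: "real^('h \<times> 'm) \<Rightarrow> real \<Rightarrow> real^('h \<times> 'm)^('h \<times> 'm)"
    and V :: "real^('h \<times> 'm) \<Rightarrow> real^'n \<Rightarrow> real \<Rightarrow> real"
    and lamH cuf \<beta>\<^sub>x \<beta>\<^sub>z \<beta>\<^sub>p cP :: real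
  assumes smooth_f: "smooth (\<lambda>(x, u, t). f x u t)"
    and smooth_fd: "smooth (\<lambda>(x, u, t). fd x u t)"
    and smooth_tk: "\<And>k. k \<le> CARD('h) \<Longrightarrow> smooth (tk k)"
    and smooth_ell: "smooth (\<lambda>(x, u, t). ell x u t)"
    and smooth_\<Phi>: "smooth (\<lambda>(x, t). \<Phi> x t)"
    and smooth_\<eta>: "smooth (\<lambda>(z, t). \<eta> z t)"
    and V_eq: "V = ocp_cost fd tk ell \<Phi>"
    and H_bound: "lamH > 0" "\<And>U x t. mat lamH \<preceq>\<^sub>L zeta_U V U x t"
    and f_u_bound: "cuf > 0" "\<And>x u t. mat_norm (jacobian (\<lambda>u. f x u t) (at u)) \<le> cuf"
    and smooth_P: "smooth (\<lambda>(x, t). P x t)"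
    and smooth_Q: "smooth (\<lambda>(z, t). Q z t)"
    and P_pos: "uniformly_pos_def P"
    and Q_pos: "uniformly_pos_def Q"
    and P_upper: "\<And>x t. P x t \<preceq>\<^sub>L mat cP"
    and betas: "\<beta>\<^sub>x > \<beta>\<^sub>p" "\<beta>\<^sub>p > 0" "\<beta>\<^sub>z > 0"
    and L_Q: "\<And>z t. L_op Q \<eta> \<beta>\<^sub>z z t \<preceq>\<^sub>L 0"
    and P_K: "\<And>U x t. sym_sum (P_xU f V P x (Pi0 *v U - Pi0 *v U_opt V x t) t ** K_mat V U x t)
                - \<beta>\<^sub>p *\<^sub>R P x t \<preceq>\<^sub>L 0"
    and L_P: "\<And>x ur t. L_op P (\<lambda>x t. f_res f V x ur t) (\<beta>\<^sub>x + \<beta>\<^sub>p) x t \<preceq>\<^sub>L 0"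
  shows "(\<exists>\<kappa>>0. \<exists>\<gamma>>0. \<forall>s t. L_op (contr_metric V P Q \<kappa>) (closed_loop f V \<eta>) \<gamma> s t \<preceq>\<^sub>L 0)
    \<and> ((\<exists>czx>0. \<forall>U x t. mat_norm (zeta_x V U x t) \<le> czx) \<longrightarrow> contracting (closed_loop f V \<eta>))
    \<and> ((\<forall>t. \<eta> 0 t = 0) \<longrightarrow>
        (\<forall>t0 s xs. solution_from (closed_loop f V \<eta>) t0 s \<longrightarrow>
           solution_from (\<lambda>x t. f x (Pi0 *v U_opt V x t) t) t0 xs \<longrightarrow>
           ((\<lambda>t. upper_part (s t) - xs t) \<longlongrightarrow> 0) at_top))"
proof -
  have sym: "transpose (W y t) = W y t" if "uniformly_pos_def W" for W :: "'y \<Rightarrow> real \<Rightarrow> real^'k^'k" and y t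
    using that unfolding uniformly_pos_def_def loewner_le_mat_iff by blast
  interpret continuation_control V lamH f \<eta> P Q
  proof
    show "smooth (\<lambda>(U, x, t). V U x t)"
      unfolding V_eq by (rule smooth_ocp_cost[OF smooth_fd smooth_ell smooth_\<Phi> smooth_tk])
  qed (fact H_bound smooth_f smooth_\<eta> smooth_P smooth_Q sym[OF P_pos] sym[OF Q_pos])+
  have "\<beta>\<^sub>x > 0" using betas by simp
  then obtain \<kappa> \<gamma> where \<kappa>: "\<kappa> > 0" and \<gamma>: "\<gamma> > 0"
    and L: "\<And>s t. L_op (contr_metric V P Q \<kappa>) (closed_loop f V \<eta>) \<gamma> s t \<preceq>\<^sub>L 0"
    using L_op_contr_metric_le[OF f_u_bound(2) P_pos Q_pos P_upper _ betas(3) L_Q P_K L_P] by blast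
  show ?thesis
  proof (intro conjI impI allI)
    show "\<exists>\<kappa>>0. \<exists>\<gamma>>0. \<forall>s t. L_op (contr_metric V P Q \<kappa>) (closed_loop f V \<eta>) \<gamma> s t \<preceq>\<^sub>L 0"
      using \<kappa> \<gamma> L by blast
  next
    assume "\<exists>czx>0. \<forall>U x t. mat_norm (zeta_x V U x t) \<le> czx"
    then have "uniformly_pos_def (contr_metric V P Q \<kappa>)"
      using uniformly_pos_def_contr_metric[OF P_pos Q_pos \<kappa>] by blast
    then show "contracting (closed_loop f V \<eta>)"
      unfolding contracting_def using smooth_contr_metric \<gamma> L by blast
  next
    fix t0 s xs
    assume "\<forall>t. \<eta> 0 t = 0" and "solution_from (closed_loop f V \<eta>) t0 s"
      and "solution_from (\<lambda>x t. f x (Pi0 *v U_opt V x t) t) t0 xs"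
    then show "((\<lambda>t. upper_part (s t) - xs t) \<longlongrightarrow> 0) at_top"
      using converges_to_optimal_state[OF P_pos Q_pos \<kappa> \<gamma> L] by blast
  qed
qed

end
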